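(* Let $\eta,\theta\in\mathbb{R}$ with $1+\eta\theta\ge 0$. Suppose $(X_t)_{t\ge0}$ is a centered square-integrable separable stochastic process such that, with $\mathcal{G}_{s,u}=\sigma\{X_r:r\in[0,s]\cup[u,\infty)\}$: (i) $E(X_t)=0$ and $E(X_tX_s)=\min\{t,s\}$ for all $s,t\ge0$; (ii) for all $0\le s<t<u$, $$E(X_t\mid\mathcal{G}_{s,u})=\frac{u-t}{u-s}X_s+\frac{t-s}{u-s}X_u;$$ (iii) for all $0\le s<t<u$, $$\mathrm{Var}(X_t\mid\mathcal{G}_{s,u})=\frac{(u-t)(t-s)}{u}\left(1+\eta\,\frac{uX_s-sX_u}{u-s}+\theta\,\frac{X_u-X_s}{u-s}+\frac{(X_u-X_s)(sX_u-uX_s)}{(u-s)^2}\right).$$ Then $(X_t)_{t\ge0}$ is the Markov process started at $X_0=0$ with transition probabilities $P_{s,t}(x,dy)$, $0\le s<t$ (defined in the context from $\eta,\theta$); that is, $(X_t)$ has the finite-dimensional distributions of that Markov process.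
   Context: Conditional variance: $\mathrm{Var}(X\mid\mathcal{F})=E(X^2\mid\mathcal{F})-(E(X\mid\mathcal{F}))^2$. Fix $\eta,\theta\in\mathbb{R}$ with $1+\eta\theta\ge0$. For $0\le s<t$ and $x\in\mathbb{R}$, define monic polynomials $Q_n(y;x,t,s)$ in the variable $y$ by $Q_0(y;x,t,s)=1$, $Q_1(y;x,t,s)=y-x$, $$yQ_1(y;x,t,s)=Q_2(y;x,t,s)+((t-s)\eta+\theta)Q_1(y;x,t,s)+(t-s)(1+x\eta)Q_0(y;x,t,s),$$ and for $n\ge 2$ $$yQ_n(y;x,t,s)=Q_{n+1}(y;x,t,s)+(t\eta+\theta)Q_n(y;x,t,s)+t(1+\eta\theta)Q_{n-1}(y;x,t,s).$$ For $x$ in $E=\{x\in\mathbb{R}:1+\eta x\ge 0\}$, $P_{s,t}(x,dy)$ is the unique probability measure on $\mathbb{R}$ making the polynomials $\{Q_n(\cdot;x,t,s):n\ge0\}$ orthogonal, i.e. $\int Q_m(y;x,t,s)Q_n(y;x,t,s)\,P_{s,t}(x,dy)=0$ for $m\ne n$ (some $Q_n$ may have norm zero); it has bounded support. These kernels are regarded as transition probabilities on the state space $E$. *)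

theory Defs
  imports "HOL-Probability.Probability" "HOL-Computational_Algebra.Polynomial"
begin

definition sigma_gen :: "'a measure \<Rightarrow> (real \<Rightarrow> 'a \<Rightarrow> real) \<Rightarrow> real set \<Rightarrow> 'a measure" where
  "sigma_gen M X T = sigma (space M) {X r -` B \<inter> space M | r B. r \<in> T \<and> B \<in> sets borel}"

definition cond_var :: "'a measure \<Rightarrow> 'a measure \<Rightarrow> ('a \<Rightarrow> real) \<Rightarrow> 'a \<Rightarrow> real" where
  "cond_var M F Y \<omega> = real_cond_exp M F (\<lambda>\<omega>. (Y \<omega>)\<^sup>2) \<omega> - (real_cond_exp M F Y \<omega>)\<^sup>2"

text \<open>
  Separability in the sense of Doob, for the time set $[0,\infty)$: the sets $F$ below range over
  all closed intervals, bounded or not. The variant in which $F$ ranges over all closed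
  sets is a stronger condition.
\<close>

definition separable_process :: "'a measure \<Rightarrow> (real \<Rightarrow> 'a \<Rightarrow> real) \<Rightarrow> bool" where
  "separable_process M X \<longleftrightarrow>
     (\<exists>D N. countable D \<and> D \<subseteq> {0..} \<and> N \<in> null_sets M \<and>
        (\<forall>a b F. closed F \<and> is_interval F \<longrightarrow>
           {\<omega> \<in> space M. \<forall>t \<in> {a<..<b} \<inter> D. X t \<omega> \<in> F}
             - {\<omega> \<in> space M. \<forall>t \<in> {a<..<b} \<inter> {0..}. X t \<omega> \<in> F} \<subseteq> N))"

text \<open>
  The polynomials $Q_n(y;x,t,s)$ in the variable $y$; multiplication by $y$ is multiplication by
  the polynomial \<open>[:0, 1:]\<close>, and each recurrence is solved for its term of highest index.
\<close>

fun Q_poly :: "real \<Rightarrow> real \<Rightarrow> nat \<Rightarrow> real \<Rightarrow> real \<Rightarrow> real \<Rightarrow> real poly" where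
  "Q_poly \<eta> \<theta> 0 x t s = 1"
| "Q_poly \<eta> \<theta> (Suc 0) x t s = [:- x, 1:]"
| "Q_poly \<eta> \<theta> (Suc (Suc 0)) x t s =
     [:0, 1:] * Q_poly \<eta> \<theta> (Suc 0) x t s
       - smult ((t - s) * \<eta> + \<theta>) (Q_poly \<eta> \<theta> (Suc 0) x t s)
       - smult ((t - s) * (1 + x * \<eta>)) (Q_poly \<eta> \<theta> 0 x t s)"
| "Q_poly \<eta> \<theta> (Suc (Suc (Suc n))) x t s =
     [:0, 1:] * Q_poly \<eta> \<theta> (Suc (Suc n)) x t s
       - smult (t * \<eta> + \<theta>) (Q_poly \<eta> \<theta> (Suc (Suc n)) x t s)
       - smult (t * (1 + \<eta> * \<theta>)) (Q_poly \<eta> \<theta> (Suc n) x t s)"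

definition state_space :: "real \<Rightarrow> real set" where
  "state_space \<eta> = {x. 1 + \<eta> * x \<ge> 0}"

definition orthogonalizes :: "real measure \<Rightarrow> (nat \<Rightarrow> real poly) \<Rightarrow> bool" where
  "orthogonalizes \<mu> p \<longleftrightarrow>
     (\<forall>m n. integrable \<mu> (\<lambda>y. poly (p m) y * poly (p n) y)) \<and>
     (\<forall>m n. m \<noteq> n \<longrightarrow> (\<integral>y. poly (p m) y * poly (p n) y \<partial>\<mu>) = 0)"

text \<open>Only meaningful for $0 \le s < t$ and \<open>x \<in> state_space \<eta>\<close>.\<close>

definition trans_kernel ::
    "real \<Rightarrow> real \<Rightarrow> real \<Rightarrow> real \<Rightarrow> real \<Rightarrow> real measure" where
  "trans_kernel \<eta> \<theta> s t x =
     (THE \<mu>. prob_space \<mu> \<and> sets \<mu> = sets borel \<and> orthogonalizes \<mu> (\<lambda>n. Q_poly \<eta> \<theta> n x t s))"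

text \<open>
  In the following, \<open>P s t x\<close> is the law at time \<open>t\<close> of a process that is
  in the state \<open>x\<close> of \<open>E\<close> at time \<open>s\<close>.
\<close>

definition markov_process_on ::
    "'a measure \<Rightarrow> real set \<Rightarrow> (real \<Rightarrow> real \<Rightarrow> real \<Rightarrow> real measure) \<Rightarrow> real
       \<Rightarrow> (real \<Rightarrow> 'a \<Rightarrow> real) \<Rightarrow> bool" where
  "markov_process_on M E P x0 X \<longleftrightarrow>
     (AE \<omega> in M. X 0 \<omega> = x0) \<and>
     (\<forall>t\<ge>0. AE \<omega> in M. X t \<omega> \<in> E) \<and>
     (\<forall>s t B. 0 \<le> s \<and> s < t \<and> B \<in> sets borel \<longrightarrow>
        (AE \<omega> in M. real_cond_exp M (sigma_gen M X {0..s}) (\<lambda>\<omega>. indicator B (X t \<omega>)) \<omega>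
                     = measure (P s t (X s \<omega>)) B))"

text \<open>
  For \<open>s < t\<^sub>1 < \<dots> < t\<^sub>n\<close>, the value of \<open>path_prob E P s x [(t\<^sub>1, B\<^sub>1), \<dots>, (t\<^sub>n, B\<^sub>n)]\<close> is
  the iterated integral
  $\int_{B_1} P_{s,t_1}(x,dy_1) \int_{B_2} P_{t_1,t_2}(y_1,dy_2) \cdots
   \int_{B_n} P_{t_{n-1},t_n}(y_{n-1},dy_n)$.
\<close>

fun path_prob ::
    "real set \<Rightarrow> (real \<Rightarrow> real \<Rightarrow> real \<Rightarrow> real measure) \<Rightarrow> real \<Rightarrow> real
       \<Rightarrow> (real \<times> real set) list \<Rightarrow> ennreal" where
  "path_prob E P s x [] = 1"
| "path_prob E P s x ((t, B) # l) =
     (\<integral>\<^sup>+ y. indicator (B \<inter> E) y * path_prob E P t y l \<partial>P s t x)"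

definition has_markov_fdds ::
    "'a measure \<Rightarrow> real set \<Rightarrow> (real \<Rightarrow> real \<Rightarrow> real \<Rightarrow> real measure) \<Rightarrow> real
       \<Rightarrow> (real \<Rightarrow> 'a \<Rightarrow> real) \<Rightarrow> bool" where
  "has_markov_fdds M E P x0 X \<longleftrightarrow>
     (\<forall>B0 \<in> sets borel. \<forall>l :: (real \<times> real set) list.
        sorted_wrt (<) (0 # map fst l) \<and> (\<forall>(t, B) \<in> set l. B \<in> sets borel) \<longrightarrow>
        emeasure M {\<omega> \<in> space M. X 0 \<omega> \<in> B0 \<and> (\<forall>(t, B) \<in> set l. X t \<omega> \<in> B)}
          = indicator B0 x0 * path_prob E P 0 x0 l)"

end

theory Submission
  imports Defs "HOL-Real_Asymp.Real_Asymp"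
begin

text \<open>
  Write \<open>F\<^sub>s\<close> for the \<open>\<sigma>\<close>-algebra of the past of time \<open>s\<close>. The hypotheses determine all conditional
  moments of \<open>X\<^sub>t\<close> given \<open>F\<^sub>s\<close>; they are polynomials in \<open>X\<^sub>s\<close> and turn out to be the moments of
  $P_{s,t}(X_s, dy)$. Since all the laws involved have bounded support, moments determine them, and
  the Markov property with the kernel $P_{s,t}$ follows.

  \<^emph>\<open>From two-sided to one-sided conditioning.\<close> The hypotheses describe \<open>X\<^sub>t\<close> given the past of \<open>s\<close> and the
  future of \<open>u\<close>. As \<open>u\<close> tends to infinity they become $E(X_t | F_s) = X_s$ and
  $E(X_t^2 | F_s) = X_s^2 + (t-s)(1 + \<eta> X_s)$ (\<open>forward_linear\<close>, \<open>forward_square\<close>). The last factor is a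
  conditional variance, so \<open>X\<^sub>s\<close> lies in the state space.

  \<^emph>\<open>Martingale polynomials.\<close> The polynomials $p_n(y;t) = Q_n(y;0,t,0)$ satisfy
  $E(p_n(X_t;t) | F_s) = p_n(X_s;s)$ (\<open>expectation_martingale_poly\<close>). If this is known up to degree \<open>n\<close>, one
  evaluates $E(X_t p_n(X_u;u) | F_s)$ and $E(X_t^2 p_{n-1}(X_u;u) | F_s)$ for $s < t < u$ in two ways,
  conditioning first on \<open>F\<^sub>t\<close> or first on \<open>F\<^sub>s\<close> and \<open>X\<^sub>u\<close>. This gives two linear equations for the two
  unknowns $E(p_{n+1}(X_t;t) | F_s)$ and $E(p_{n+1}(X_u;u) | F_s)$. The coefficients of the second
  unknown are $(t-s)/(u-s)$ and $t(t-s)/(u(u-s))$. They differ, so the solution is unique, and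
  $p_{n+1}(X_s;s)$ solves both equations (\<open>martingale_step_algebra\<close>). The argument needs finite moments of all
  orders; these come from comparing \<open>X\<^sub>t\<close> with \<open>X\<^bsub>2t\<^esub>\<close> (\<open>integrable_X_power\<close>).

  \<^emph>\<open>From \<open>p\<^sub>n\<close> to \<open>Q\<^sub>n\<close>.\<close> Two generating functions show that \<open>Q\<^sub>n(y;x,t,s)\<close> is a combination of the
  differences $p_k(y;t) - p_k(x;s)$ with coefficients that depend on \<open>x\<close> and \<open>s\<close> alone
  (\<open>Q_poly_martingale_poly\<close>). Hence $E(Q_n(X_t;X_s,t,s) | F_s) = 0$ for \<open>n \<ge> 1\<close>, which is all that is
  needed to compute the conditional moments (\<open>conditional_moment\<close>). For \<open>s = 0\<close> it also bounds the moments of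
  \<open>X\<^sub>t\<close> geometrically, so \<open>X\<^sub>t\<close> is bounded (\<open>AE_bounded_X\<close>).

  \<^emph>\<open>The kernel.\<close> For \<open>x\<close> in the support of the law of \<open>X\<^sub>s\<close>, the measure $P_{s,t}(x, dy)$ is obtained as
  a weak limit of the laws of \<open>X\<^sub>t\<close> conditioned on \<open>X\<^sub>s\<close> being close to \<open>x\<close> (\<open>trans_kernel_on_support\<close>). The
  remaining \<open>x\<close> form a null set, so changing the kernel there yields a measurable kernel for which
  the Markov property follows by comparing moments (\<open>markov_nn_integral\<close>). The finite-dimensional distributions
  are then computed by induction on the number of time points.
\<close>

section \<open>Monic polynomials with a three-term recurrence\<close>

text \<open>
  If $y q_k = q_{k+1} + a_k q_k + b_k q_{k-1}$ for monic \<open>q\<^sub>k\<close>, then \<open>recurrence_coeff a b n k\<close> is the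
  coefficient of \<open>q\<^sub>k\<close> in the expansion of $y^n$. The case \<open>k = 0\<close> is the \<open>n\<close>-th moment of a
  probability measure that orthogonalizes the \<open>q\<^sub>k\<close>.
\<close>

fun recurrence_coeff :: "(nat \<Rightarrow> real) \<Rightarrow> (nat \<Rightarrow> real) \<Rightarrow> nat \<Rightarrow> nat \<Rightarrow> real" where
  "recurrence_coeff a b 0 k = (if k = 0 then 1 else 0)"
| "recurrence_coeff a b (Suc n) k =
     (if k = 0 then 0 else recurrence_coeff a b n (k - 1))
       + a k * recurrence_coeff a b n k + b (Suc k) * recurrence_coeff a b n (Suc k)"

lemma recurrence_coeff_eq_0: "n < k \<Longrightarrow> recurrence_coeff a b n k = 0"
  by (induction n arbitrary: k) auto

lemma recurrence_coeff_diag: "recurrence_coeff a b n n = 1"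
  by (induction n) (auto simp: recurrence_coeff_eq_0)

text \<open>
  A geometric bound on the moments is what forces the support to be bounded.
\<close>

lemma abs_recurrence_coeff_le:
  assumes "\<And>k. \<bar>a k\<bar> \<le> A" "\<And>k. \<bar>b k\<bar> \<le> B"
  shows "\<bar>recurrence_coeff a b n k\<bar> \<le> (1 + A + B) ^ n"
proof (induction n arbitrary: k)
  case (Suc n)
  have AB: "0 \<le> A" "0 \<le> B" using assms[of 0] by linarith+
  let ?M = "(1 + A + B) ^ n"
  have M: "0 \<le> ?M" using AB by simp
  have 1: "\<bar>if k = 0 then 0 else recurrence_coeff a b n (k - 1)\<bar> \<le> ?M"
    using Suc.IH M by simp
  have 2: "\<bar>a k * recurrence_coeff a b n k\<bar> \<le> A * ?M"
    unfolding abs_mult using Suc.IH assms AB M by (intro mult_mono) auto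
  have 3: "\<bar>b (Suc k) * recurrence_coeff a b n (Suc k)\<bar> \<le> B * ?M"
    unfolding abs_mult using Suc.IH assms AB M by (intro mult_mono) auto
  have "\<bar>recurrence_coeff a b (Suc n) k\<bar> \<le> ?M + A * ?M + B * ?M"
    unfolding recurrence_coeff.simps using 1 2 3 by linarith
  also have "\<dots> = (1 + A + B) ^ Suc n" by (simp add: algebra_simps)
  finally show ?case .
qed (auto)

locale three_term_recurrence =
  fixes q :: "nat \<Rightarrow> real poly" and a b :: "nat \<Rightarrow> real"
  assumes q_0: "q 0 = 1"
    and b_0: "b 0 = 0"
    and recurrence: "[:0, 1:] * q n = q (Suc n) + smult (a n) (q n) + smult (b n) (q (n - 1))"
begin

text \<open>
  The recursion for the coefficients is multiplication of the expansion by \<open>y\<close>; the three terms of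
  the recurrence become three shifted sums.
\<close>

lemma monom_eq_sum: "monom 1 n = (\<Sum>k\<le>n. smult (recurrence_coeff a b n k) (q k))"
proof (induction n)
  case (Suc n)
  let ?c = "recurrence_coeff a b n"
  have "monom 1 (Suc n) = [:0, 1:] * monom (1::real) n"
    by (simp add: monom_Suc)
  also have "\<dots> = (\<Sum>k\<le>n. smult (?c k) ([:0, 1:] * q k))"
    unfolding Suc.IH sum_distrib_left by (intro sum.cong) (auto simp only: mult_smult_right)
  also have "\<dots> = (\<Sum>k\<le>n. smult (?c k) (q (Suc k))) + (\<Sum>k\<le>n. smult (?c k * a k) (q k))
      + (\<Sum>k\<le>n. smult (?c k * b k) (q (k - 1)))"
    unfolding recurrence by (simp add: sum.distrib smult_add_right)
  also have "(\<Sum>k\<le>n. smult (?c k) (q (Suc k)))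
      = (\<Sum>k\<le>Suc n. smult (if k = 0 then 0 else ?c (k - 1)) (q k))"
    unfolding sum.atMost_Suc_shift by simp
  also have "(\<Sum>k\<le>n. smult (?c k * a k) (q k)) = (\<Sum>k\<le>Suc n. smult (a k * ?c k) (q k))"
    by (simp add: recurrence_coeff_eq_0 mult.commute)
  also have "(\<Sum>k\<le>n. smult (?c k * b k) (q (k - 1)))
      = (\<Sum>k\<le>Suc (Suc n). smult (?c k * b k) (q (k - 1)))"
    by (simp add: recurrence_coeff_eq_0)
  also have "\<dots> = (\<Sum>k\<le>Suc n. smult (b (Suc k) * ?c (Suc k)) (q k))"
    unfolding sum.atMost_Suc_shift[of _ "Suc n"] by (simp add: b_0 mult.commute)
  finally show ?case
    by (simp only: sum.distrib[symmetric] smult_add_left[symmetric] recurrence_coeff.simps)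
qed (simp add: q_0 monom_0 one_pCons)

end

section \<open>Measures determined by their moments\<close>

lemma poly_one_eq: "poly (1 :: real poly) = (\<lambda>y. 1)"
  by (simp add: fun_eq_iff)

lemma integrable_poly_of_powers:
  assumes "\<And>n. integrable \<mu> (\<lambda>\<omega>. (Y \<omega>) ^ n :: real)"
  shows "integrable \<mu> (\<lambda>\<omega>. poly p (Y \<omega>))"
  unfolding poly_altdef using assms
  by (intro Bochner_Integration.integrable_sum integrable_mult_right) auto

context three_term_recurrence
begin

lemma integral_power_eq:
  assumes "prob_space \<mu>" and int: "\<And>n. integrable \<mu> (\<lambda>y. y ^ n)"
    and zero: "\<And>n. 0 < n \<Longrightarrow> (\<integral>y. poly (q n) y \<partial>\<mu>) = 0"
  shows "(\<integral>y. y ^ n \<partial>\<mu>) = recurrence_coeff a b n 0"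
proof -
  interpret prob_space \<mu> by fact
  have "(\<integral>y. y ^ n \<partial>\<mu>) = (\<integral>y. (\<Sum>k\<le>n. recurrence_coeff a b n k * poly (q k) y) \<partial>\<mu>)"
    using arg_cong[OF monom_eq_sum[of n], of poly] by (simp add: poly_monom fun_eq_iff poly_sum)
  also have "\<dots> = (\<Sum>k\<le>n. recurrence_coeff a b n k * (\<integral>y. poly (q k) y \<partial>\<mu>))"
    using integrable_poly_of_powers[OF int] by (subst Bochner_Integration.integral_sum) auto
  also have "\<dots> = (\<Sum>k\<in>{0}. recurrence_coeff a b n k * (\<integral>y. poly (q k) y \<partial>\<mu>))"
    using zero by (intro sum.mono_neutral_right) auto
  also have "\<dots> = recurrence_coeff a b n 0" by (simp add: q_0 poly_one_eq prob_space)
  finally show ?thesis .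
qed

text \<open>
  The converse of the preceding lemma: the expansion of $y^n$ has leading coefficient \<open>1\<close>, so the integrals of the
  \<open>q\<^sub>k\<close> can be read off from the moments one after the other.
\<close>

lemma integral_q_eq_0:
  assumes "prob_space \<mu>" and int: "\<And>n. integrable \<mu> (\<lambda>y. y ^ n)"
    and moments: "\<And>n. (\<integral>y. y ^ n \<partial>\<mu>) = recurrence_coeff a b n 0"
    and "0 < n"
  shows "(\<integral>y. poly (q n) y \<partial>\<mu>) = 0"
  using \<open>0 < n\<close>
proof (induction n rule: less_induct)
  case (less n)
  interpret prob_space \<mu> by fact
  let ?L = "\<lambda>k. recurrence_coeff a b n k * (\<integral>y. poly (q k) y \<partial>\<mu>)"
  have "recurrence_coeff a b n 0 = (\<integral>y. (\<Sum>k\<le>n. recurrence_coeff a b n k * poly (q k) y) \<partial>\<mu>)"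
    unfolding moments[symmetric]
    using arg_cong[OF monom_eq_sum[of n], of poly] by (simp add: poly_monom fun_eq_iff poly_sum)
  also have "\<dots> = (\<Sum>k\<le>n. ?L k)"
    using integrable_poly_of_powers[OF int] by (subst Bochner_Integration.integral_sum) auto
  also have "\<dots> = (\<Sum>k\<in>{0, n}. ?L k)"
    using less by (intro sum.mono_neutral_right) auto
  also have "\<dots> = recurrence_coeff a b n 0 + (\<integral>y. poly (q n) y \<partial>\<mu>)"
    using less.prems by (simp add: q_0 poly_one_eq prob_space recurrence_coeff_diag)
  finally show ?case by simp
qed

text \<open>
  Induction on the smaller index: in \<open>q\<^sub>m q\<^sub>n\<close> the factor \<open>y\<close> is moved from \<open>y q\<^bsub>m-1\<^esub>\<close> to \<open>q\<^sub>n\<close>, which leaves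
  products whose smaller index is below \<open>m\<close>.
\<close>

lemma integral_q_mult_eq_0:
  assumes "prob_space \<mu>" and int: "\<And>n. integrable \<mu> (\<lambda>y. y ^ n)"
    and zero: "\<And>n. 0 < n \<Longrightarrow> (\<integral>y. poly (q n) y \<partial>\<mu>) = 0"
    and "m < n"
  shows "(\<integral>y. poly (q m) y * poly (q n) y \<partial>\<mu>) = 0"
proof -
  define L where "L p = (\<integral>y. poly p y \<partial>\<mu>)" for p
  have L_add: "L (p + r) = L p + L r" for p r
    unfolding L_def poly_add by (intro Bochner_Integration.integral_add integrable_poly_of_powers int)
  have L_smult: "L (smult c p) = c * L p" for c p
  proof -
    have "poly (smult c p) = (\<lambda>y. c * poly p y)" by (simp add: fun_eq_iff)
    then show ?thesis unfolding L_def by (simp only: integral_mult_right_zero)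
  qed
  have "L (q m * q n) = 0"
    using \<open>m < n\<close>
  proof (induction m arbitrary: n rule: less_induct)
    case (less m)
    show ?case
    proof (cases m)
      case 0
      then show ?thesis using less.prems zero by (simp add: q_0 L_def)
    next
      case (Suc k)
      have "q (Suc k) * q n + smult (a k) (q k * q n) + smult (b k) (q (k - 1) * q n)
          = ([:0, 1:] * q k) * q n"
        unfolding recurrence by (simp only: distrib_right mult_smult_left)
      also have "\<dots> = q k * ([:0, 1:] * q n)" by (simp only: ac_simps)
      also have "\<dots> = q k * q (Suc n) + smult (a n) (q k * q n) + smult (b n) (q k * q (n - 1))"
        unfolding recurrence[of n] by (simp only: distrib_left mult_smult_right)
      finally have "L (q (Suc k) * q n) + a k * L (q k * q n) + b k * L (q (k - 1) * q n)
          = L (q k * q (Suc n)) + a n * L (q k * q n) + b n * L (q k * q (n - 1))"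
        unfolding L_add[symmetric] L_smult[symmetric] by simp
      moreover have "L (q k * q n) = 0" "L (q (k - 1) * q n) = 0" "L (q k * q (Suc n)) = 0"
          "L (q k * q (n - 1)) = 0"
        using less.prems Suc by (auto intro!: less.IH)
      ultimately show ?thesis using Suc by simp
    qed
  qed
  then show ?thesis by (simp add: L_def)
qed

text \<open>
  Orthogonality is equivalent to a prescription of the moments, which is easier to verify and to pass
  to limits.
\<close>

lemma orthogonalizes_iff:
  assumes "prob_space \<mu>" "sets \<mu> = sets borel"
  shows "orthogonalizes \<mu> q \<longleftrightarrow>
    (\<forall>n. integrable \<mu> (\<lambda>y. y ^ n)) \<and> (\<forall>n. (\<integral>y. y ^ n \<partial>\<mu>) = recurrence_coeff a b n 0)"
    (is "?L \<longleftrightarrow> ?R")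
proof
  assume L: ?L
  have iq: "integrable \<mu> (\<lambda>y. poly (q n) y)" for n
  proof -
    have "integrable \<mu> (\<lambda>y. poly (q n) y * poly (q 0) y)"
      using L unfolding orthogonalizes_def by blast
    then show ?thesis by (simp add: q_0)
  qed
  have int: "integrable \<mu> (\<lambda>y. y ^ n)" for n
  proof -
    have "integrable \<mu> (\<lambda>y. \<Sum>k\<le>n. recurrence_coeff a b n k * poly (q k) y)"
      using iq by auto
    then show ?thesis
      using arg_cong[OF monom_eq_sum[of n], of poly] by (simp add: poly_monom fun_eq_iff poly_sum)
  qed
  have "(\<integral>y. poly (q n) y \<partial>\<mu>) = 0" if "0 < n" for n
  proof -
    have "(\<integral>y. poly (q n) y * poly (q 0) y \<partial>\<mu>) = 0"
      using L that unfolding orthogonalizes_def by (metis less_irrefl)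
    then show ?thesis by (simp add: q_0)
  qed
  then show ?R using int integral_power_eq[OF assms(1) int] by blast
next
  assume R: ?R
  then have int: "\<And>n. integrable \<mu> (\<lambda>y. y ^ n)" by blast
  have zero: "(\<integral>y. poly (q n) y \<partial>\<mu>) = 0" if "0 < n" for n
    using integral_q_eq_0[OF assms(1) int] R that by blast
  have 1: "integrable \<mu> (\<lambda>y. poly (q m) y * poly (q n) y)" for m n
    using integrable_poly_of_powers[OF int, of "q m * q n"] by simp
  have 2: "(\<integral>y. poly (q m) y * poly (q n) y \<partial>\<mu>) = 0" if "m \<noteq> n" for m n
  proof (cases "m < n")
    case True
    then show ?thesis using integral_q_mult_eq_0[OF assms(1) int zero] by blast
  next
    case False
    then have "(\<integral>y. poly (q n) y * poly (q m) y \<partial>\<mu>) = 0"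
      using that by (intro integral_q_mult_eq_0[OF assms(1) int zero]) auto
    then show ?thesis by (simp add: mult.commute)
  qed
  show ?L unfolding orthogonalizes_def using 1 2 by blast
qed

end

text \<open>
  Markov's inequality for the \<open>2n\<close>-th power bounds the probability of \<open>\<bar>Y\<bar> \<ge> c\<close> by $(C/c)^{2n}$, which
  tends to \<open>0\<close> for \<open>c > C\<close>.
\<close>

lemma (in prob_space) AE_abs_le_of_moments:
  assumes int: "\<And>n. integrable M (\<lambda>\<omega>. (Y \<omega>) ^ n :: real)"
    and bound: "\<And>n. expectation (\<lambda>\<omega>. (Y \<omega>) ^ n) \<le> C ^ n" and "0 \<le> C"
  shows "AE \<omega> in M. \<bar>Y \<omega>\<bar> \<le> C"
proof -
  have [measurable]: "Y \<in> borel_measurable M" using int[of 1] by auto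
  have step: "AE \<omega> in M. \<bar>Y \<omega>\<bar> < c" if "C < c" for c
  proof -
    have c: "0 < c" using that \<open>0 \<le> C\<close> by linarith
    have le: "prob {\<omega> \<in> space M. c \<le> \<bar>Y \<omega>\<bar>} \<le> ((C / c)\<^sup>2) ^ n" for n
    proof -
      have "prob {\<omega> \<in> space M. c \<le> \<bar>Y \<omega>\<bar>} \<le> prob {\<omega> \<in> space M. c ^ (2 * n) \<le> Y \<omega> ^ (2 * n)}"
      proof (intro finite_measure_mono subsetI)
        fix \<omega> assume "\<omega> \<in> {\<omega> \<in> space M. c \<le> \<bar>Y \<omega>\<bar>}"
        then show "\<omega> \<in> {\<omega> \<in> space M. c ^ (2 * n) \<le> Y \<omega> ^ (2 * n)}"
          using c power_mono[of c "\<bar>Y \<omega>\<bar>" "2 * n"] by (auto simp: power_even_abs)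
      qed simp
      also have "\<dots> \<le> expectation (\<lambda>\<omega>. Y \<omega> ^ (2 * n)) / c ^ (2 * n)"
        using c int by (intro integral_Markov_inequality_measure[where A = "{}"]) (auto simp: zero_le_even_power)
      also have "\<dots> \<le> C ^ (2 * n) / c ^ (2 * n)"
        using bound[of "2 * n"] c by (intro divide_right_mono) auto
      also have "\<dots> = ((C / c)\<^sup>2) ^ n" by (simp add: power_mult power_divide)
      finally show ?thesis .
    qed
    have "(C / c)\<^sup>2 < 1"
      using that c \<open>0 \<le> C\<close> by (simp add: power_less_one_iff abs_square_less_1)
    then have "(\<lambda>n. ((C / c)\<^sup>2) ^ n) \<longlonglongrightarrow> 0"
      by (intro LIMSEQ_realpow_zero) auto
    then have "prob {\<omega> \<in> space M. c \<le> \<bar>Y \<omega>\<bar>} \<le> 0"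
      by (intro LIMSEQ_le_const) (use le in auto)
    then have "prob {\<omega> \<in> space M. c \<le> \<bar>Y \<omega>\<bar>} = 0" by (simp add: measure_le_0_iff)
    then have "AE \<omega> in M. \<not> c \<le> \<bar>Y \<omega>\<bar>"
      by (subst AE_iff_measurable[OF _ refl]) (auto simp: emeasure_eq_measure)
    then show ?thesis by (auto simp: not_le)
  qed
  have "AE \<omega> in M. \<forall>n. \<bar>Y \<omega>\<bar> < C + 1 / real (Suc n)"
    unfolding AE_all_countable by (intro allI step) auto
  then show ?thesis
  proof eventually_elim
    case (elim \<omega>)
    show ?case
    proof (rule field_le_epsilon)
      fix e :: real assume "0 < e"
      then obtain n where "1 / real (Suc n) < e" using nat_approx_posE by metis
      then show "\<bar>Y \<omega>\<bar> \<le> C + e" using elim[rule_format, of n] by linarith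
    qed
  qed
qed

lemma integrable_continuous_of_AE_bounded:
  fixes \<rho> :: "real measure"
  assumes \<rho>: "prob_space \<rho>" "sets \<rho> = sets borel" "AE y in \<rho>. \<bar>y\<bar> \<le> C"
    and h: "continuous_on UNIV (h :: real \<Rightarrow> real)"
  shows "integrable \<rho> h"
proof -
  interpret prob_space \<rho> by fact
  have [measurable]: "h \<in> borel_measurable \<rho>"
    using borel_measurable_continuous_onI[OF h] \<rho>(2) by (simp cong: measurable_cong_sets)
  have "compact (h ` {-C..C})"
    using h by (intro compact_continuous_image continuous_on_subset[OF h]) auto
  then obtain B where B: "\<And>y. y \<in> {-C..C} \<Longrightarrow> norm (h y) \<le> B"
    by (meson bounded_iff compact_imp_bounded imageI)
  show ?thesis
  proof (rule integrable_const_bound[where B = B])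
    show "AE y in \<rho>. norm (h y) \<le> B"
      using \<rho>(3) by eventually_elim (rule B, auto)
  qed simp
qed

lemma abs_integral_diff_le:
  fixes \<rho> :: "real measure"
  assumes \<rho>: "prob_space \<rho>" "sets \<rho> = sets borel" "AE y in \<rho>. \<bar>y\<bar> \<le> C"
    and f: "continuous_on UNIV f" and g: "continuous_on UNIV g"
    and fg: "\<And>y. \<bar>y\<bar> \<le> C \<Longrightarrow> \<bar>f y - g y :: real\<bar> \<le> e"
  shows "\<bar>(\<integral>y. f y \<partial>\<rho>) - (\<integral>y. g y \<partial>\<rho>)\<bar> \<le> e"
proof -
  interpret prob_space \<rho> by fact
  note int = integrable_continuous_of_AE_bounded[OF \<rho>]
  have "\<bar>(\<integral>y. f y \<partial>\<rho>) - (\<integral>y. g y \<partial>\<rho>)\<bar> = \<bar>\<integral>y. f y - g y \<partial>\<rho>\<bar>"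
    using int f g by simp
  also have "\<dots> \<le> (\<integral>y. \<bar>f y - g y\<bar> \<partial>\<rho>)"
    by (rule integral_abs_bound)
  also have "\<dots> \<le> (\<integral>y. e \<partial>\<rho>)"
  proof (rule integral_mono_AE)
    show "AE y in \<rho>. \<bar>f y - g y\<bar> \<le> e" using \<rho>(3) by eventually_elim (rule fg)
  qed (use int f g in auto)
  finally show ?thesis by (simp add: prob_space)
qed

lemma Weierstrass_poly:
  fixes f :: "real \<Rightarrow> real"
  assumes f: "continuous_on UNIV f" and e: "0 < e"
  obtains p where "\<And>y. \<bar>y\<bar> \<le> C \<Longrightarrow> \<bar>f y - poly p y\<bar> \<le> e"
proof -
  obtain g where g: "real_polynomial_function g" "\<And>y. y \<in> {-C..C} \<Longrightarrow> \<bar>f y - g y\<bar> < e"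
    using Stone_Weierstrass_real_polynomial_function[of "{-C..C}" f e]
      continuous_on_subset[OF f] e by (metis compact_Icc subset_UNIV)
  then obtain c n where gc: "g = (\<lambda>y. \<Sum>i\<le>n. c i * y ^ i)"
    by (auto simp: real_polynomial_function_iff_sum)
  have "g y = poly (\<Sum>i\<le>n. monom (c i) i) y" for y
    by (simp add: gc poly_sum poly_monom)
  moreover have "\<bar>f y - g y\<bar> \<le> e" if "\<bar>y\<bar> \<le> C" for y
  proof -
    have "y \<in> {-C..C}" using that by (auto simp: abs_le_iff)
    from g(2)[OF this] show ?thesis by simp
  qed
  ultimately show ?thesis using that by metis
qed

lemma integral_continuous_eq_of_moments:
  fixes \<mu> \<nu> :: "real measure"
  assumes \<mu>: "prob_space \<mu>" "sets \<mu> = sets borel" "AE y in \<mu>. \<bar>y\<bar> \<le> C"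
    and \<nu>: "prob_space \<nu>" "sets \<nu> = sets borel" "AE y in \<nu>. \<bar>y\<bar> \<le> C"
    and eq: "\<And>n. (\<integral>y. y ^ n \<partial>\<mu>) = (\<integral>y. y ^ n \<partial>\<nu>)"
    and f: "continuous_on UNIV (f :: real \<Rightarrow> real)"
  shows "(\<integral>y. f y \<partial>\<mu>) = (\<integral>y. f y \<partial>\<nu>)"
proof -
  have "\<bar>(\<integral>y. f y \<partial>\<mu>) - (\<integral>y. f y \<partial>\<nu>)\<bar> \<le> 0 + e" if e: "0 < e" for e
  proof -
    have "0 < e / 2" using e by simp
    from Weierstrass_poly[OF f this] obtain p where p: "\<And>y. \<bar>y\<bar> \<le> C \<Longrightarrow> \<bar>f y - poly p y\<bar> \<le> e / 2"
      by blast
    have pc: "continuous_on UNIV (poly p)" by (intro continuous_intros)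
    have pow: "continuous_on UNIV (\<lambda>y :: real. y ^ i)" for i by (intro continuous_intros)
    have "(\<integral>y. poly p y \<partial>\<mu>) = (\<integral>y. poly p y \<partial>\<nu>)"
      unfolding poly_altdef
      using integrable_continuous_of_AE_bounded[OF \<mu> pow] integrable_continuous_of_AE_bounded[OF \<nu> pow] eq
      by (simp add: Bochner_Integration.integral_sum)
    moreover have "\<bar>(\<integral>y. f y \<partial>\<mu>) - (\<integral>y. poly p y \<partial>\<mu>)\<bar> \<le> e / 2"
        "\<bar>(\<integral>y. f y \<partial>\<nu>) - (\<integral>y. poly p y \<partial>\<nu>)\<bar> \<le> e / 2"
      using abs_integral_diff_le[OF \<mu> f pc p] abs_integral_diff_le[OF \<nu> f pc p] by auto
    ultimately show ?thesis unfolding abs_le_iff by linarith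
  qed
  then have "\<bar>(\<integral>y. f y \<partial>\<mu>) - (\<integral>y. f y \<partial>\<nu>)\<bar> \<le> 0" by (rule field_le_epsilon)
  then show ?thesis by simp
qed

text \<open>
  On a bounded interval polynomials are uniformly dense, so equal moments give equal characteristic
  functions.
\<close>

lemma measure_eqI_moments:
  fixes \<mu> \<nu> :: "real measure"
  assumes "prob_space \<mu>" "sets \<mu> = sets borel" "prob_space \<nu>" "sets \<nu> = sets borel"
    and "AE y in \<mu>. \<bar>y\<bar> \<le> C" "AE y in \<nu>. \<bar>y\<bar> \<le> C"
    and "\<And>n. (\<integral>y. y ^ n \<partial>\<mu>) = (\<integral>y. y ^ n \<partial>\<nu>)"
  shows "\<mu> = \<nu>"
proof -
  have \<mu>: "real_distribution \<mu>" and \<nu>: "real_distribution \<nu>"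
    using assms(1-4) by (auto simp: real_distribution_def real_distribution_axioms_def)
  have "char \<mu> = char \<nu>"
  proof
    fix t
    have "(CLINT x|\<rho>. iexp (t * x)) = complex_of_real (\<integral>x. cos (t * x) \<partial>\<rho>) + \<i> * complex_of_real (\<integral>x. sin (t * x) \<partial>\<rho>)"
      if "prob_space \<rho>" "sets \<rho> = sets borel" for \<rho>
    proof -
      interpret prob_space \<rho> by fact
      have [measurable_cong]: "sets \<rho> = sets borel" by fact
      have 1: "integrable \<rho> (\<lambda>x. cos (t * x))" "integrable \<rho> (\<lambda>x. sin (t * x))"
        by (auto intro!: integrable_const_bound[where B = 1])
      have "(CLINT x|\<rho>. iexp (t * x)) = (CLINT x|\<rho>. complex_of_real (cos (t * x)) + \<i> * complex_of_real (sin (t * x)))"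
        by (intro Bochner_Integration.integral_cong) (auto simp: exp_Euler cos_of_real sin_of_real simp flip: of_real_mult)
      also have "\<dots> = (CLINT x|\<rho>. complex_of_real (cos (t * x))) + (CLINT x|\<rho>. \<i> * complex_of_real (sin (t * x)))"
        using 1 by (intro Bochner_Integration.integral_add integrable_mult_right integrable_of_real)
      finally show ?thesis by simp
    qed
    moreover have "(\<integral>x. cos (t * x) \<partial>\<mu>) = (\<integral>x. cos (t * x) \<partial>\<nu>)" "(\<integral>x. sin (t * x) \<partial>\<mu>) = (\<integral>x. sin (t * x) \<partial>\<nu>)"
      by (intro integral_continuous_eq_of_moments[OF assms(1,2,5,3,4,6,7)] continuous_intros)+
    ultimately show "char \<mu> t = char \<nu> t"
      unfolding char_def using assms(1-4) by simp
  qed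
  then show ?thesis by (rule Levy_uniqueness[OF \<mu> \<nu>])
qed

section \<open>The polynomials of the transition kernel\<close>

definition Q_diag :: "real \<Rightarrow> real \<Rightarrow> real \<Rightarrow> real \<Rightarrow> real \<Rightarrow> nat \<Rightarrow> real" where
  "Q_diag \<eta> \<theta> x t s n = (if n = 0 then x else if n = 1 then (t - s) * \<eta> + \<theta> else t * \<eta> + \<theta>)"

definition Q_offdiag :: "real \<Rightarrow> real \<Rightarrow> real \<Rightarrow> real \<Rightarrow> real \<Rightarrow> nat \<Rightarrow> real" where
  "Q_offdiag \<eta> \<theta> x t s n =
     (if n = 0 then 0 else if n = 1 then (t - s) * (1 + x * \<eta>) else t * (1 + \<eta> * \<theta>))"

text \<open>
  The first two steps of the recurrence for \<open>Q\<^sub>n\<close> are special; they enter only through the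
  coefficients \<open>Q_diag\<close> and \<open>Q_offdiag\<close>.
\<close>

lemma three_term_recurrence_Q_poly:
  "three_term_recurrence (\<lambda>n. Q_poly \<eta> \<theta> n x t s) (Q_diag \<eta> \<theta> x t s) (Q_offdiag \<eta> \<theta> x t s)"
proof
  fix n
  show "[:0, 1:] * Q_poly \<eta> \<theta> n x t s = Q_poly \<eta> \<theta> (Suc n) x t s
     + smult (Q_diag \<eta> \<theta> x t s n) (Q_poly \<eta> \<theta> n x t s)
     + smult (Q_offdiag \<eta> \<theta> x t s n) (Q_poly \<eta> \<theta> (n - 1) x t s)"
  proof (cases n)
    case 0
    then show ?thesis by (simp add: Q_diag_def Q_offdiag_def)
  next
    case (Suc m)
    then show ?thesis
      by (cases m) (simp_all only: Q_poly.simps Q_diag_def Q_offdiag_def, auto)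
  qed
qed (auto simp: Q_offdiag_def)

text \<open>
  The \<open>n\<close>-th moment that a measure $P_{s,t}(x, dy)$ must have.
\<close>

definition kernel_moment :: "real \<Rightarrow> real \<Rightarrow> real \<Rightarrow> real \<Rightarrow> nat \<Rightarrow> real \<Rightarrow> real" where
  "kernel_moment \<eta> \<theta> s t n x = recurrence_coeff (Q_diag \<eta> \<theta> x t s) (Q_offdiag \<eta> \<theta> x t s) n 0"

lemma continuous_on_recurrence_coeff:
  assumes "\<And>k. continuous_on S (\<lambda>x. a x k)" "\<And>k. continuous_on S (\<lambda>x. b x k)"
  shows "continuous_on S (\<lambda>x. recurrence_coeff (a x) (b x) n k)"
proof (induction n arbitrary: k)
  case (Suc n)
  show ?case
    by (cases "k = 0") (auto intro!: continuous_intros assms Suc.IH)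
qed simp

lemma continuous_on_Q_coeff:
  "continuous_on S (\<lambda>x. recurrence_coeff (Q_diag \<eta> \<theta> x t s) (Q_offdiag \<eta> \<theta> x t s) n k)"
proof (rule continuous_on_recurrence_coeff)
  fix k :: nat
  consider "k = 0" | "k = 1" | "1 < k" by linarith
  then show "continuous_on S (\<lambda>x. Q_diag \<eta> \<theta> x t s k)" "continuous_on S (\<lambda>x. Q_offdiag \<eta> \<theta> x t s k)"
    by (cases; auto simp: Q_diag_def Q_offdiag_def intro!: continuous_intros)+
qed

lemma continuous_on_kernel_moment: "continuous_on S (kernel_moment \<eta> \<theta> s t n)"
  unfolding kernel_moment_def by (rule continuous_on_Q_coeff)

lemma kernel_moment_bound: "\<exists>C\<ge>0. \<forall>n. \<bar>kernel_moment \<eta> \<theta> s t n x\<bar> \<le> C ^ n"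
proof -
  define A where "A = \<bar>x\<bar> + \<bar>(t - s) * \<eta> + \<theta>\<bar> + \<bar>t * \<eta> + \<theta>\<bar>"
  define B where "B = \<bar>(t - s) * (1 + x * \<eta>)\<bar> + \<bar>t * (1 + \<eta> * \<theta>)\<bar>"
  have "\<bar>Q_diag \<eta> \<theta> x t s k\<bar> \<le> A" for k unfolding Q_diag_def A_def by auto
  moreover have "\<bar>Q_offdiag \<eta> \<theta> x t s k\<bar> \<le> B" for k unfolding Q_offdiag_def B_def by auto
  ultimately have "\<bar>kernel_moment \<eta> \<theta> s t n x\<bar> \<le> (1 + A + B) ^ n" for n
    unfolding kernel_moment_def by (rule abs_recurrence_coeff_le)
  moreover have "0 \<le> 1 + A + B" by (simp add: A_def B_def)
  ultimately show ?thesis by blast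
qed

lemma power_eq_sum_Q_poly:
  "y ^ n = (\<Sum>k\<le>n. recurrence_coeff (Q_diag \<eta> \<theta> x t s) (Q_offdiag \<eta> \<theta> x t s) n k
                   * poly (Q_poly \<eta> \<theta> k x t s) y)"
proof -
  interpret three_term_recurrence "\<lambda>n. Q_poly \<eta> \<theta> n x t s" "Q_diag \<eta> \<theta> x t s" "Q_offdiag \<eta> \<theta> x t s"
    by (rule three_term_recurrence_Q_poly)
  show ?thesis
    using arg_cong[OF monom_eq_sum[of n], of "\<lambda>p. poly p y"] by (simp add: poly_monom poly_sum)
qed

lemma AE_bounded_of_kernel_moments:
  fixes \<mu> :: "real measure"
  assumes "prob_space \<mu>" "\<And>n. integrable \<mu> (\<lambda>y. y ^ n)"
    and "\<And>n. (\<integral>y. y ^ n \<partial>\<mu>) = kernel_moment \<eta> \<theta> s t n x"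
    and "0 \<le> C" "\<And>n. \<bar>kernel_moment \<eta> \<theta> s t n x\<bar> \<le> C ^ n"
  shows "AE y in \<mu>. \<bar>y\<bar> \<le> C"
proof (rule prob_space.AE_abs_le_of_moments)
  show "(\<integral>y. y ^ n \<partial>\<mu>) \<le> C ^ n" for n
    using assms(3,5)[of n] by linarith
qed (use assms in auto)

text \<open>
  The kernel is a definite description. A measure with the right moments satisfies it, and it is the only one
  because these moments bound the support.
\<close>

lemma trans_kernel_eqI:
  fixes \<mu> :: "real measure"
  assumes \<mu>: "prob_space \<mu>" "sets \<mu> = sets borel" "\<And>n. integrable \<mu> (\<lambda>y. y ^ n)"
    and moments: "\<And>n. (\<integral>y. y ^ n \<partial>\<mu>) = kernel_moment \<eta> \<theta> s t n x"
  shows "trans_kernel \<eta> \<theta> s t x = \<mu>"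
  unfolding trans_kernel_def
proof (rule the_equality)
  interpret Q: three_term_recurrence "\<lambda>n. Q_poly \<eta> \<theta> n x t s" "Q_diag \<eta> \<theta> x t s" "Q_offdiag \<eta> \<theta> x t s"
    by (rule three_term_recurrence_Q_poly)
  show "prob_space \<mu> \<and> sets \<mu> = sets borel \<and> orthogonalizes \<mu> (\<lambda>n. Q_poly \<eta> \<theta> n x t s)"
    using assms by (simp add: Q.orthogonalizes_iff kernel_moment_def)
  fix \<nu> :: "real measure"
  assume "prob_space \<nu> \<and> sets \<nu> = sets borel \<and> orthogonalizes \<nu> (\<lambda>n. Q_poly \<eta> \<theta> n x t s)"
  then have \<nu>: "prob_space \<nu>" "sets \<nu> = sets borel" "\<And>n. integrable \<nu> (\<lambda>y. y ^ n)"
      "\<And>n. (\<integral>y. y ^ n \<partial>\<nu>) = kernel_moment \<eta> \<theta> s t n x"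
    using Q.orthogonalizes_iff by (auto simp: kernel_moment_def)
  obtain C where C: "0 \<le> C" "\<And>n. \<bar>kernel_moment \<eta> \<theta> s t n x\<bar> \<le> C ^ n"
    using kernel_moment_bound by blast
  show "\<nu> = \<mu>"
    using \<mu> \<nu> C moments AE_bounded_of_kernel_moments
    by (intro measure_eqI_moments[where C = C]) auto
qed

section \<open>Martingale polynomials\<close>

text \<open>
  The process starts at \<open>0\<close> at time \<open>0\<close>, and its transition law to time \<open>t\<close> orthogonalizes these polynomials.
\<close>

definition martingale_poly :: "real \<Rightarrow> real \<Rightarrow> nat \<Rightarrow> real \<Rightarrow> real poly" where
  "martingale_poly \<eta> \<theta> n t = Q_poly \<eta> \<theta> n 0 t 0"

lemma martingale_poly_0 [simp]: "martingale_poly \<eta> \<theta> 0 t = 1"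
  and martingale_poly_1 [simp]: "poly (martingale_poly \<eta> \<theta> (Suc 0) t) y = y"
  and martingale_poly_rec_1: "y * poly (martingale_poly \<eta> \<theta> (Suc 0) t) y =
    poly (martingale_poly \<eta> \<theta> 2 t) y + (t * \<eta> + \<theta>) * poly (martingale_poly \<eta> \<theta> (Suc 0) t) y + t"
  and martingale_poly_rec: "y * poly (martingale_poly \<eta> \<theta> (Suc (Suc n)) t) y = poly (martingale_poly \<eta> \<theta> (Suc (Suc (Suc n))) t) y
    + (t * \<eta> + \<theta>) * poly (martingale_poly \<eta> \<theta> (Suc (Suc n)) t) y + t * (1 + \<eta> * \<theta>) * poly (martingale_poly \<eta> \<theta> (Suc n) t) y"
  by (simp_all add: martingale_poly_def numeral_2_eq_2 algebra_simps)

text \<open>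
  At time \<open>0\<close> the lower coefficient of the recurrence vanishes, so every $p_n(y;0)$ with \<open>n \<ge> 1\<close> is a multiple of $p_1(y;0) = y$.
\<close>

lemma martingale_poly_at_origin: "poly (martingale_poly \<eta> \<theta> (Suc n) 0) 0 = 0"
proof (induction n rule: less_induct)
  case (less n)
  consider "n = 0" | "n = 1" | m where "n = Suc (Suc m)" by (metis One_nat_def not0_implies_Suc)
  then show ?case
  proof cases
    case 2
    then show ?thesis by (simp add: martingale_poly_def)
  next
    case 3
    then show ?thesis using martingale_poly_rec[of 0 \<eta> \<theta> m 0] less[of "Suc m"] by simp
  qed simp
qed

text \<open>
  With $D_r(y) = (1+\<theta>z)(1+\<eta>rz) + rz^2 - yz$ the generating functions are
  $\sum_n p_n(y;r) z^n = 1 + z(y-rz)/D_r(y)$ and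
  $\sum_n Q_n(y;x,t,s) z^n = 1 + z((y-tz)(1+\<eta>sz) - (x-sz)(1+\<eta>tz))/D_t(y)$. Subtracting the first at \<open>(x,s)\<close> from the first
  at \<open>(y,t)\<close> gives
  $D_s(x) \sum_n (p_n(y;t) - p_n(x;s)) z^n = (1+\<theta>z) \sum_{n \<ge> 1} Q_n(y;x,t,s) z^n$, and the lemma compares coefficients.
  The proof checks the recurrences directly.
\<close>

lemma Q_poly_martingale_poly:
  fixes \<eta> \<theta> x y s t :: real
  defines "D \<equiv> \<lambda>n. poly (martingale_poly \<eta> \<theta> n t) y - poly (martingale_poly \<eta> \<theta> n s) x"
    and "q \<equiv> \<lambda>n. poly (Q_poly \<eta> \<theta> n x t s) y"
  shows "q (Suc (Suc n)) + \<theta> * q (Suc n) =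
    D (Suc (Suc n)) + (s * \<eta> + \<theta> - x) * D (Suc n) + s * (1 + \<eta> * \<theta>) * D n"
proof (induction n rule: less_induct)
  case (less n)
  consider "n = 0" | "n = 1" | "n = 2" | m where "n = Suc (Suc (Suc m))"
    by (metis One_nat_def numeral_2_eq_2 not0_implies_Suc)
  then show ?case
  proof cases
    case 4
    define P where "P n = poly (martingale_poly \<eta> \<theta> n t) y" for n
    define R where "R n = poly (martingale_poly \<eta> \<theta> n s) x" for n
    define c \<tau> \<sigma> where "c = 1 + \<eta> * \<theta>" and "\<tau> = t * \<eta> + \<theta>" and "\<sigma> = s * \<eta> + \<theta>"
    have D: "D n = P n - R n" for n by (simp add: D_def P_def R_def)
    have q: "q (Suc (Suc (Suc k))) = (y - \<tau>) * q (Suc (Suc k)) - t * c * q (Suc k)" for k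
      by (simp add: q_def c_def \<tau>_def algebra_simps)
    have P: "P (Suc (Suc (Suc k))) = (y - \<tau>) * P (Suc (Suc k)) - t * c * P (Suc k)" for k
      using martingale_poly_rec[of y \<eta> \<theta> k t] by (simp add: P_def c_def \<tau>_def algebra_simps)
    have R: "R (Suc (Suc (Suc k))) = (x - \<sigma>) * R (Suc (Suc k)) - s * c * R (Suc k)" for k
      using martingale_poly_rec[of x \<eta> \<theta> k s] by (simp add: R_def c_def \<sigma>_def algebra_simps)
    have R0: "D (Suc (Suc (Suc k))) + (\<sigma> - x) * D (Suc (Suc k)) + s * c * D (Suc k)
        = P (Suc (Suc (Suc k))) + (\<sigma> - x) * P (Suc (Suc k)) + s * c * P (Suc k)" for k
      unfolding D R[of k] by (simp add: algebra_simps)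
    have IH: "q (Suc (Suc (Suc k))) + \<theta> * q (Suc (Suc k))
        = P (Suc (Suc (Suc k))) + (\<sigma> - x) * P (Suc (Suc k)) + s * c * P (Suc k)"
      if "Suc k < n" for k
      using less[OF that] R0[of k] by (simp add: c_def \<sigma>_def)
    let ?m = "Suc (Suc m)"
    note IH1 = IH[of "Suc m", unfolded 4, OF lessI] and IH0 = IH[of m, unfolded 4, OF less_SucI, OF lessI]
    have "q (Suc (Suc (Suc ?m))) + \<theta> * q (Suc (Suc ?m))
        = (y - \<tau>) * (q (Suc (Suc ?m)) + \<theta> * q (Suc ?m)) - t * c * (q (Suc ?m) + \<theta> * q ?m)"
      unfolding q[of ?m] q[of "Suc m"] by (simp add: algebra_simps)
    also have "\<dots> = P (Suc (Suc (Suc ?m))) + (\<sigma> - x) * P (Suc (Suc ?m)) + s * c * P (Suc ?m)"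
      unfolding IH1 IH0 P[of ?m] P[of "Suc m"] P[of m] by (simp add: algebra_simps)
    finally show ?thesis using R0[of ?m] 4 by (simp add: c_def \<sigma>_def)
  qed (simp_all add: D_def q_def martingale_poly_def numeral_2_eq_2 algebra_simps)
qed

section \<open>Two-sided and one-sided conditioning\<close>

lemma (in prob_space) integrable_mult_square:
  assumes [measurable]: "f \<in> borel_measurable M" "g \<in> borel_measurable M"
    and "integrable M (\<lambda>x. (f x)\<^sup>2)" "integrable M (\<lambda>x. (g x)\<^sup>2)"
  shows "integrable M (\<lambda>x. f x * g x :: real)"
proof (rule Bochner_Integration.integrable_bound)
  show "integrable M (\<lambda>x. (f x)\<^sup>2 + (g x)\<^sup>2)" using assms by auto
  have "\<bar>a * b\<bar> \<le> a\<^sup>2 + b\<^sup>2" for a b :: real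
  proof -
    have "0 \<le> (\<bar>a\<bar> - \<bar>b\<bar>)\<^sup>2" by simp
    then have "2 * (\<bar>a\<bar> * \<bar>b\<bar>) \<le> a\<^sup>2 + b\<^sup>2" by (simp add: power2_diff)
    moreover have "0 \<le> \<bar>a\<bar> * \<bar>b\<bar>" by simp
    ultimately show ?thesis unfolding abs_mult by linarith
  qed
  then show "AE x in M. norm (f x * g x) \<le> norm ((f x)\<^sup>2 + (g x)\<^sup>2)" by simp
qed simp

text \<open>
  Conditional expectations are used in this form throughout: \<open>Y\<close> may be replaced by its conditional expectation
  when it is integrated against a random variable measurable with respect to \<open>F\<close>, bounded or not.
\<close>

lemma (in prob_space) integral_mult_eq_of_cond_exp:
  assumes F: "subalgebra M F"
    and f: "f \<in> borel_measurable F" and Y [measurable]: "Y \<in> borel_measurable M"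
    and int: "integrable M (\<lambda>\<omega>. f \<omega> * Y \<omega>)"
    and Z: "AE \<omega> in M. real_cond_exp M F Y \<omega> = Z \<omega>" and [measurable]: "Z \<in> borel_measurable M"
  shows "(\<integral>\<omega>. f \<omega> * Y \<omega> \<partial>M) = (\<integral>\<omega>. f \<omega> * Z \<omega> \<partial>M)" "integrable M (\<lambda>\<omega>. f \<omega> * Z \<omega>)"
proof -
  interpret finite_measure_subalgebra M F by unfold_locales (rule F)
  have [measurable]: "f \<in> borel_measurable M" by (rule measurable_from_subalg[OF F f])
  have AE: "AE \<omega> in M. f \<omega> * real_cond_exp M F Y \<omega> = f \<omega> * Z \<omega>"
    using Z by eventually_elim simp
  show "integrable M (\<lambda>\<omega>. f \<omega> * Z \<omega>)"
    using real_cond_exp_intg(1)[OF int f Y] AE integrable_cong_AE[OF _ _ AE] by simp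
  show "(\<integral>\<omega>. f \<omega> * Y \<omega> \<partial>M) = (\<integral>\<omega>. f \<omega> * Z \<omega> \<partial>M)"
    using real_cond_exp_intg(2)[OF int f Y] integral_cong_AE[OF _ _ AE] by simp
qed

lemma (in prob_space) integral_mult_eq_of_indicators:
  assumes F: "subalgebra M F"
    and f: "f \<in> borel_measurable F"
    and Y: "integrable M (Y :: 'a \<Rightarrow> real)" and Z: "integrable M Z" "Z \<in> borel_measurable F"
    and int: "integrable M (\<lambda>\<omega>. f \<omega> * Y \<omega>)"
    and eq: "\<And>A. A \<in> sets F \<Longrightarrow> (\<integral>\<omega>. indicator A \<omega> * Y \<omega> \<partial>M) = (\<integral>\<omega>. indicator A \<omega> * Z \<omega> \<partial>M)"
  shows "(\<integral>\<omega>. f \<omega> * Y \<omega> \<partial>M) = (\<integral>\<omega>. f \<omega> * Z \<omega> \<partial>M)" "integrable M (\<lambda>\<omega>. f \<omega> * Z \<omega>)"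
proof -
  interpret finite_measure_subalgebra M F by unfold_locales (rule F)
  have "AE \<omega> in M. real_cond_exp M F Y \<omega> = Z \<omega>"
    by (rule real_cond_exp_charact) (use eq Y Z in \<open>auto simp: set_lebesgue_integral_def\<close>)
  then show "(\<integral>\<omega>. f \<omega> * Y \<omega> \<partial>M) = (\<integral>\<omega>. f \<omega> * Z \<omega> \<partial>M)" "integrable M (\<lambda>\<omega>. f \<omega> * Z \<omega>)"
    using integral_mult_eq_of_cond_exp[OF F f _ int] Y Z by auto
qed

lemma space_sigma_gen [simp]: "space (sigma_gen M X T) = space M"
  unfolding sigma_gen_def by (rule space_measure_of) auto

lemma sets_sigma_gen:
  "sets (sigma_gen M X T) =
     sigma_sets (space M) {X r -` B \<inter> space M | r B. r \<in> T \<and> B \<in> sets borel}"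
  unfolding sigma_gen_def by (rule sets_measure_of) auto

lemma measurable_sigma_gen: "r \<in> T \<Longrightarrow> X r \<in> borel_measurable (sigma_gen M X T)"
  by (rule measurableI) (auto simp: sets_sigma_gen)

lemma sets_sigma_gen_mono: "T \<subseteq> T' \<Longrightarrow> sets (sigma_gen M X T) \<subseteq> sets (sigma_gen M X T')"
  unfolding sets_sigma_gen by (intro sigma_sets_mono') auto

lemma borel_measurable_sigma_gen_mono:
  assumes "f \<in> borel_measurable (sigma_gen M X T)" "T \<subseteq> T'"
  shows "f \<in> borel_measurable (sigma_gen M X T')"
  using assms sets_sigma_gen_mono[OF assms(2), of M X] by (auto simp: measurable_def)

lemma integral_mult_quadratic_form:
  fixes f A B C E G :: "'b \<Rightarrow> real"
  assumes "integrable M (\<lambda>x. f x * A x)" "integrable M (\<lambda>x. f x * B x)" "integrable M (\<lambda>x. f x * C x)"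
    "integrable M (\<lambda>x. f x * E x)" "integrable M (\<lambda>x. f x * G x)" "integrable M f"
  shows "(\<integral>x. f x * (a * A x + b * B x + c * C x + e * E x + g * G x + k) \<partial>M) =
    a * (\<integral>x. f x * A x \<partial>M) + b * (\<integral>x. f x * B x \<partial>M) + c * (\<integral>x. f x * C x \<partial>M)
    + e * (\<integral>x. f x * E x \<partial>M) + g * (\<integral>x. f x * G x \<partial>M) + k * (\<integral>x. f x \<partial>M)"
proof -
  have "(\<integral>x. f x * (a * A x + b * B x + c * C x + e * E x + g * G x + k) \<partial>M) =
    (\<integral>x. a * (f x * A x) + b * (f x * B x) + c * (f x * C x) + e * (f x * E x) + g * (f x * G x) + k * f x \<partial>M)"
    by (simp add: algebra_simps)
  also have "\<dots> = a * (\<integral>x. f x * A x \<partial>M) + b * (\<integral>x. f x * B x \<partial>M) + c * (\<integral>x. f x * C x \<partial>M)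
    + e * (\<integral>x. f x * E x \<partial>M) + g * (\<integral>x. f x * G x \<partial>M) + k * (\<integral>x. f x \<partial>M)"
    using assms by simp
  finally show ?thesis .
qed

text \<open>
  The conditional second moment is the conditional variance plus the square of the linear regression. Collecting the powers
  of \<open>x = X\<^sub>s\<close> and \<open>y = X\<^sub>u\<close>, the coefficient of $y^2$ simplifies to $t(t-s)/(u(u-s))$.
\<close>

lemma harness_second_moment:
  fixes s t u x y :: real
  assumes "0 < u" "s < u"
  shows "(u - t) * (t - s) / u * (1 + \<eta> * ((u * x - s * y) / (u - s)) + \<theta> * ((y - x) / (u - s))
         + (y - x) * (s * y - u * x) / (u - s)\<^sup>2) + ((u - t) / (u - s) * x + (t - s) / (u - s) * y)\<^sup>2 =
      (((u - t) / (u - s))\<^sup>2 + (u - t) * (t - s) / u * u / (u - s)\<^sup>2) * x\<^sup>2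
    + (2 * (u - t) * (t - s) / (u - s)\<^sup>2 - (u - t) * (t - s) / u * (s + u) / (u - s)\<^sup>2) * (x * y)
    + t * (t - s) / (u * (u - s)) * y\<^sup>2
    + (u - t) * (t - s) / u * (\<eta> * u - \<theta>) / (u - s) * x
    + (u - t) * (t - s) / u * (\<theta> - \<eta> * s) / (u - s) * y
    + (u - t) * (t - s) / u"
proof -
  have expand: "K * (1 + \<eta> * ((u * x - s * y) * i) + \<theta> * ((y - x) * i) + (y - x) * (s * y - u * x) * (i * i))
      + (p * i * x + q * i * y) * (p * i * x + q * i * y) =
      (p * i * (p * i) + K * u * (i * i)) * (x * x) + (2 * p * q * (i * i) - K * (s + u) * (i * i)) * (x * y)
      + (q * i * (q * i) + K * s * (i * i)) * (y * y) + K * (\<eta> * u - \<theta>) * i * x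
      + K * (\<theta> - \<eta> * s) * i * y + K" for K i p q
    by (simp add: algebra_simps)
  have "((t - s) / (u - s))\<^sup>2 + (u - t) * (t - s) / u * s / (u - s)\<^sup>2
      = ((t - s) * (t - s) * u + (u - t) * (t - s) * s) / (u * ((u - s) * (u - s)))"
    using assms by (simp add: add_divide_distrib power2_eq_square)
  also have "(t - s) * (t - s) * u + (u - t) * (t - s) * s = t * (t - s) * (u - s)"
    by (simp add: algebra_simps)
  finally have top: "t * (t - s) / (u * (u - s)) =
      ((t - s) / (u - s))\<^sup>2 + (u - t) * (t - s) / u * s / (u - s)\<^sup>2"
    using assms by simp
  show ?thesis
    unfolding top using expand[of "(u - t) * (t - s) / u" "inverse (u - s)" "u - t" "t - s"]
    by (simp only: power2_eq_square divide_inverse[of _ "u - s"] divide_inverse[of _ "(u - s) * (u - s)"]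
        inverse_mult_distrib)
qed

locale quadratic_harness = prob_space M for M :: "'a measure" +
  fixes X :: "real \<Rightarrow> 'a \<Rightarrow> real" and \<eta> \<theta> :: real
  assumes X_measurable: "\<And>t. t \<ge> 0 \<Longrightarrow> X t \<in> borel_measurable M"
    and X_square: "\<And>t. t \<ge> 0 \<Longrightarrow> integrable M (\<lambda>\<omega>. (X t \<omega>)\<^sup>2)"
    and covariance: "\<And>s t. s \<ge> 0 \<Longrightarrow> t \<ge> 0 \<Longrightarrow> (\<integral>\<omega>. X t \<omega> * X s \<omega> \<partial>M) = min t s"
    and linear_regression: "\<And>s t u. 0 \<le> s \<Longrightarrow> s < t \<Longrightarrow> t < u \<Longrightarrow>
           AE \<omega> in M. real_cond_exp M (sigma_gen M X ({0..s} \<union> {u..})) (X t) \<omega>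
             = (u - t) / (u - s) * X s \<omega> + (t - s) / (u - s) * X u \<omega>"
    and quadratic_variance: "\<And>s t u. 0 \<le> s \<Longrightarrow> s < t \<Longrightarrow> t < u \<Longrightarrow>
           AE \<omega> in M. cond_var M (sigma_gen M X ({0..s} \<union> {u..})) (X t) \<omega>
             = (u - t) * (t - s) / u *
                 (1 + \<eta> * ((u * X s \<omega> - s * X u \<omega>) / (u - s))
                    + \<theta> * ((X u \<omega> - X s \<omega>) / (u - s))
                    + (X u \<omega> - X s \<omega>) * (s * X u \<omega> - u * X s \<omega>) / (u - s)\<^sup>2)"
begin

abbreviation past :: "real \<Rightarrow> 'a measure" where
  "past s \<equiv> sigma_gen M X {0..s}"

abbreviation past_future :: "real \<Rightarrow> real \<Rightarrow> 'a measure" where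
  "past_future s u \<equiv> sigma_gen M X ({0..s} \<union> {u..})"

lemma subalgebra_sigma_gen: "T \<subseteq> {0..} \<Longrightarrow> subalgebra M (sigma_gen M X T)"
  unfolding subalgebra_def sets_sigma_gen
proof (intro conjI sets.sigma_sets_subset)
  assume T: "T \<subseteq> {0..}"
  show "{X r -` B \<inter> space M |r B. r \<in> T \<and> B \<in> sets borel} \<subseteq> sets M"
  proof clarify
    fix r and B :: "real set" assume "r \<in> T" "B \<in> sets borel"
    then show "X r -` B \<inter> space M \<in> sets M" using T by (intro measurable_sets[OF X_measurable]) auto
  qed
qed simp

lemma subalgebra_past: "subalgebra M (past s)"
  by (intro subalgebra_sigma_gen subsetI) simp

lemma subalgebra_past_future: "0 \<le> u \<Longrightarrow> subalgebra M (past_future s u)"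
  by (intro subalgebra_sigma_gen subsetI) (simp, linarith)

lemma past_measurable_X: "0 \<le> r \<Longrightarrow> r \<le> s \<Longrightarrow> X r \<in> borel_measurable (past s)"
  by (rule measurable_sigma_gen) auto

lemma X_integrable: "t \<ge> 0 \<Longrightarrow> integrable M (X t)"
  by (rule square_integrable_imp_integrable[OF X_measurable X_square])

lemma X_product_integrable: "s \<ge> 0 \<Longrightarrow> t \<ge> 0 \<Longrightarrow> integrable M (\<lambda>\<omega>. X s \<omega> * X t \<omega>)"
  by (rule integrable_mult_square[OF X_measurable X_measurable X_square X_square])

lemma expectation_square: "t \<ge> 0 \<Longrightarrow> (\<integral>\<omega>. (X t \<omega>)\<^sup>2 \<partial>M) = t"
  using covariance[of t t] by (simp add: power2_eq_square)

lemma AE_X_0: "AE \<omega> in M. X 0 \<omega> = 0"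
proof -
  have "AE \<omega> in M. (X 0 \<omega>)\<^sup>2 = 0"
    by (subst integral_nonneg_eq_0_iff_AE[symmetric]) (simp_all add: X_square expectation_square)
  then show ?thesis by simp
qed

lemma backward_linear:
  assumes "0 \<le> s" "s < t" "t < u" and f: "f \<in> borel_measurable (past_future s u)"
    and int: "integrable M (\<lambda>\<omega>. f \<omega> * X t \<omega>)"
      "integrable M (\<lambda>\<omega>. f \<omega> * X s \<omega>)" "integrable M (\<lambda>\<omega>. f \<omega> * X u \<omega>)"
  shows "(\<integral>\<omega>. f \<omega> * X t \<omega> \<partial>M) =
    (u - t) / (u - s) * (\<integral>\<omega>. f \<omega> * X s \<omega> \<partial>M) + (t - s) / (u - s) * (\<integral>\<omega>. f \<omega> * X u \<omega> \<partial>M)"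
proof -
  have F: "subalgebra M (past_future s u)" using assms by (intro subalgebra_past_future) auto
  have [measurable]: "X s \<in> borel_measurable M" "X t \<in> borel_measurable M" "X u \<in> borel_measurable M"
    using assms X_measurable by auto
  have "(\<integral>\<omega>. f \<omega> * X t \<omega> \<partial>M) =
      (\<integral>\<omega>. f \<omega> * ((u - t) / (u - s) * X s \<omega> + (t - s) / (u - s) * X u \<omega>) \<partial>M)"
    by (rule integral_mult_eq_of_cond_exp[OF F f _ int(1) linear_regression[OF assms(1-3)]]) simp_all
  also have "\<dots> = (\<integral>\<omega>. (u - t) / (u - s) * (f \<omega> * X s \<omega>) + (t - s) / (u - s) * (f \<omega> * X u \<omega>) \<partial>M)"
    by (simp add: algebra_simps)
  also have "\<dots> = (\<integral>\<omega>. (u - t) / (u - s) * (f \<omega> * X s \<omega>) \<partial>M) + (\<integral>\<omega>. (t - s) / (u - s) * (f \<omega> * X u \<omega>) \<partial>M)"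
    using int by (intro Bochner_Integration.integral_add integrable_mult_right)
  finally show ?thesis by simp
qed

lemma backward_square:
  assumes "0 \<le> s" "s < t" "t < u" and f: "f \<in> borel_measurable (past_future s u)"
    and int: "integrable M (\<lambda>\<omega>. f \<omega> * (X t \<omega>)\<^sup>2)"
      "integrable M (\<lambda>\<omega>. f \<omega> * (X s \<omega>)\<^sup>2)" "integrable M (\<lambda>\<omega>. f \<omega> * (X s \<omega> * X u \<omega>))"
      "integrable M (\<lambda>\<omega>. f \<omega> * (X u \<omega>)\<^sup>2)"
      "integrable M (\<lambda>\<omega>. f \<omega> * X s \<omega>)" "integrable M (\<lambda>\<omega>. f \<omega> * X u \<omega>)" "integrable M f"
  shows "(\<integral>\<omega>. f \<omega> * (X t \<omega>)\<^sup>2 \<partial>M) =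
      (((u - t) / (u - s))\<^sup>2 + (u - t) * (t - s) / u * u / (u - s)\<^sup>2) * (\<integral>\<omega>. f \<omega> * (X s \<omega>)\<^sup>2 \<partial>M)
    + (2 * (u - t) * (t - s) / (u - s)\<^sup>2 - (u - t) * (t - s) / u * (s + u) / (u - s)\<^sup>2)
        * (\<integral>\<omega>. f \<omega> * (X s \<omega> * X u \<omega>) \<partial>M)
    + t * (t - s) / (u * (u - s)) * (\<integral>\<omega>. f \<omega> * (X u \<omega>)\<^sup>2 \<partial>M)
    + (u - t) * (t - s) / u * (\<eta> * u - \<theta>) / (u - s) * (\<integral>\<omega>. f \<omega> * X s \<omega> \<partial>M)
    + (u - t) * (t - s) / u * (\<theta> - \<eta> * s) / (u - s) * (\<integral>\<omega>. f \<omega> * X u \<omega> \<partial>M)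
    + (u - t) * (t - s) / u * (\<integral>\<omega>. f \<omega> \<partial>M)"
    (is "_ = ?a * _ + ?b * _ + ?c * _ + ?e * _ + ?g * _ + ?K * _")
proof -
  have F: "subalgebra M (past_future s u)" using assms by (intro subalgebra_past_future) auto
  have [measurable]: "X s \<in> borel_measurable M" "X t \<in> borel_measurable M" "X u \<in> borel_measurable M"
    using assms X_measurable by auto
  have AE: "AE \<omega> in M. real_cond_exp M (past_future s u) (\<lambda>\<omega>. (X t \<omega>)\<^sup>2) \<omega> =
      ?a * (X s \<omega>)\<^sup>2 + ?b * (X s \<omega> * X u \<omega>) + ?c * (X u \<omega>)\<^sup>2 + ?e * X s \<omega> + ?g * X u \<omega> + ?K"
    using linear_regression[OF assms(1-3)] quadratic_variance[OF assms(1-3)]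
  proof eventually_elim
    case (elim \<omega>)
    have u: "0 < u" "s < u" using assms(1-3) by auto
    show ?case
      by (rule trans[OF elim(2)[unfolded cond_var_def elim(1) diff_eq_eq] harness_second_moment[OF u]])
  qed
  have "(\<integral>\<omega>. f \<omega> * (X t \<omega>)\<^sup>2 \<partial>M) = (\<integral>\<omega>. f \<omega> *
      (?a * (X s \<omega>)\<^sup>2 + ?b * (X s \<omega> * X u \<omega>) + ?c * (X u \<omega>)\<^sup>2 + ?e * X s \<omega> + ?g * X u \<omega> + ?K) \<partial>M)"
    by (rule integral_mult_eq_of_cond_exp(1)[OF F f _ int(1) AE]) simp_all
  then show ?thesis
    unfolding integral_mult_quadratic_form[OF int(2-7)] .
qed


lemma integrable_bounded_mult:
  assumes "f \<in> borel_measurable M" "\<And>\<omega>. \<bar>f \<omega>\<bar> \<le> B" "integrable M g"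
  shows "integrable M (\<lambda>\<omega>. f \<omega> * g \<omega> :: real)"
proof (rule Bochner_Integration.integrable_bound)
  show "integrable M (\<lambda>\<omega>. B * g \<omega>)" using assms by simp
  have "\<bar>f \<omega>\<bar> * \<bar>g \<omega>\<bar> \<le> \<bar>B\<bar> * \<bar>g \<omega>\<bar>" for \<omega>
    using assms(2)[of \<omega>] by (intro mult_right_mono) auto
  then show "AE \<omega> in M. norm (f \<omega> * g \<omega>) \<le> norm (B * g \<omega>)" by (simp add: abs_mult)
qed (use assms in measurable)

text \<open>
  The growth rate $\sqrt{t}$ is slower than \<open>t\<close>, so these expectations disappear in the limit of the two-sided regression.
\<close>

lemma abs_expectation_bounded_mult_le:
  assumes "t > 0" "f \<in> borel_measurable M" "\<And>\<omega>. \<bar>f \<omega>\<bar> \<le> B"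
  shows "\<bar>\<integral>\<omega>. f \<omega> * X t \<omega> \<partial>M\<bar> \<le> B * sqrt t"
proof -
  have B: "0 \<le> B" using assms(3)[of undefined] by linarith
  have "\<bar>\<integral>\<omega>. f \<omega> * X t \<omega> \<partial>M\<bar> \<le> (\<integral>\<omega>. \<bar>f \<omega> * X t \<omega>\<bar> \<partial>M)"
    by (rule integral_abs_bound)
  also have "\<dots> \<le> (\<integral>\<omega>. B / 2 * (sqrt t + (X t \<omega>)\<^sup>2 / sqrt t) \<partial>M)"
  proof (rule integral_mono)
    show "integrable M (\<lambda>\<omega>. \<bar>f \<omega> * X t \<omega>\<bar>)"
      using assms X_integrable by (intro integrable_abs integrable_bounded_mult[where B = B]) auto
    show "integrable M (\<lambda>\<omega>. B / 2 * (sqrt t + (X t \<omega>)\<^sup>2 / sqrt t))"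
      using X_square assms(1) by auto
    fix \<omega>
    have "0 \<le> (sqrt t - \<bar>X t \<omega>\<bar>)\<^sup>2" by simp
    then have "2 * \<bar>X t \<omega>\<bar> * sqrt t \<le> sqrt t * sqrt t + (X t \<omega>)\<^sup>2"
      using assms(1) by (simp add: power2_diff mult_ac)
    then have "2 * \<bar>X t \<omega>\<bar> \<le> sqrt t + (X t \<omega>)\<^sup>2 / sqrt t"
      using assms(1) by (simp add: field_simps)
    then have "B / 2 * (2 * \<bar>X t \<omega>\<bar>) \<le> B / 2 * (sqrt t + (X t \<omega>)\<^sup>2 / sqrt t)"
      using B by (intro mult_left_mono) auto
    moreover have "\<bar>f \<omega>\<bar> * \<bar>X t \<omega>\<bar> \<le> B * \<bar>X t \<omega>\<bar>"
      using assms(3) by (intro mult_right_mono) auto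
    ultimately show "\<bar>f \<omega> * X t \<omega>\<bar> \<le> B / 2 * (sqrt t + (X t \<omega>)\<^sup>2 / sqrt t)"
      by (simp add: abs_mult)
  qed
  also have "\<dots> = B / 2 * (sqrt t + t / sqrt t)"
    using X_square[of t] assms(1) expectation_square[of t] by (simp add: prob_space)
  also have "\<dots> = B * sqrt t" using assms(1) by (simp add: real_div_sqrt)
  finally show ?thesis .
qed

lemma past_imp_past_future: "f \<in> borel_measurable (past s) \<Longrightarrow> f \<in> borel_measurable (past_future s u)"
  by (erule borel_measurable_sigma_gen_mono) simp

text \<open>
  Let \<open>u\<close> tend to infinity in the linear regression: the weight of \<open>X\<^sub>s\<close> tends to \<open>1\<close>, that of \<open>X\<^sub>u\<close> is of order
  \<open>1/u\<close>.
\<close>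

lemma forward_linear_bounded:
  assumes st: "0 \<le> s" "s < t" and f: "f \<in> borel_measurable (past s)" and B: "\<And>\<omega>. \<bar>f \<omega>\<bar> \<le> B"
  shows "(\<integral>\<omega>. f \<omega> * X t \<omega> \<partial>M) = (\<integral>\<omega>. f \<omega> * X s \<omega> \<partial>M)"
proof -
  define \<phi> where "\<phi> r = (\<integral>\<omega>. f \<omega> * X r \<omega> \<partial>M)" for r
  have fM: "f \<in> borel_measurable M" by (rule measurable_from_subalg[OF subalgebra_past f])
  have int: "integrable M (\<lambda>\<omega>. f \<omega> * X r \<omega>)" if "0 \<le> r" for r
    by (rule integrable_bounded_mult[OF fM B X_integrable[OF that]])
  have eq: "\<phi> t = (u - t) / (u - s) * \<phi> s + (t - s) / (u - s) * \<phi> u" if "t < u" for u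
    unfolding \<phi>_def using that st
    by (intro backward_linear int past_imp_past_future f) auto
  have "((\<lambda>u. (u - t) / (u - s) * \<phi> s + (t - s) / (u - s) * \<phi> u) \<longlongrightarrow> 1 * \<phi> s + 0) at_top"
  proof (intro tendsto_add tendsto_mult tendsto_const)
    show "((\<lambda>u. (u - t) / (u - s)) \<longlongrightarrow> 1) at_top" by real_asymp
    show "((\<lambda>u. (t - s) / (u - s) * \<phi> u) \<longlongrightarrow> 0) at_top"
    proof (rule Lim_null_comparison)
      show "((\<lambda>u. (t - s) / (u - s) * (B * sqrt u)) \<longlongrightarrow> 0) at_top" by real_asymp
      show "\<forall>\<^sub>F u in at_top. norm ((t - s) / (u - s) * \<phi> u) \<le> (t - s) / (u - s) * (B * sqrt u)"
        using eventually_gt_at_top[of t]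
      proof eventually_elim
        case (elim u)
        then show ?case
          using abs_expectation_bounded_mult_le[of u f B] st fM B
          by (simp add: abs_mult \<phi>_def mult_left_mono divide_right_mono)
      qed
    qed
  qed
  then have "((\<lambda>u::real. \<phi> t) \<longlongrightarrow> 1 * \<phi> s + 0) at_top"
    by (rule Lim_transform_eventually)
      (rule eventually_mono[OF eventually_gt_at_top[of t]], simp only: eq)
  then have "\<phi> t = \<phi> s" by (simp add: tendsto_const_iff)
  then show ?thesis by (simp add: \<phi>_def)
qed

lemma forward_linear:
  assumes st: "0 \<le> s" "s < t" and f: "f \<in> borel_measurable (past s)"
    and int: "integrable M (\<lambda>\<omega>. f \<omega> * X t \<omega>)"
  shows "(\<integral>\<omega>. f \<omega> * X t \<omega> \<partial>M) = (\<integral>\<omega>. f \<omega> * X s \<omega> \<partial>M)"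
proof (rule integral_mult_eq_of_indicators(1)[OF subalgebra_past f _ _ _ int])
  fix A assume "A \<in> sets (past s)"
  then show "(\<integral>\<omega>. indicator A \<omega> * X t \<omega> \<partial>M) = (\<integral>\<omega>. indicator A \<omega> * X s \<omega> \<partial>M)"
    by (intro forward_linear_bounded[where B = 1] st borel_measurable_indicator) (auto simp: indicator_def)
qed (use st X_integrable past_measurable_X in auto)

text \<open>
  The same limit in the quadratic regression. The term in $X_u^2$ has a coefficient of order $1/u^2$
  against an expectation of order \<open>u\<close>; in the other terms the martingale property turns \<open>X\<^sub>u\<close> into \<open>X\<^sub>s\<close>.
\<close>

lemma forward_square_bounded:
  assumes st: "0 \<le> s" "s < t" and f: "f \<in> borel_measurable (past s)" and B: "\<And>\<omega>. \<bar>f \<omega>\<bar> \<le> B"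
  shows "(\<integral>\<omega>. f \<omega> * (X t \<omega>)\<^sup>2 \<partial>M) = (\<integral>\<omega>. f \<omega> * ((X s \<omega>)\<^sup>2 + (t - s) * (1 + \<eta> * X s \<omega>)) \<partial>M)"
proof -
  define \<phi> where "\<phi> r = (\<integral>\<omega>. f \<omega> * X r \<omega> \<partial>M)" for r
  define \<psi> where "\<psi> r = (\<integral>\<omega>. f \<omega> * (X r \<omega>)\<^sup>2 \<partial>M)" for r
  define J where "J = (\<integral>\<omega>. f \<omega> \<partial>M)"
  have fM: "f \<in> borel_measurable M" by (rule measurable_from_subalg[OF subalgebra_past f])
  have int1: "integrable M (\<lambda>\<omega>. f \<omega> * X r \<omega>)" if "0 \<le> r" for r
    by (rule integrable_bounded_mult[OF fM B X_integrable[OF that]])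
  have int2: "integrable M (\<lambda>\<omega>. f \<omega> * (X r \<omega>)\<^sup>2)" if "0 \<le> r" for r
    by (rule integrable_bounded_mult[OF fM B X_square[OF that]])
  have int3: "integrable M (\<lambda>\<omega>. f \<omega> * (X s \<omega> * X r \<omega>))" if "0 \<le> r" for r
    by (rule integrable_bounded_mult[OF fM B X_product_integrable[OF st(1) that]])
  have int0: "integrable M f" using integrable_bounded_mult[OF fM B, of "\<lambda>_. 1"] by simp
  have \<phi>: "\<phi> u = \<phi> s" if "s < u" for u
    unfolding \<phi>_def using st that by (intro forward_linear f int1) auto
  have \<psi>s: "(\<integral>\<omega>. f \<omega> * (X s \<omega> * X u \<omega>) \<partial>M) = \<psi> s" if "s < u" for u
  proof -
    have "(\<integral>\<omega>. (f \<omega> * X s \<omega>) * X u \<omega> \<partial>M) = (\<integral>\<omega>. (f \<omega> * X s \<omega>) * X s \<omega> \<partial>M)"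
      using st that int3[of u] past_measurable_X[of s s] f
      by (intro forward_linear borel_measurable_times) (auto simp: mult.assoc)
    then show ?thesis unfolding \<psi>_def by (simp add: power2_eq_square mult.assoc)
  qed
  let ?rest = "\<lambda>u. (((u - t) / (u - s))\<^sup>2 + (u - t) * (t - s) / u * u / (u - s)\<^sup>2) * \<psi> s
    + (2 * (u - t) * (t - s) / (u - s)\<^sup>2 - (u - t) * (t - s) / u * (s + u) / (u - s)\<^sup>2) * \<psi> s"
  let ?rest' = "\<lambda>u. (u - t) * (t - s) / u * (\<eta> * u - \<theta>) / (u - s) * \<phi> s
    + (u - t) * (t - s) / u * (\<theta> - \<eta> * s) / (u - s) * \<phi> s
    + (u - t) * (t - s) / u * J"
  have eq: "\<psi> t = ?rest u + t * (t - s) / (u * (u - s)) * \<psi> u + ?rest' u" if "t < u" for u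
  proof -
    have su: "s < u" using st that by simp
    have "\<psi> t = ((u - t) / (u - s))\<^sup>2 * 0 + (((u - t) / (u - s))\<^sup>2 + (u - t) * (t - s) / u * u / (u - s)\<^sup>2) * \<psi> s
    + (2 * (u - t) * (t - s) / (u - s)\<^sup>2 - (u - t) * (t - s) / u * (s + u) / (u - s)\<^sup>2) * \<psi> s
    + t * (t - s) / (u * (u - s)) * \<psi> u
    + (u - t) * (t - s) / u * (\<eta> * u - \<theta>) / (u - s) * \<phi> s
    + (u - t) * (t - s) / u * (\<theta> - \<eta> * s) / (u - s) * \<phi> u
    + (u - t) * (t - s) / u * J"
      using backward_square[OF st that past_imp_past_future[OF f]] int0 int1 int2 int3 st that
      unfolding \<psi>s[OF su] J_def[symmetric] \<phi>_def[symmetric] \<psi>_def[symmetric] by simp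
    then show ?thesis unfolding \<phi>[OF su] by (simp only: add.assoc mult_zero_right add_0_left)
  qed
  have 1: "(?rest \<longlongrightarrow> 1 * \<psi> s + 0 * \<psi> s) at_top"
    by (intro tendsto_add tendsto_mult tendsto_const; real_asymp)
  have 2: "(?rest' \<longlongrightarrow> ((t - s) * \<eta>) * \<phi> s + 0 * \<phi> s + (t - s) * J) at_top"
    by (intro tendsto_add tendsto_mult[OF _ tendsto_const]; real_asymp)
  have 3: "((\<lambda>u. t * (t - s) / (u * (u - s)) * \<psi> u) \<longlongrightarrow> 0) at_top"
  proof (rule Lim_null_comparison)
    show "((\<lambda>u. t * (t - s) / (u - s) * B) \<longlongrightarrow> 0) at_top" by real_asymp
    show "\<forall>\<^sub>F u in at_top. norm (t * (t - s) / (u * (u - s)) * \<psi> u) \<le> t * (t - s) / (u - s) * B"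
      using eventually_gt_at_top[of t]
    proof eventually_elim
      case (elim u)
      then have u: "0 < u" "s < u" "0 < t" using st by auto
      have "\<bar>\<psi> u\<bar> \<le> (\<integral>\<omega>. \<bar>f \<omega> * (X u \<omega>)\<^sup>2\<bar> \<partial>M)"
        unfolding \<psi>_def by (rule integral_abs_bound)
      also have "\<dots> \<le> (\<integral>\<omega>. B * (X u \<omega>)\<^sup>2 \<partial>M)"
        using u B integrable_abs[OF int2[of u]] X_square by (intro integral_mono) (auto simp: abs_mult intro!: mult_right_mono)
      also have "\<dots> = B * u" using u expectation_square by simp
      finally have "t * (t - s) / (u * (u - s)) * \<bar>\<psi> u\<bar> \<le> t * (t - s) / (u * (u - s)) * (B * u)"
        using u st by (intro mult_left_mono) auto
      then show ?case using u st by (simp add: abs_mult)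
    qed
  qed
  have "((\<lambda>u. ?rest u + t * (t - s) / (u * (u - s)) * \<psi> u + ?rest' u) \<longlongrightarrow>
      (1 * \<psi> s + 0 * \<psi> s) + 0 + (((t - s) * \<eta>) * \<phi> s + 0 * \<phi> s + (t - s) * J)) at_top"
    by (intro tendsto_add[OF tendsto_add] 1 2 3)
  then have "((\<lambda>u::real. \<psi> t) \<longlongrightarrow> (1 * \<psi> s + 0 * \<psi> s) + 0 + (((t - s) * \<eta>) * \<phi> s + 0 * \<phi> s + (t - s) * J)) at_top"
    by (rule Lim_transform_eventually)
      (rule eventually_mono[OF eventually_gt_at_top[of t]], simp only: eq)
  then have "\<psi> t = \<psi> s + (t - s) * (J + \<eta> * \<phi> s)"
    by (simp add: tendsto_const_iff algebra_simps)
  also have "\<dots> = (\<integral>\<omega>. f \<omega> * (X s \<omega>)\<^sup>2 + (t - s) * (f \<omega> + \<eta> * (f \<omega> * X s \<omega>)) \<partial>M)"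
    unfolding \<psi>_def \<phi>_def J_def using int0 int1[OF st(1)] int2[OF st(1)] by simp
  also have "\<dots> = (\<integral>\<omega>. f \<omega> * ((X s \<omega>)\<^sup>2 + (t - s) * (1 + \<eta> * X s \<omega>)) \<partial>M)"
    by (simp add: algebra_simps)
  finally show ?thesis by (simp add: \<psi>_def)
qed

lemma forward_square:
  assumes st: "0 \<le> s" "s < t" and f: "f \<in> borel_measurable (past s)"
    and int: "integrable M (\<lambda>\<omega>. f \<omega> * (X t \<omega>)\<^sup>2)"
  shows "(\<integral>\<omega>. f \<omega> * (X t \<omega>)\<^sup>2 \<partial>M) = (\<integral>\<omega>. f \<omega> * ((X s \<omega>)\<^sup>2 + (t - s) * (1 + \<eta> * X s \<omega>)) \<partial>M)"
proof (rule integral_mult_eq_of_indicators(1)[OF subalgebra_past f _ _ _ int])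
  fix A assume "A \<in> sets (past s)"
  then show "(\<integral>\<omega>. indicator A \<omega> * (X t \<omega>)\<^sup>2 \<partial>M) =
      (\<integral>\<omega>. indicator A \<omega> * ((X s \<omega>)\<^sup>2 + (t - s) * (1 + \<eta> * X s \<omega>)) \<partial>M)"
    by (intro forward_square_bounded[where B = 1] st borel_measurable_indicator) (auto simp: indicator_def)
next
  have [measurable]: "X s \<in> borel_measurable (past s)" by (rule past_measurable_X) (use st in auto)
  show "(\<lambda>\<omega>. (X s \<omega>)\<^sup>2 + (t - s) * (1 + \<eta> * X s \<omega>)) \<in> borel_measurable (past s)" by measurable
qed (use st X_integrable X_square in auto)

text \<open>
  For \<open>t = s + 1\<close> the conditional variance of \<open>X\<^sub>t\<close> given the past of \<open>s\<close> is $1 + \<eta> X_s$, which cannot be negative.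
\<close>

lemma AE_state_space:
  assumes "0 \<le> s"
  shows "AE \<omega> in M. X s \<omega> \<in> state_space \<eta>"
proof -
  \<comment> \<open>the indicator of the event that has to be shown to be null\<close>
  define f where "f \<omega> = (indicator {x. 1 + \<eta> * x < 0} (X s \<omega>) :: real)" for \<omega>
  have Xs [measurable]: "X s \<in> borel_measurable (past s)" by (rule past_measurable_X) (use assms in auto)
  have [measurable]: "X s \<in> borel_measurable M" "X (s + 1) \<in> borel_measurable M"
    using assms X_measurable by auto
  have f: "f \<in> borel_measurable (past s)" unfolding f_def by measurable
  have fM [measurable]: "f \<in> borel_measurable M" by (rule measurable_from_subalg[OF subalgebra_past f])
  have fB: "\<bar>f \<omega>\<bar> \<le> 1" for \<omega> by (simp add: f_def indicator_def)
  note int = integrable_bounded_mult[OF fM fB]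
  have int2: "integrable M (\<lambda>\<omega>. f \<omega> * (X (s + 1) \<omega>)\<^sup>2)" "integrable M (\<lambda>\<omega>. f \<omega> * (X s \<omega>)\<^sup>2)"
    using int[OF X_square] assms by auto
  have int1: "integrable M (\<lambda>\<omega>. f \<omega> * (X s \<omega> * X (s + 1) \<omega>))"
    using int[OF X_product_integrable] assms by auto
  have int0: "integrable M (\<lambda>\<omega>. f \<omega> * (1 + \<eta> * X s \<omega>))"
    using int[of "\<lambda>\<omega>. 1 + \<eta> * X s \<omega>"] X_integrable[OF assms] by simp
  have "(\<integral>\<omega>. f \<omega> * X s \<omega> * X (s + 1) \<omega> \<partial>M) = (\<integral>\<omega>. f \<omega> * X s \<omega> * X s \<omega> \<partial>M)"
    using assms int1 f Xs by (intro forward_linear borel_measurable_times) (auto simp: mult.assoc)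
  then have cross: "(\<integral>\<omega>. f \<omega> * (X s \<omega> * X (s + 1) \<omega>) \<partial>M) = (\<integral>\<omega>. f \<omega> * (X s \<omega>)\<^sup>2 \<partial>M)"
    by (simp add: power2_eq_square mult.assoc)
  have sq: "(\<integral>\<omega>. f \<omega> * (X (s + 1) \<omega>)\<^sup>2 \<partial>M) =
      (\<integral>\<omega>. f \<omega> * (X s \<omega>)\<^sup>2 \<partial>M) + (\<integral>\<omega>. f \<omega> * (1 + \<eta> * X s \<omega>) \<partial>M)"
    using forward_square[of s "s + 1" f] assms f int2 int0 by (simp add: distrib_left)
  have "0 \<le> (\<integral>\<omega>. f \<omega> * (X (s + 1) \<omega> - X s \<omega>)\<^sup>2 \<partial>M)"
    by (intro integral_nonneg_AE AE_I2) (auto simp: f_def)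
  also have "\<dots> = (\<integral>\<omega>. f \<omega> * (X (s + 1) \<omega>)\<^sup>2 - 2 * (f \<omega> * (X s \<omega> * X (s + 1) \<omega>)) + f \<omega> * (X s \<omega>)\<^sup>2 \<partial>M)"
    by (simp add: power2_diff algebra_simps)
  also have "\<dots> = (\<integral>\<omega>. f \<omega> * (1 + \<eta> * X s \<omega>) \<partial>M)"
    using int1 int2 by (simp add: cross sq)
  finally have "(\<integral>\<omega>. - (f \<omega> * (1 + \<eta> * X s \<omega>)) \<partial>M) \<le> 0" by simp
  moreover have nonneg: "0 \<le> - (f \<omega> * (1 + \<eta> * X s \<omega>))" for \<omega>
    by (simp add: f_def indicator_def)
  ultimately have "(\<integral>\<omega>. - (f \<omega> * (1 + \<eta> * X s \<omega>)) \<partial>M) = 0"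
    by (intro antisym integral_nonneg_AE AE_I2) auto
  then have "AE \<omega> in M. - (f \<omega> * (1 + \<eta> * X s \<omega>)) = 0"
    using nonneg int0 by (subst (asm) integral_nonneg_eq_0_iff_AE) auto
  then show ?thesis
    by eventually_elim (auto simp: f_def indicator_def state_space_def split: if_splits)
qed

section \<open>Finiteness of all moments\<close>

text \<open>
  Let \<open>A = X\<^sub>t\<close> and \<open>B = X\<^bsub>2t\<^esub>\<close>. The identity \<open>A = 2(A - B/2) + (B - A)\<close> shows that \<open>A\<close> is large only if one of the two
  differences is comparable with it. The conditional second moments of \<open>B - A\<close> given \<open>A\<close> and of
  \<open>A - B/2\<close> given \<open>B\<close> grow only linearly, so one power is gained: moments of order \<open>k + 1\<close> control a
  truncated moment of order \<open>k + 2\<close>, uniformly in the truncation level \<open>L\<close>.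
\<close>

lemma integrable_truncated_moment_bound:
  assumes t: "0 < t" and L: "0 \<le> L"
    and int: "\<And>r. 0 \<le> r \<Longrightarrow> integrable M (\<lambda>\<omega>. \<bar>X r \<omega>\<bar> ^ k)" "\<And>r. 0 \<le> r \<Longrightarrow> integrable M (\<lambda>\<omega>. \<bar>X r \<omega>\<bar> ^ Suc k)"
  shows "integrable M (\<lambda>\<omega>. (X t \<omega>)\<^sup>2 * min \<bar>X t \<omega>\<bar> L ^ k)"
    and "(\<integral>\<omega>. (X t \<omega>)\<^sup>2 * min \<bar>X t \<omega>\<bar> L ^ k \<partial>M) \<le>
      4 * t * (\<integral>\<omega>. \<bar>X t \<omega>\<bar> ^ k + \<bar>\<eta>\<bar> * \<bar>X t \<omega>\<bar> ^ Suc k \<partial>M)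
      + 16 * 2 ^ k * (\<integral>\<omega>. \<bar>\<theta>\<bar> / 4 * \<bar>X (2 * t) \<omega>\<bar> ^ Suc k + t / 2 * \<bar>X (2 * t) \<omega>\<bar> ^ k \<partial>M)"
proof -
  define A where "A = X t"
  define B where "B = X (2 * t)"
  define g where "g x = min \<bar>x\<bar> L ^ k" for x
  define f where "f \<omega> = g (A \<omega>)" for \<omega>
  define h where "h \<omega> = g (2 * B \<omega>)" for \<omega>
  have g0: "0 \<le> g x" and gL: "\<bar>g x\<bar> \<le> L ^ k" and gx: "g x \<le> \<bar>x\<bar> ^ k" for x
    using L by (auto simp: g_def power_mono)
  have g_mono: "g x \<le> g y" if "\<bar>x\<bar> \<le> \<bar>y\<bar>" for x y
    using that L by (auto simp: g_def intro!: power_mono)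
  have [measurable]: "g \<in> borel_measurable borel" unfolding g_def by measurable
  have [measurable]: "A \<in> borel_measurable M" "B \<in> borel_measurable M"
    using X_measurable t by (auto simp: A_def B_def)
  have Ap [measurable]: "A \<in> borel_measurable (past t)"
    unfolding A_def using t by (intro past_measurable_X) auto
  have fp: "f \<in> borel_measurable (past t)" unfolding f_def by measurable
  have [measurable]: "B \<in> borel_measurable (past_future 0 (2 * t))"
    unfolding B_def by (rule measurable_sigma_gen) auto
  have hp: "h \<in> borel_measurable (past_future 0 (2 * t))" unfolding h_def by measurable
  have fM: "f \<in> borel_measurable M" and hM: "h \<in> borel_measurable M"
    unfolding f_def h_def by measurable
  have fL: "\<bar>f \<omega>\<bar> \<le> L ^ k" and hL: "\<bar>h \<omega>\<bar> \<le> L ^ k" for \<omega>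
    unfolding f_def h_def by (rule gL)+
  note intf = integrable_bounded_mult[OF fM fL] and inth = integrable_bounded_mult[OF hM hL]
  have sq: "integrable M (\<lambda>\<omega>. (A \<omega>)\<^sup>2)" "integrable M (\<lambda>\<omega>. (B \<omega>)\<^sup>2)"
      "integrable M (\<lambda>\<omega>. A \<omega> * B \<omega>)" "integrable M A" "integrable M B" "integrable M (\<lambda>\<omega>. X 0 \<omega>)"
      "integrable M (\<lambda>\<omega>. (X 0 \<omega>)\<^sup>2)" "integrable M (\<lambda>\<omega>. X 0 \<omega> * B \<omega>)" "integrable M (\<lambda>\<omega>. 1 :: real)"
    unfolding A_def B_def using t X_square X_product_integrable X_integrable by auto
  note if' = sq[THEN intf] and ih = sq[THEN inth]

  have "(\<integral>\<omega>. f \<omega> * A \<omega> * B \<omega> \<partial>M) = (\<integral>\<omega>. f \<omega> * A \<omega> * A \<omega> \<partial>M)"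
    unfolding B_def A_def using t fp Ap if'(3)
    by (intro forward_linear) (auto simp: A_def B_def mult.assoc)
  then have cross_f: "(\<integral>\<omega>. f \<omega> * (A \<omega> * B \<omega>) \<partial>M) = (\<integral>\<omega>. f \<omega> * (A \<omega>)\<^sup>2 \<partial>M)"
    by (simp add: power2_eq_square mult.assoc)
  have sq_f: "(\<integral>\<omega>. f \<omega> * (B \<omega>)\<^sup>2 \<partial>M) = (\<integral>\<omega>. f \<omega> * ((A \<omega>)\<^sup>2 + (2 * t - t) * (1 + \<eta> * A \<omega>)) \<partial>M)"
    unfolding A_def B_def using t if'(2) by (intro forward_square fp) (auto simp: B_def)
  have "(\<integral>\<omega>. f \<omega> * (B \<omega> - A \<omega>)\<^sup>2 \<partial>M) = (\<integral>\<omega>. f \<omega> * (B \<omega>)\<^sup>2 - 2 * (f \<omega> * (A \<omega> * B \<omega>)) + f \<omega> * (A \<omega>)\<^sup>2 \<partial>M)"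
    by (simp add: power2_diff algebra_simps)
  also have "\<dots> = (\<integral>\<omega>. f \<omega> * (B \<omega>)\<^sup>2 \<partial>M) - (\<integral>\<omega>. f \<omega> * (A \<omega>)\<^sup>2 \<partial>M)"
    using if' by (simp add: cross_f)
  also have "(\<integral>\<omega>. f \<omega> * (B \<omega>)\<^sup>2 \<partial>M) = (\<integral>\<omega>. f \<omega> * (A \<omega>)\<^sup>2 + t * (f \<omega> * 1 + \<eta> * (f \<omega> * A \<omega>)) \<partial>M)"
    unfolding sq_f by (simp add: algebra_simps)
  also have "\<dots> = (\<integral>\<omega>. f \<omega> * (A \<omega>)\<^sup>2 \<partial>M) + t * (\<integral>\<omega>. f \<omega> * 1 + \<eta> * (f \<omega> * A \<omega>) \<partial>M)"
    using if' by simp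
  finally have var_f: "(\<integral>\<omega>. f \<omega> * (B \<omega> - A \<omega>)\<^sup>2 \<partial>M) = t * (\<integral>\<omega>. f \<omega> * 1 + \<eta> * (f \<omega> * A \<omega>) \<partial>M)"
    by simp
  have le_f: "(\<integral>\<omega>. f \<omega> * 1 + \<eta> * (f \<omega> * A \<omega>) \<partial>M) \<le> (\<integral>\<omega>. \<bar>A \<omega>\<bar> ^ k + \<bar>\<eta>\<bar> * \<bar>A \<omega>\<bar> ^ Suc k \<partial>M)"
  proof (rule integral_mono)
    show "integrable M (\<lambda>\<omega>. f \<omega> * 1 + \<eta> * (f \<omega> * A \<omega>))" using if' by simp
    show "integrable M (\<lambda>\<omega>. \<bar>A \<omega>\<bar> ^ k + \<bar>\<eta>\<bar> * \<bar>A \<omega>\<bar> ^ Suc k)"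
      using int t unfolding A_def by (intro Bochner_Integration.integrable_add integrable_mult_right) auto
    fix \<omega>
    have 1: "f \<omega> \<le> \<bar>A \<omega>\<bar> ^ k" "0 \<le> f \<omega>" by (simp_all add: f_def gx g0)
    have "\<eta> * (f \<omega> * A \<omega>) \<le> \<bar>\<eta>\<bar> * (f \<omega> * \<bar>A \<omega>\<bar>)"
      using 1(2) by (metis abs_ge_self abs_mult abs_of_nonneg)
    also have "\<dots> \<le> \<bar>\<eta>\<bar> * (\<bar>A \<omega>\<bar> ^ k * \<bar>A \<omega>\<bar>)"
      using 1 by (intro mult_left_mono mult_right_mono) auto
    finally show "f \<omega> * 1 + \<eta> * (f \<omega> * A \<omega>) \<le> \<bar>A \<omega>\<bar> ^ k + \<bar>\<eta>\<bar> * \<bar>A \<omega>\<bar> ^ Suc k"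
      using 1 by (simp add: mult_ac)
  qed

  have X0: "(\<integral>\<omega>. h \<omega> * X 0 \<omega> \<partial>M) = 0" "(\<integral>\<omega>. h \<omega> * (X 0 \<omega>)\<^sup>2 \<partial>M) = 0"
      "(\<integral>\<omega>. h \<omega> * (X 0 \<omega> * B \<omega>) \<partial>M) = 0"
    using AE_X_0 by (auto intro!: integral_eq_zero_AE elim!: eventually_mono)
  have "(\<integral>\<omega>. h \<omega> * B \<omega> * A \<omega> \<partial>M) = (2 * t - t) / (2 * t - 0) * (\<integral>\<omega>. h \<omega> * B \<omega> * X 0 \<omega> \<partial>M)
      + (t - 0) / (2 * t - 0) * (\<integral>\<omega>. h \<omega> * B \<omega> * X (2 * t) \<omega> \<partial>M)"
    unfolding A_def using t ih(2,3,8)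
    by (intro backward_linear borel_measurable_times hp)
      (auto simp: A_def B_def mult_ac power2_eq_square intro: measurable_sigma_gen)
  then have cross_h: "(\<integral>\<omega>. h \<omega> * (A \<omega> * B \<omega>) \<partial>M) = (\<integral>\<omega>. h \<omega> * (B \<omega>)\<^sup>2 \<partial>M) / 2"
    using t X0 by (simp add: B_def power2_eq_square mult_ac)
  have sq_h: "(\<integral>\<omega>. h \<omega> * (A \<omega>)\<^sup>2 \<partial>M) = (\<integral>\<omega>. h \<omega> * (B \<omega>)\<^sup>2 \<partial>M) / 4 + (\<theta> / 4 * (\<integral>\<omega>. h \<omega> * B \<omega> \<partial>M)
      + t / 2 * (\<integral>\<omega>. h \<omega> \<partial>M))"
  proof -
    have "(\<integral>\<omega>. h \<omega> * (A \<omega>)\<^sup>2 \<partial>M) = t * (t - 0) / (2 * t * (2 * t - 0)) * (\<integral>\<omega>. h \<omega> * (B \<omega>)\<^sup>2 \<partial>M)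
      + (2 * t - t) * (t - 0) / (2 * t) * (\<theta> - \<eta> * 0) / (2 * t - 0) * (\<integral>\<omega>. h \<omega> * B \<omega> \<partial>M)
      + (2 * t - t) * (t - 0) / (2 * t) * (\<integral>\<omega>. h \<omega> \<partial>M)"
      using backward_square[of 0 t "2 * t" h] ih t hp X0 by (simp add: A_def B_def)
    then show ?thesis using t by (simp add: field_simps)
  qed
  have "(\<integral>\<omega>. h \<omega> * (A \<omega> - B \<omega> / 2)\<^sup>2 \<partial>M) =
      (\<integral>\<omega>. h \<omega> * (A \<omega>)\<^sup>2 - h \<omega> * (A \<omega> * B \<omega>) + h \<omega> * (B \<omega>)\<^sup>2 / 4 \<partial>M)"
    by (simp add: power2_diff power_divide algebra_simps)
  also have "\<dots> = \<theta> / 4 * (\<integral>\<omega>. h \<omega> * B \<omega> \<partial>M) + t / 2 * (\<integral>\<omega>. h \<omega> \<partial>M)"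
    using ih by (simp add: cross_h sq_h)
  also have "\<dots> = (\<integral>\<omega>. \<theta> / 4 * (h \<omega> * B \<omega>) + t / 2 * (h \<omega> * 1) \<partial>M)"
    using ih by simp
  also have "\<dots> \<le> (\<integral>\<omega>. 2 ^ k * (\<bar>\<theta>\<bar> / 4 * \<bar>B \<omega>\<bar> ^ Suc k + t / 2 * \<bar>B \<omega>\<bar> ^ k) \<partial>M)"
  proof (rule integral_mono)
    show "integrable M (\<lambda>\<omega>. \<theta> / 4 * (h \<omega> * B \<omega>) + t / 2 * (h \<omega> * 1))" using ih by simp
    show "integrable M (\<lambda>\<omega>. 2 ^ k * (\<bar>\<theta>\<bar> / 4 * \<bar>B \<omega>\<bar> ^ Suc k + t / 2 * \<bar>B \<omega>\<bar> ^ k))"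
      using int t unfolding B_def by (intro integrable_mult_right Bochner_Integration.integrable_add) auto
    fix \<omega>
    have 1: "h \<omega> \<le> 2 ^ k * \<bar>B \<omega>\<bar> ^ k" "0 \<le> h \<omega>"
      using gx[of "2 * B \<omega>"] g0 by (simp_all add: h_def abs_mult power_mult_distrib)
    have "\<theta> / 4 * (h \<omega> * B \<omega>) \<le> \<bar>\<theta>\<bar> / 4 * (h \<omega> * \<bar>B \<omega>\<bar>)"
    proof -
      have "\<theta> * (h \<omega> * B \<omega>) \<le> \<bar>\<theta> * (h \<omega> * B \<omega>)\<bar>" by (rule abs_ge_self)
      also have "\<dots> = \<bar>\<theta>\<bar> * (h \<omega> * \<bar>B \<omega>\<bar>)" using 1(2) by (simp add: abs_mult)
      finally show ?thesis by simp
    qed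
    also have "\<dots> \<le> \<bar>\<theta>\<bar> / 4 * (2 ^ k * \<bar>B \<omega>\<bar> ^ k * \<bar>B \<omega>\<bar>)"
      using 1 by (intro mult_left_mono mult_right_mono) auto
    finally have 2: "\<theta> / 4 * (h \<omega> * B \<omega>) \<le> 2 ^ k * (\<bar>\<theta>\<bar> / 4 * \<bar>B \<omega>\<bar> ^ Suc k)" by (simp add: mult_ac)
    have "t / 2 * (h \<omega> * 1) \<le> t / 2 * (2 ^ k * \<bar>B \<omega>\<bar> ^ k)"
      using 1 t by (intro mult_left_mono) auto
    then show "\<theta> / 4 * (h \<omega> * B \<omega>) + t / 2 * (h \<omega> * 1) \<le> 2 ^ k * (\<bar>\<theta>\<bar> / 4 * \<bar>B \<omega>\<bar> ^ Suc k + t / 2 * \<bar>B \<omega>\<bar> ^ k)"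
      using 2 by (simp only: distrib_left mult.left_commute)
  qed
  finally have le_h: "(\<integral>\<omega>. h \<omega> * (A \<omega> - B \<omega> / 2)\<^sup>2 \<partial>M) \<le>
      2 ^ k * (\<integral>\<omega>. \<bar>\<theta>\<bar> / 4 * \<bar>B \<omega>\<bar> ^ Suc k + t / 2 * \<bar>B \<omega>\<bar> ^ k \<partial>M)" by simp

  \<comment> \<open>if \<open>B - A\<close> is small against \<open>A\<close>, then \<open>A - B/2\<close> is not, and \<open>\<bar>A\<bar> \<le> 2\<bar>B\<bar>\<close>; hence the argument \<open>2B\<close> in \<open>h\<close>\<close>
  have pointwise: "(A \<omega>)\<^sup>2 * f \<omega> \<le> 4 * (f \<omega> * (B \<omega> - A \<omega>)\<^sup>2) + 16 * (h \<omega> * (A \<omega> - B \<omega> / 2)\<^sup>2)" for \<omega>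
  proof (cases "\<bar>A \<omega>\<bar> \<le> 2 * \<bar>B \<omega> - A \<omega>\<bar>")
    case True
    then have "\<bar>A \<omega>\<bar> \<le> \<bar>2 * (B \<omega> - A \<omega>)\<bar>" by (simp only: abs_mult abs_numeral)
    then have "(A \<omega>)\<^sup>2 \<le> (2 * (B \<omega> - A \<omega>))\<^sup>2" by (rule abs_le_square_iff[THEN iffD1])
    then have "(A \<omega>)\<^sup>2 \<le> 4 * (B \<omega> - A \<omega>)\<^sup>2" unfolding power_mult_distrib by simp
    then have "f \<omega> * (A \<omega>)\<^sup>2 \<le> f \<omega> * (4 * (B \<omega> - A \<omega>)\<^sup>2)"
      by (intro mult_left_mono) (auto simp: f_def g0)
    moreover have "0 \<le> h \<omega> * (A \<omega> - B \<omega> / 2)\<^sup>2" by (simp add: h_def g0)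
    ultimately show ?thesis by (simp add: mult_ac)
  next
    case False
    then have "\<bar>A \<omega>\<bar> \<le> \<bar>4 * (A \<omega> - B \<omega> / 2)\<bar>" "\<bar>A \<omega>\<bar> \<le> \<bar>2 * B \<omega>\<bar>" by (auto simp: abs_if split: if_splits)
    then have "(A \<omega>)\<^sup>2 \<le> (4 * (A \<omega> - B \<omega> / 2))\<^sup>2" "f \<omega> \<le> h \<omega>"
      unfolding abs_le_square_iff[symmetric] f_def h_def by (simp_all only: g_mono)
    then have "(A \<omega>)\<^sup>2 * f \<omega> \<le> (4 * (A \<omega> - B \<omega> / 2))\<^sup>2 * h \<omega>"
      by (intro mult_mono) (auto simp: f_def g0)
    moreover have "0 \<le> f \<omega> * (B \<omega> - A \<omega>)\<^sup>2" by (simp add: f_def g0)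
    moreover have "(4 * (A \<omega> - B \<omega> / 2))\<^sup>2 * h \<omega> = 16 * (h \<omega> * (A \<omega> - B \<omega> / 2)\<^sup>2)"
      unfolding power_mult_distrib by simp
    ultimately show ?thesis by linarith
  qed
  have int_l: "integrable M (\<lambda>\<omega>. (A \<omega>)\<^sup>2 * f \<omega>)" using if'(1) by (simp add: mult.commute)
  then show "integrable M (\<lambda>\<omega>. (X t \<omega>)\<^sup>2 * min \<bar>X t \<omega>\<bar> L ^ k)" by (simp add: A_def f_def g_def)
  have int_f: "integrable M (\<lambda>\<omega>. f \<omega> * (B \<omega> - A \<omega>)\<^sup>2)"
  proof (rule intf)
    have "(\<lambda>\<omega>. (B \<omega> - A \<omega>)\<^sup>2) = (\<lambda>\<omega>. (B \<omega>)\<^sup>2 + (A \<omega>)\<^sup>2 - 2 * (A \<omega> * B \<omega>))"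
      by (simp add: power2_diff fun_eq_iff)
    then show "integrable M (\<lambda>\<omega>. (B \<omega> - A \<omega>)\<^sup>2)" using sq by simp
  qed
  have int_h: "integrable M (\<lambda>\<omega>. h \<omega> * (A \<omega> - B \<omega> / 2)\<^sup>2)"
    by (rule inth) (use sq in \<open>simp add: power2_diff power_divide\<close>)
  have "(\<integral>\<omega>. (A \<omega>)\<^sup>2 * f \<omega> \<partial>M) \<le>
      (\<integral>\<omega>. 4 * (f \<omega> * (B \<omega> - A \<omega>)\<^sup>2) + 16 * (h \<omega> * (A \<omega> - B \<omega> / 2)\<^sup>2) \<partial>M)"
    using int_l int_f int_h by (intro integral_mono pointwise) auto
  also have "\<dots> = 4 * (\<integral>\<omega>. f \<omega> * (B \<omega> - A \<omega>)\<^sup>2 \<partial>M) + 16 * (\<integral>\<omega>. h \<omega> * (A \<omega> - B \<omega> / 2)\<^sup>2 \<partial>M)"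
    using int_f int_h by simp
  also have "\<dots> \<le> 4 * (t * (\<integral>\<omega>. \<bar>A \<omega>\<bar> ^ k + \<bar>\<eta>\<bar> * \<bar>A \<omega>\<bar> ^ Suc k \<partial>M))
      + 16 * (2 ^ k * (\<integral>\<omega>. \<bar>\<theta>\<bar> / 4 * \<bar>B \<omega>\<bar> ^ Suc k + t / 2 * \<bar>B \<omega>\<bar> ^ k \<partial>M))"
    unfolding var_f using le_f le_h t by (intro add_mono mult_left_mono) auto
  finally show "(\<integral>\<omega>. (X t \<omega>)\<^sup>2 * min \<bar>X t \<omega>\<bar> L ^ k \<partial>M) \<le>
      4 * t * (\<integral>\<omega>. \<bar>X t \<omega>\<bar> ^ k + \<bar>\<eta>\<bar> * \<bar>X t \<omega>\<bar> ^ Suc k \<partial>M)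
      + 16 * 2 ^ k * (\<integral>\<omega>. \<bar>\<theta>\<bar> / 4 * \<bar>X (2 * t) \<omega>\<bar> ^ Suc k + t / 2 * \<bar>X (2 * t) \<omega>\<bar> ^ k \<partial>M)"
    by (simp add: A_def B_def f_def g_def mult.assoc)
qed

text \<open>
  The truncation is removed by monotone convergence.
\<close>

lemma integrable_X_power: "0 \<le> t \<Longrightarrow> integrable M (\<lambda>\<omega>. \<bar>X t \<omega>\<bar> ^ n)"
proof (induction n arbitrary: t rule: less_induct)
  case (less n)
  consider "n = 0" | "n = 1" | k where "n = Suc (Suc k)" by (metis One_nat_def not0_implies_Suc)
  then show ?case
  proof cases
    case 2
    then show ?thesis using X_integrable less.prems by simp
  next
    case 3
    have [measurable]: "X t \<in> borel_measurable M" using X_measurable less.prems by simp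
    show ?thesis
    proof (cases "t = 0")
      case True
      have "AE \<omega> in M. \<bar>X t \<omega>\<bar> ^ n = 0"
        using AE_X_0 by eventually_elim (simp add: True 3)
      then show ?thesis by (subst integrable_cong_AE[of _ _ "\<lambda>_. 0"]) auto
    next
      case False
      then have t: "0 < t" using less.prems by simp
      have int: "integrable M (\<lambda>\<omega>. \<bar>X r \<omega>\<bar> ^ k)" "integrable M (\<lambda>\<omega>. \<bar>X r \<omega>\<bar> ^ Suc k)" if "0 \<le> r" for r
        using less.IH[of k r] less.IH[of "Suc k" r] 3 that by auto
      let ?Y = "\<lambda>i \<omega>. (X t \<omega>)\<^sup>2 * min \<bar>X t \<omega>\<bar> (real i) ^ k"
      have trunc: "integrable M (?Y i)" for i
        by (rule integrable_truncated_moment_bound(1)[OF t of_nat_0_le_iff]) (use int in auto)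
      have "\<exists>C. \<forall>i. (\<integral>\<omega>. ?Y i \<omega> \<partial>M) \<le> C"
        by (rule exI, rule allI, rule integrable_truncated_moment_bound(2)[OF t of_nat_0_le_iff])
          (use int in auto)
      then obtain C where C: "\<forall>i. (\<integral>\<omega>. ?Y i \<omega> \<partial>M) \<le> C" by blast
      have mono: "(X t \<omega>)\<^sup>2 * min \<bar>X t \<omega>\<bar> (real i) ^ k \<le> (X t \<omega>)\<^sup>2 * min \<bar>X t \<omega>\<bar> (real j) ^ k"
        if "i \<le> j" for i j \<omega>
        using that by (intro mult_left_mono power_mono) auto
      have "incseq (\<lambda>i. \<integral>\<omega>. ?Y i \<omega> \<partial>M)"
        by (intro incseq_SucI integral_mono trunc mono) auto
      then obtain l where l: "(\<lambda>i. \<integral>\<omega>. ?Y i \<omega> \<partial>M) \<longlonglongrightarrow> l"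
        using incseq_convergent[OF _ C] by blast
      have "integrable M (\<lambda>\<omega>. (X t \<omega>)\<^sup>2 * \<bar>X t \<omega>\<bar> ^ k)"
      proof (rule integrable_monotone_convergence)
        show "integrable M (?Y i)" for i by (rule trunc)
        show "AE \<omega> in M. mono (\<lambda>i. ?Y i \<omega>)" by (intro AE_I2 monoI mono)
        show "AE \<omega> in M. (\<lambda>i. ?Y i \<omega>) \<longlonglongrightarrow> (X t \<omega>)\<^sup>2 * \<bar>X t \<omega>\<bar> ^ k"
        proof (rule AE_I2)
          fix \<omega>
          have "\<forall>\<^sub>F i in sequentially. (X t \<omega>)\<^sup>2 * \<bar>X t \<omega>\<bar> ^ k = ?Y i \<omega>"
            using eventually_ge_at_top[of "nat \<lceil>\<bar>X t \<omega>\<bar>\<rceil>"]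
          proof eventually_elim
            case (elim i)
            then have "\<bar>X t \<omega>\<bar> \<le> real i" by linarith
            then show ?case by (simp add: min_absorb1)
          qed
          then show "(\<lambda>i. ?Y i \<omega>) \<longlonglongrightarrow> (X t \<omega>)\<^sup>2 * \<bar>X t \<omega>\<bar> ^ k"
            by (rule Lim_transform_eventually[OF tendsto_const])
        qed
        show "(\<lambda>i. \<integral>\<omega>. ?Y i \<omega> \<partial>M) \<longlonglongrightarrow> l" by (rule l)
      qed simp
      then show ?thesis by (simp add: 3 power2_eq_square abs_mult[symmetric] mult.assoc[symmetric])
    qed
  qed simp
qed

end

section \<open>The martingale property\<close>

context prob_space
begin

text \<open>
  The class of test variables. It is closed under products, so the moment identities can be used for
  products of powers of the process at several times.
\<close>

definition finite_moments :: "('a \<Rightarrow> real) \<Rightarrow> bool" where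
  "finite_moments f \<longleftrightarrow> f \<in> borel_measurable M \<and> (\<forall>n. integrable M (\<lambda>\<omega>. \<bar>f \<omega>\<bar> ^ n))"

lemma finite_moments_integrable:
  assumes "finite_moments f" shows "integrable M f"
proof -
  have "integrable M (\<lambda>\<omega>. \<bar>f \<omega>\<bar> ^ 1)" "f \<in> borel_measurable M"
    using assms unfolding finite_moments_def by blast+
  then show ?thesis by (simp add: integrable_abs_iff)
qed

lemma finite_moments_mult:
  assumes "finite_moments f" "finite_moments g"
  shows "finite_moments (\<lambda>\<omega>. f \<omega> * g \<omega>)"
proof -
  have [measurable]: "f \<in> borel_measurable M" "g \<in> borel_measurable M"
    using assms by (auto simp: finite_moments_def)
  have "integrable M (\<lambda>\<omega>. \<bar>f \<omega>\<bar> ^ n * \<bar>g \<omega>\<bar> ^ n)" for n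
  proof (rule integrable_mult_square)
    show "integrable M (\<lambda>\<omega>. (\<bar>f \<omega>\<bar> ^ n)\<^sup>2)" "integrable M (\<lambda>\<omega>. (\<bar>g \<omega>\<bar> ^ n)\<^sup>2)"
      using assms unfolding power_mult[symmetric] finite_moments_def by blast+
  qed measurable
  then show ?thesis by (simp add: finite_moments_def abs_mult power_mult_distrib)
qed

lemma finite_moments_add:
  assumes "finite_moments f" "finite_moments g"
  shows "finite_moments (\<lambda>\<omega>. f \<omega> + g \<omega>)"
proof -
  have [measurable]: "f \<in> borel_measurable M" "g \<in> borel_measurable M"
    using assms by (auto simp: finite_moments_def)
  have "integrable M (\<lambda>\<omega>. \<bar>f \<omega> + g \<omega>\<bar> ^ n)" for n
  proof (rule Bochner_Integration.integrable_bound)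
    show "integrable M (\<lambda>\<omega>. 2 ^ n * (\<bar>f \<omega>\<bar> ^ n + \<bar>g \<omega>\<bar> ^ n))"
      using assms by (auto simp: finite_moments_def)
    have "\<bar>a + b\<bar> ^ n \<le> 2 ^ n * (\<bar>a\<bar> ^ n + \<bar>b\<bar> ^ n)" for a b :: real
    proof -
      have "\<bar>a + b\<bar> \<le> 2 * max \<bar>a\<bar> \<bar>b\<bar>"
        using abs_triangle_ineq[of a b] by (auto simp: max_def)
      then have "\<bar>a + b\<bar> ^ n \<le> (2 * max \<bar>a\<bar> \<bar>b\<bar>) ^ n" by (rule power_mono) simp
      also have "\<dots> = 2 ^ n * (max \<bar>a\<bar> \<bar>b\<bar>) ^ n" by (rule power_mult_distrib)
      also have "\<dots> \<le> 2 ^ n * (\<bar>a\<bar> ^ n + \<bar>b\<bar> ^ n)"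
        by (intro mult_left_mono) (auto simp: max_def)
      finally show ?thesis .
    qed
    then show "AE \<omega> in M. norm (\<bar>f \<omega> + g \<omega>\<bar> ^ n) \<le> norm (2 ^ n * (\<bar>f \<omega>\<bar> ^ n + \<bar>g \<omega>\<bar> ^ n))"
      by simp
  qed simp
  then show ?thesis by (simp add: finite_moments_def)
qed

lemma finite_moments_bounded:
  assumes "f \<in> borel_measurable M" "AE \<omega> in M. \<bar>f \<omega>\<bar> \<le> B"
  shows "finite_moments f"
proof -
  have "integrable M (\<lambda>\<omega>. \<bar>f \<omega>\<bar> ^ n)" for n
    using assms by (intro integrable_const_bound[where B = "B ^ n"]) (auto intro: power_mono elim!: eventually_mono)
  then show ?thesis using assms by (simp add: finite_moments_def)
qed

lemma finite_moments_const: "finite_moments (\<lambda>\<omega>. c)"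
  by (rule finite_moments_bounded[where B = "\<bar>c\<bar>"]) auto

lemma finite_moments_poly:
  assumes "finite_moments f"
  shows "finite_moments (\<lambda>\<omega>. poly p (f \<omega>))"
proof (induction p)
  case (pCons a p)
  then show ?case
    by (simp add: finite_moments_add finite_moments_const finite_moments_mult assms)
qed (simp add: finite_moments_const)

lemma finite_moments_power: "finite_moments f \<Longrightarrow> finite_moments (\<lambda>\<omega>. f \<omega> ^ n)"
  using finite_moments_poly[of f "monom 1 n"] by (simp add: poly_monom)

lemmas finite_moments_intros =
  finite_moments_mult finite_moments_add finite_moments_const finite_moments_poly finite_moments_power

end

lemma martingale_poly_three_term:
  "y * poly (martingale_poly \<eta> \<theta> k r) y = poly (martingale_poly \<eta> \<theta> (Suc k) r) y
     + Q_diag \<eta> \<theta> 0 r 0 k * poly (martingale_poly \<eta> \<theta> k r) y + Q_offdiag \<eta> \<theta> 0 r 0 k * poly (martingale_poly \<eta> \<theta> (k - 1) r) y"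
  using arg_cong[OF three_term_recurrence.recurrence[OF three_term_recurrence_Q_poly[of \<eta> \<theta> 0 r 0], of k], of "\<lambda>p. poly p y"]
  by (simp add: martingale_poly_def)

text \<open>
  The two linear equations for \<open>Nt\<close> and \<open>Nu\<close>, where \<open>Nr\<close> stands for the expectation of $f p_{n+1}(X_r;r)$ and \<open>e2\<close>,
  \<open>e1\<close>, \<open>e0\<close>, \<open>em\<close> for those of $f p_k(X_s;s)$ with \<open>k\<close> going down from \<open>n\<close>. The quantities \<open>P2\<close>, \<open>P1\<close>,
  \<open>P0\<close> are the expectations of $f X_r p_k(X_r;r)$ for \<open>k = n, n-1, n-2\<close>. The lower order terms cancel,
  so that the equations say \<open>(u - s) (Nt - Ns) = (t - s) (Nu - Ns)\<close> and
  \<open>u (u - s) (Nt - Ns) = t (t - s) (Nu - Ns)\<close>. The three alternatives for the recurrence coefficients are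
  \<open>n = 2\<close>, \<open>n = 3\<close> and \<open>n > 3\<close>.
\<close>

lemma martingale_step_algebra:
  fixes s t u :: real and e2 e1 e0 em Ns Nt Nu \<eta> \<theta> c :: real and A0 B0 B1 :: "real \<Rightarrow> real"
  defines "a \<equiv> \<lambda>r. r * \<eta> + \<theta>" and "c \<equiv> 1 + \<eta> * \<theta>"
  defines "P2 \<equiv> \<lambda>r N. N + a r * e2 + c * r * e1"
    and "P1 \<equiv> \<lambda>r. e2 + a r * e1 + B1 r * e0" and "P0 \<equiv> \<lambda>r. e1 + A0 r * e0 + B0 r * em"
  assumes less: "0 \<le> s" "s < t" "t < u"
    and coeffs: "(\<forall>r. A0 r = 0 \<and> B0 r = 0 \<and> B1 r = r) \<or> (\<forall>r. A0 r = a r \<and> B0 r = r \<and> B1 r = c * r)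
      \<or> (\<forall>r. A0 r = a r \<and> B0 r = c * r \<and> B1 r = c * r)"
    and h1: "P2 t Nt = (u - t) / (u - s) * P2 s Ns + (t - s) / (u - s) * P2 u Nu"
    and h2: "P2 t Nt + a t * P1 t + B1 t * P0 t =
      (((u - t) / (u - s))\<^sup>2 + (u - t) * (t - s) / u * u / (u - s)\<^sup>2) * (P2 s Ns + a s * P1 s + B1 s * P0 s)
      + (2 * (u - t) * (t - s) / (u - s)\<^sup>2 - (u - t) * (t - s) / u * (s + u) / (u - s)\<^sup>2)
          * (P2 s Ns + a u * P1 s + B1 u * P0 s)
      + t * (t - s) / (u * (u - s)) * (P2 u Nu + a u * P1 u + B1 u * P0 u)
      + (u - t) * (t - s) / u * (\<eta> * u - \<theta>) / (u - s) * P1 s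
      + (u - t) * (t - s) / u * (\<theta> - \<eta> * s) / (u - s) * P1 u
      + (u - t) * (t - s) / u * e1"
  shows "Nu = Ns"
proof -
  have nz: "u \<noteq> 0" "u - s \<noteq> 0" using less by auto
  have "(u - s) * P2 t Nt = (u - t) * P2 s Ns + (t - s) * P2 u Nu"
    unfolding h1 using nz by (simp add: distrib_left)
  then have k1: "(u - s) * (Nt - Ns) = (t - s) * (Nu - Ns)"
    unfolding P2_def a_def by (simp add: algebra_simps)
  let ?d = "u - s"
  have c1: "u * ?d\<^sup>2 * (((u - t) / ?d)\<^sup>2 + (u - t) * (t - s) / u * u / ?d\<^sup>2) = u * (u - t)\<^sup>2 + u * (u - t) * (t - s)"
    using nz by (simp add: distrib_left power_divide)
  have c2: "u * ?d\<^sup>2 * (2 * (u - t) * (t - s) / ?d\<^sup>2 - (u - t) * (t - s) / u * (s + u) / ?d\<^sup>2)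
      = (u - s) * (u - t) * (t - s)"
  proof -
    have "u * z * (p / z - q / u * w / z) = u * p - q * w" if "z \<noteq> 0" for z p q w
      using that nz by (simp add: right_diff_distrib)
    from this[of "?d\<^sup>2" "2 * (u - t) * (t - s)" "(u - t) * (t - s)" "s + u"] show ?thesis
      using nz by (simp add: algebra_simps)
  qed
  have c3: "u * ?d\<^sup>2 * (t * (t - s) / (u * ?d)) = ?d * t * (t - s)"
    using nz by (simp add: power2_eq_square)
  have c4: "u * ?d\<^sup>2 * ((u - t) * (t - s) / u * z / ?d) = ?d * (u - t) * (t - s) * z" for z
    using nz by (simp add: power2_eq_square)
  have c5: "u * ?d\<^sup>2 * ((u - t) * (t - s) / u) = ?d\<^sup>2 * (u - t) * (t - s)"
    using nz by simp
  have dist: "k * (a1 * A1 + a2 * A2 + a3 * A3 + a4 * A4 + a5 * A5 + a6 * A6) =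
      (k * a1) * A1 + (k * a2) * A2 + (k * a3) * A3 + (k * a4) * A4 + (k * a5) * A5 + (k * a6) * A6"
    for k a1 a2 a3 a4 a5 a6 A1 A2 A3 A4 A5 A6 :: real
    by (simp only: distrib_left mult.assoc)
  have "u * ?d\<^sup>2 * (P2 t Nt + a t * P1 t + B1 t * P0 t) =
      (u * (u - t)\<^sup>2 + u * (u - t) * (t - s)) * (P2 s Ns + a s * P1 s + B1 s * P0 s)
      + ((u - s) * (u - t) * (t - s)) * (P2 s Ns + a u * P1 s + B1 u * P0 s)
      + (?d * t * (t - s)) * (P2 u Nu + a u * P1 u + B1 u * P0 u)
      + (?d * (u - t) * (t - s) * (\<eta> * u - \<theta>)) * P1 s
      + (?d * (u - t) * (t - s) * (\<theta> - \<eta> * s)) * P1 u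
      + (?d\<^sup>2 * (u - t) * (t - s)) * e1"
    unfolding h2 dist c1 c2 c3 c4 c5 by (rule refl)
  moreover have "u * ?d\<^sup>2 * (P2 t Nt + a t * P1 t + B1 t * P0 t) -
      ((u * (u - t)\<^sup>2 + u * (u - t) * (t - s)) * (P2 s Ns + a s * P1 s + B1 s * P0 s)
      + ((u - s) * (u - t) * (t - s)) * (P2 s Ns + a u * P1 s + B1 u * P0 s)
      + (?d * t * (t - s)) * (P2 u Nu + a u * P1 u + B1 u * P0 u)
      + (?d * (u - t) * (t - s) * (\<eta> * u - \<theta>)) * P1 s
      + (?d * (u - t) * (t - s) * (\<theta> - \<eta> * s)) * P1 u
      + (?d\<^sup>2 * (u - t) * (t - s)) * e1)
      = ?d * (u * (?d * (Nt - Ns)) - t * (t - s) * (Nu - Ns))"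
    using coeffs
  proof (elim disjE)
    assume "\<forall>r. A0 r = 0 \<and> B0 r = 0 \<and> B1 r = r"
    then have eqs: "A0 = (\<lambda>r. 0)" "B0 = (\<lambda>r. 0)" "B1 = (\<lambda>r. r)" by (auto simp: fun_eq_iff)
    show ?thesis unfolding eqs P2_def P1_def P0_def a_def c_def by algebra
  next
    assume "\<forall>r. A0 r = a r \<and> B0 r = r \<and> B1 r = c * r"
    then have eqs: "A0 = (\<lambda>r. a r)" "B0 = (\<lambda>r. r)" "B1 = (\<lambda>r. c * r)" by (auto simp: fun_eq_iff)
    show ?thesis unfolding eqs P2_def P1_def P0_def a_def c_def by algebra
  next
    assume "\<forall>r. A0 r = a r \<and> B0 r = c * r \<and> B1 r = c * r"
    then have eqs: "A0 = (\<lambda>r. a r)" "B0 = (\<lambda>r. c * r)" "B1 = (\<lambda>r. c * r)" by (auto simp: fun_eq_iff)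
    show ?thesis unfolding eqs P2_def P1_def P0_def a_def c_def by algebra
  qed
  ultimately have "?d * (u * (?d * (Nt - Ns)) - t * (t - s) * (Nu - Ns)) = 0" by linarith
  then have "u * ((t - s) * (Nu - Ns)) = t * (t - s) * (Nu - Ns)"
    unfolding k1 using nz by simp
  then have "(u - t) * (t - s) * (Nu - Ns) = 0" by (simp add: algebra_simps)
  then show ?thesis using less by simp
qed

context quadratic_harness
begin

lemma finite_moments_X: "0 \<le> t \<Longrightarrow> finite_moments (X t)"
  by (simp add: finite_moments_def X_measurable integrable_X_power)

abbreviation P :: "nat \<Rightarrow> real \<Rightarrow> 'a \<Rightarrow> real" where
  "P k r \<omega> \<equiv> poly (martingale_poly \<eta> \<theta> k r) (X r \<omega>)"

lemma expectation_X_martingale_poly: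
  assumes "finite_moments f" "0 \<le> r"
  shows "(\<integral>\<omega>. f \<omega> * (X r \<omega> * P k r \<omega>) \<partial>M) = (\<integral>\<omega>. f \<omega> * P (Suc k) r \<omega> \<partial>M)
    + Q_diag \<eta> \<theta> 0 r 0 k * (\<integral>\<omega>. f \<omega> * P k r \<omega> \<partial>M)
    + Q_offdiag \<eta> \<theta> 0 r 0 k * (\<integral>\<omega>. f \<omega> * P (k - 1) r \<omega> \<partial>M)"
proof -
  have int: "integrable M (\<lambda>\<omega>. f \<omega> * P j r \<omega>)" for j
    by (intro finite_moments_integrable finite_moments_intros finite_moments_X assms)
  have "(\<integral>\<omega>. f \<omega> * (X r \<omega> * P k r \<omega>) \<partial>M) = (\<integral>\<omega>. f \<omega> * P (Suc k) r \<omega>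
      + Q_diag \<eta> \<theta> 0 r 0 k * (f \<omega> * P k r \<omega>) + Q_offdiag \<eta> \<theta> 0 r 0 k * (f \<omega> * P (k - 1) r \<omega>) \<partial>M)"
    unfolding martingale_poly_three_term[of "X r _" \<eta> \<theta> k r] by (simp add: algebra_simps)
  also have "\<dots> = (\<integral>\<omega>. f \<omega> * P (Suc k) r \<omega> \<partial>M)
    + Q_diag \<eta> \<theta> 0 r 0 k * (\<integral>\<omega>. f \<omega> * P k r \<omega> \<partial>M)
    + Q_offdiag \<eta> \<theta> 0 r 0 k * (\<integral>\<omega>. f \<omega> * P (k - 1) r \<omega> \<partial>M)"
    using int by simp
  finally show ?thesis .
qed

text \<open>
  Degrees \<open>1\<close> and \<open>2\<close> restate the one-sided conditional moments. In higher degree the time \<open>t\<close> halfway between \<open>s\<close>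
  and \<open>u\<close> is used as an auxiliary point, and \<open>h1\<close> and \<open>h2\<close> are the two equations obtained from conditioning in
  two orders.
\<close>

lemma expectation_martingale_poly:
  assumes "0 \<le> s" "s < t" "f \<in> borel_measurable (past s)" "finite_moments f"
  shows "(\<integral>\<omega>. f \<omega> * P n t \<omega> \<partial>M) = (\<integral>\<omega>. f \<omega> * P n s \<omega> \<partial>M)"
  using assms
proof (induction n arbitrary: s t f rule: less_induct)
  case (less n s u f)
  note fp = \<open>f \<in> borel_measurable (past s)\<close> and fm = \<open>finite_moments f\<close>
  have s: "0 \<le> s" and u: "s < u" "0 \<le> u" using less.prems by auto
  consider "n = 0" | "n = 1" | "n = 2" | l where "n = Suc (Suc (Suc l))"
    by (metis One_nat_def numeral_2_eq_2 not0_implies_Suc)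
  then show ?case
  proof cases
    case 1
    then show ?thesis by simp
  next
    case 2
    have "integrable M (\<lambda>\<omega>. f \<omega> * X u \<omega>)"
      by (intro finite_moments_integrable finite_moments_intros finite_moments_X fm u)
    then show ?thesis using forward_linear[OF s u(1) fp] 2 by simp
  next
    case 3
    have P2: "P 2 r \<omega> = (X r \<omega>)\<^sup>2 - (r * \<eta> + \<theta>) * X r \<omega> - r" for r \<omega>
      using martingale_poly_rec_1[of "X r \<omega>" \<eta> \<theta> r] by (simp add: power2_eq_square)
    have int: "integrable M (\<lambda>\<omega>. f \<omega> * X r \<omega>)" "integrable M (\<lambda>\<omega>. f \<omega> * (X r \<omega>)\<^sup>2)" "integrable M f" if "0 \<le> r" for r
      by (intro finite_moments_integrable finite_moments_intros finite_moments_X fm that)+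
    have E: "(\<integral>\<omega>. f \<omega> * P 2 r \<omega> \<partial>M) = (\<integral>\<omega>. f \<omega> * (X r \<omega>)\<^sup>2 \<partial>M)
        - (r * \<eta> + \<theta>) * (\<integral>\<omega>. f \<omega> * X r \<omega> \<partial>M) - r * (\<integral>\<omega>. f \<omega> \<partial>M)" if "0 \<le> r" for r
    proof -
      have "(\<integral>\<omega>. f \<omega> * P 2 r \<omega> \<partial>M) = (\<integral>\<omega>. f \<omega> * (X r \<omega>)\<^sup>2 - (r * \<eta> + \<theta>) * (f \<omega> * X r \<omega>) - r * f \<omega> \<partial>M)"
        unfolding P2 by (simp add: algebra_simps)
      also have "\<dots> = (\<integral>\<omega>. f \<omega> * (X r \<omega>)\<^sup>2 \<partial>M)
        - (r * \<eta> + \<theta>) * (\<integral>\<omega>. f \<omega> * X r \<omega> \<partial>M) - r * (\<integral>\<omega>. f \<omega> \<partial>M)"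
        using int[OF that] by simp
      finally show ?thesis .
    qed
    have "(\<integral>\<omega>. f \<omega> * (X u \<omega>)\<^sup>2 \<partial>M) = (\<integral>\<omega>. f \<omega> * ((X s \<omega>)\<^sup>2 + (u - s) * (1 + \<eta> * X s \<omega>)) \<partial>M)"
      by (rule forward_square[OF s u(1) fp int(2)[OF u(2)]])
    also have "\<dots> = (\<integral>\<omega>. f \<omega> * (X s \<omega>)\<^sup>2 + (u - s) * f \<omega> + (u - s) * \<eta> * (f \<omega> * X s \<omega>) \<partial>M)"
      by (simp add: algebra_simps)
    also have "\<dots> = (\<integral>\<omega>. f \<omega> * (X s \<omega>)\<^sup>2 \<partial>M) + (u - s) * (\<integral>\<omega>. f \<omega> \<partial>M)
        + (u - s) * \<eta> * (\<integral>\<omega>. f \<omega> * X s \<omega> \<partial>M)"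
      using int[OF s] by simp
    finally show ?thesis
      unfolding 3 E[OF s] E[OF u(2)] forward_linear[OF s u(1) fp int(1)[OF u(2)]]
      by (simp add: algebra_simps)
  next
    case 4
    define t where "t = (s + u) / 2"
    have t: "s < t" "t < u" "0 \<le> t" using s u by (auto simp: t_def)
    define A where "A k r = Q_diag \<eta> \<theta> 0 r 0 k" for k r
    define B where "B k r = Q_offdiag \<eta> \<theta> 0 r 0 k" for k r
    define J where "J r k = (\<integral>\<omega>. f \<omega> * P k r \<omega> \<partial>M)" for r k
    define JX where "JX r k = J r (Suc k) + A k r * J r k + B k r * J r (k - 1)" for r k
    define e where "e k = J s k" for k
    have IH: "(\<integral>\<omega>. g \<omega> * P k u' \<omega> \<partial>M) = (\<integral>\<omega>. g \<omega> * P k s' \<omega> \<partial>M)"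
      if "k \<le> Suc (Suc l)" "0 \<le> s'" "s' < u'" "g \<in> borel_measurable (past s')" "finite_moments g" for k s' u' g
      using less.IH[of k s' u' g] that 4 by simp
    have J: "J r k = e k" if "s \<le> r" "k \<le> Suc (Suc l)" for r k
      using IH[of k s r f] that s fp fm by (cases "r = s") (auto simp: J_def e_def)
    note fm_intros = finite_moments_intros finite_moments_X fm s u t
    have Xm: "X r \<in> borel_measurable (past r')" if "0 \<le> r" "r \<le> r'" for r r'
      using that by (rule past_measurable_X)
    have fp': "f \<in> borel_measurable (past t)"
      using fp by (rule borel_measurable_sigma_gen_mono) (use t in auto)
    have fX: "(\<integral>\<omega>. f \<omega> * X r \<omega> * P k r \<omega> \<partial>M) = JX r k" if "0 \<le> r" for r k
      using expectation_X_martingale_poly[OF fm that, of k] by (simp add: J_def JX_def A_def B_def mult.assoc)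
    have fXX: "(\<integral>\<omega>. f \<omega> * X r \<omega> * X r \<omega> * P k r \<omega> \<partial>M) =
        JX r (Suc k) + A k r * JX r k + B k r * JX r (k - 1)" if "0 \<le> r" for r k
    proof -
      have "finite_moments (\<lambda>\<omega>. f \<omega> * X r \<omega>)" by (intro fm_intros that)
      from expectation_X_martingale_poly[OF this that, of k] show ?thesis
        using fX[OF that] by (simp add: A_def B_def mult.assoc)
    qed
    \<comment> \<open>conditioning on the past of \<open>t\<close> first\<close>
    have T1: "(\<integral>\<omega>. f \<omega> * P k u \<omega> * X t \<omega> \<partial>M) = JX t k" if "k \<le> Suc (Suc l)" for k
    proof -
      have "(\<integral>\<omega>. (f \<omega> * X t \<omega>) * P k u \<omega> \<partial>M) = (\<integral>\<omega>. (f \<omega> * X t \<omega>) * P k t \<omega> \<partial>M)"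
        using that t by (intro IH borel_measurable_times fp' Xm fm_intros) auto
      then show ?thesis using fX[OF t(3)] by (simp add: mult_ac)
    qed
    \<comment> \<open>conditioning on the past of \<open>s\<close> turns \<open>p\<^sub>k\<close> at time \<open>u\<close> into \<open>p\<^sub>k\<close> at time \<open>s\<close>\<close>
    have S1: "(\<integral>\<omega>. f \<omega> * X s \<omega> * P k u \<omega> \<partial>M) = JX s k" if "k \<le> Suc (Suc l)" for k
      using IH[of k s u "\<lambda>\<omega>. f \<omega> * X s \<omega>"] that s u fX[OF s] fp Xm[of s s]
      by (simp add: finite_moments_intros finite_moments_X fm)
    have Pu: "(\<lambda>\<omega>. P k u \<omega>) \<in> borel_measurable (past_future s u)" for k
    proof -
      have [measurable]: "X u \<in> borel_measurable (past_future s u)" by (rule measurable_sigma_gen) auto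
      show ?thesis unfolding poly_altdef by measurable
    qed
    have G: "(\<lambda>\<omega>. f \<omega> * P k u \<omega>) \<in> borel_measurable (past_future s u)" for k
      by (intro borel_measurable_times past_imp_past_future fp Pu)
    have h1: "JX t (Suc (Suc l)) = (u - t) / (u - s) * JX s (Suc (Suc l)) + (t - s) / (u - s) * JX u (Suc (Suc l))"
    proof -
      have "(\<integral>\<omega>. f \<omega> * P (Suc (Suc l)) u \<omega> * X t \<omega> \<partial>M) =
          (u - t) / (u - s) * (\<integral>\<omega>. f \<omega> * P (Suc (Suc l)) u \<omega> * X s \<omega> \<partial>M)
          + (t - s) / (u - s) * (\<integral>\<omega>. f \<omega> * P (Suc (Suc l)) u \<omega> * X u \<omega> \<partial>M)"
        by (intro backward_linear s t G finite_moments_integrable fm_intros)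
      then show ?thesis using T1 S1 fX[OF u(2)] by (simp add: mult_ac)
    qed
    have h2: "JX t (Suc (Suc l)) + A (Suc l) t * JX t (Suc l) + B (Suc l) t * JX t l =
      (((u - t) / (u - s))\<^sup>2 + (u - t) * (t - s) / u * u / (u - s)\<^sup>2)
          * (JX s (Suc (Suc l)) + A (Suc l) s * JX s (Suc l) + B (Suc l) s * JX s l)
      + (2 * (u - t) * (t - s) / (u - s)\<^sup>2 - (u - t) * (t - s) / u * (s + u) / (u - s)\<^sup>2)
          * (JX s (Suc (Suc l)) + A (Suc l) u * JX s (Suc l) + B (Suc l) u * JX s l)
      + t * (t - s) / (u * (u - s)) * (JX u (Suc (Suc l)) + A (Suc l) u * JX u (Suc l) + B (Suc l) u * JX u l)
      + (u - t) * (t - s) / u * (\<eta> * u - \<theta>) / (u - s) * JX s (Suc l)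
      + (u - t) * (t - s) / u * (\<theta> - \<eta> * s) / (u - s) * JX u (Suc l)
      + (u - t) * (t - s) / u * e (Suc l)"
    proof -
      let ?g = "\<lambda>\<omega>. f \<omega> * P (Suc l) u \<omega>"
      have gt: "(\<integral>\<omega>. ?g \<omega> * (X r \<omega>)\<^sup>2 \<partial>M) = JX r (Suc (Suc l)) + A (Suc l) r * JX r (Suc l) + B (Suc l) r * JX r l"
        if r: "0 \<le> r" "r \<le> u" "f \<in> borel_measurable (past r)" for r
      proof -
        have "(\<integral>\<omega>. (f \<omega> * X r \<omega> * X r \<omega>) * P (Suc l) u \<omega> \<partial>M) = (\<integral>\<omega>. (f \<omega> * X r \<omega> * X r \<omega>) * P (Suc l) r \<omega> \<partial>M)"
        proof (cases "r = u")
          case False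
          then show ?thesis using r by (intro IH borel_measurable_times Xm fm_intros) auto
        qed simp
        then show ?thesis using fXX[OF r(1), of "Suc l"] by (simp add: power2_eq_square mult_ac)
      qed
      have gsu: "(\<integral>\<omega>. ?g \<omega> * (X s \<omega> * X u \<omega>) \<partial>M) =
          JX s (Suc (Suc l)) + A (Suc l) u * JX s (Suc l) + B (Suc l) u * JX s l"
      proof -
        have "finite_moments (\<lambda>\<omega>. f \<omega> * X s \<omega>)" by (intro fm_intros)
        from expectation_X_martingale_poly[OF this u(2), of "Suc l"] show ?thesis
          using S1[of "Suc (Suc l)"] S1[of "Suc l"] S1[of l] by (simp add: A_def B_def mult_ac)
      qed
      have fpu: "f \<in> borel_measurable (past u)"
        using fp by (rule borel_measurable_sigma_gen_mono) (use u in auto)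
      have "(\<integral>\<omega>. ?g \<omega> * X s \<omega> \<partial>M) = JX s (Suc l)" using S1[of "Suc l"] by (simp add: mult_ac)
      moreover have "(\<integral>\<omega>. ?g \<omega> * X u \<omega> \<partial>M) = JX u (Suc l)" using fX[OF u(2), of "Suc l"] by (simp add: mult_ac)
      moreover have "(\<integral>\<omega>. ?g \<omega> \<partial>M) = e (Suc l)" using J[of u "Suc l"] u by (simp add: J_def)
      moreover have "(\<integral>\<omega>. ?g \<omega> * (X t \<omega>)\<^sup>2 \<partial>M) =
          (((u - t) / (u - s))\<^sup>2 + (u - t) * (t - s) / u * u / (u - s)\<^sup>2) * (\<integral>\<omega>. ?g \<omega> * (X s \<omega>)\<^sup>2 \<partial>M)
        + (2 * (u - t) * (t - s) / (u - s)\<^sup>2 - (u - t) * (t - s) / u * (s + u) / (u - s)\<^sup>2)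
            * (\<integral>\<omega>. ?g \<omega> * (X s \<omega> * X u \<omega>) \<partial>M)
        + t * (t - s) / (u * (u - s)) * (\<integral>\<omega>. ?g \<omega> * (X u \<omega>)\<^sup>2 \<partial>M)
        + (u - t) * (t - s) / u * (\<eta> * u - \<theta>) / (u - s) * (\<integral>\<omega>. ?g \<omega> * X s \<omega> \<partial>M)
        + (u - t) * (t - s) / u * (\<theta> - \<eta> * s) / (u - s) * (\<integral>\<omega>. ?g \<omega> * X u \<omega> \<partial>M)
        + (u - t) * (t - s) / u * (\<integral>\<omega>. ?g \<omega> \<partial>M)"
        by (intro backward_square s t G finite_moments_integrable fm_intros)
      ultimately show ?thesis
        using gt[OF t(3) less_imp_le[OF t(2)] fp'] gt[OF s less_imp_le[OF u(1)] fp] gt[OF u(2) order_refl fpu] gsu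
        by (simp only:)
    qed
    have JX2: "JX r (Suc (Suc l)) = J r n + (r * \<eta> + \<theta>) * e (Suc (Suc l)) + (1 + \<eta> * \<theta>) * r * e (Suc l)"
      if "s \<le> r" for r
      using J[OF that] by (simp add: JX_def 4 A_def B_def Q_diag_def Q_offdiag_def)
    have JX1: "JX r (Suc l) = e (Suc (Suc l)) + (r * \<eta> + \<theta>) * e (Suc l) + B (Suc l) r * e l"
      if "s \<le> r" for r
      using J[OF that] by (simp add: JX_def A_def Q_diag_def)
    have JX0: "JX r l = e (Suc l) + A l r * e l + B l r * e (l - 1)" if "s \<le> r" for r
      using J[OF that] by (simp add: JX_def)
    have AS: "A (Suc l) r = r * \<eta> + \<theta>" for r by (simp add: A_def Q_diag_def)
    have coeffs: "(\<forall>r. A l r = 0 \<and> B l r = 0 \<and> B (Suc l) r = r)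
      \<or> (\<forall>r. A l r = r * \<eta> + \<theta> \<and> B l r = r \<and> B (Suc l) r = (1 + \<eta> * \<theta>) * r)
      \<or> (\<forall>r. A l r = r * \<eta> + \<theta> \<and> B l r = (1 + \<eta> * \<theta>) * r \<and> B (Suc l) r = (1 + \<eta> * \<theta>) * r)"
    proof -
      consider "l = 0" | "l = 1" | "1 < l" by linarith
      then show ?thesis by cases (simp_all add: A_def B_def Q_diag_def Q_offdiag_def)
    qed
    note le = order_refl[of s] less_imp_le[OF t(1)] less_imp_le[OF u(1)]
    note expand = le[THEN JX2] le[THEN JX1] le[THEN JX0] AS
    have "J u n = J s n"
      by (rule martingale_step_algebra[OF s t(1,2) coeffs h1[unfolded expand] h2[unfolded expand]])
    then show ?thesis by (simp add: J_def)
  qed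
qed

section \<open>Conditional moments\<close>

lemma finite_moments_Q_poly:
  assumes "0 \<le> s" "0 \<le> t"
  shows "finite_moments (\<lambda>\<omega>. poly (Q_poly \<eta> \<theta> n (X s \<omega>) t s) (X t \<omega>))"
proof (induction n rule: less_induct)
  case (less n)
  have diff: "finite_moments (\<lambda>\<omega>. f \<omega> - g \<omega>)" if "finite_moments f" "finite_moments g" for f g
  proof -
    have "finite_moments (\<lambda>\<omega>. f \<omega> + (- 1) * g \<omega>)" by (intro finite_moments_intros that)
    then show ?thesis by simp
  qed
  note intros = diff finite_moments_intros finite_moments_X assms
  consider "n = 0" | "n = 1" | "n = 2" | m where "n = Suc (Suc (Suc m))"
    by (metis One_nat_def numeral_2_eq_2 not0_implies_Suc)
  then show ?case
  proof cases
    case 4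
    have "finite_moments (\<lambda>\<omega>. X t \<omega> * poly (Q_poly \<eta> \<theta> (Suc (Suc m)) (X s \<omega>) t s) (X t \<omega>)
        - (t * \<eta> + \<theta>) * poly (Q_poly \<eta> \<theta> (Suc (Suc m)) (X s \<omega>) t s) (X t \<omega>)
        - (t * (1 + \<eta> * \<theta>)) * poly (Q_poly \<eta> \<theta> (Suc m) (X s \<omega>) t s) (X t \<omega>))"
      using less 4 by (intro intros) auto
    then show ?thesis by (simp add: 4)
  next
    case 1
    then show ?thesis by (simp add: finite_moments_const)
  next
    case 2
    have "finite_moments (\<lambda>\<omega>. X t \<omega> - X s \<omega>)" by (intro intros)
    then show ?thesis by (simp add: 2)
  next
    case 3
    have "finite_moments (\<lambda>\<omega>. X t \<omega> * (X t \<omega> - X s \<omega>) - ((t - s) * \<eta> + \<theta>) * (X t \<omega> - X s \<omega>)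
        - (t - s) * (1 + X s \<omega> * \<eta>))"
      by (intro intros)
    then show ?thesis by (simp add: 3 numeral_2_eq_2 algebra_simps)
  qed
qed

text \<open>
  The factors in front of the differences in \<open>Q_poly_martingale_poly\<close> depend on \<open>X\<^sub>s\<close> only and can be absorbed into the test
  variable; then the martingale property makes every difference vanish.
\<close>

lemma expectation_Q_poly_eq_0:
  assumes st: "0 \<le> s" "s < t" and f: "f \<in> borel_measurable (past s)" "finite_moments f"
  shows "(\<integral>\<omega>. f \<omega> * poly (Q_poly \<eta> \<theta> (Suc n) (X s \<omega>) t s) (X t \<omega>) \<partial>M) = 0"
proof (induction n)
  case 0
  have int: "integrable M (\<lambda>\<omega>. f \<omega> * X r \<omega>)" if "0 \<le> r" for r
    by (intro finite_moments_integrable finite_moments_intros finite_moments_X f that)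
  have "(\<integral>\<omega>. f \<omega> * poly (Q_poly \<eta> \<theta> (Suc 0) (X s \<omega>) t s) (X t \<omega>) \<partial>M) = (\<integral>\<omega>. f \<omega> * X t \<omega> - f \<omega> * X s \<omega> \<partial>M)"
    by (simp add: algebra_simps)
  also have "\<dots> = 0" using int st forward_linear[OF st f(1)] by simp
  finally show ?case .
next
  case (Suc n)
  let ?q = "\<lambda>k \<omega>. poly (Q_poly \<eta> \<theta> k (X s \<omega>) t s) (X t \<omega>)"
  have Xs: "X s \<in> borel_measurable (past s)" using st by (intro past_measurable_X) auto
  have s0: "0 \<le> t" using st by simp
  note fm = finite_moments_intros finite_moments_X finite_moments_Q_poly f st s0
  define g where "g \<omega> = f \<omega> * ((s * \<eta> + \<theta>) + (- 1) * X s \<omega>)" for \<omega>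
  define h where "h \<omega> = f \<omega> * (s * (1 + \<eta> * \<theta>))" for \<omega>
  have gm: "g \<in> borel_measurable (past s)" "finite_moments g"
    unfolding g_def using f Xs by (measurable, intro fm)
  have hm: "h \<in> borel_measurable (past s)" "finite_moments h"
    unfolding h_def using f by (measurable, intro fm)
  have int: "integrable M (\<lambda>\<omega>. f' \<omega> * P k r \<omega>)" if "finite_moments f'" "0 \<le> r" for f' k r
    by (intro finite_moments_integrable fm that)
  have intq: "integrable M (\<lambda>\<omega>. f \<omega> * ?q k \<omega>)" for k
    by (intro finite_moments_integrable fm)
  have mart: "(\<integral>\<omega>. f' \<omega> * P k t \<omega> - f' \<omega> * P k s \<omega> \<partial>M) = 0"
    if "f' \<in> borel_measurable (past s)" "finite_moments f'" for f' k
    using expectation_martingale_poly[OF st that, of k] int[OF that(2)] st by simp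
  have expand: "z * ((a - b) + (y - x) * (c - d) + k * (e - e')) =
      (z * a - z * b) + (z * (y + (- 1) * x) * c - z * (y + (- 1) * x) * d) + (z * k * e - z * k * e')"
    for z a b c d e e' k x y :: real by (simp add: algebra_simps)
  have "(\<integral>\<omega>. f \<omega> * ?q (Suc (Suc n)) \<omega> + \<theta> * (f \<omega> * ?q (Suc n) \<omega>) \<partial>M) =
      (\<integral>\<omega>. (f \<omega> * P (Suc (Suc n)) t \<omega> - f \<omega> * P (Suc (Suc n)) s \<omega>)
        + (g \<omega> * P (Suc n) t \<omega> - g \<omega> * P (Suc n) s \<omega>) + (h \<omega> * P n t \<omega> - h \<omega> * P n s \<omega>) \<partial>M)"
  proof (intro Bochner_Integration.integral_cong refl)
    fix \<omega>
    have "f \<omega> * ?q (Suc (Suc n)) \<omega> + \<theta> * (f \<omega> * ?q (Suc n) \<omega>) = f \<omega> * (?q (Suc (Suc n)) \<omega> + \<theta> * ?q (Suc n) \<omega>)"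
      by (simp only: distrib_left mult.left_commute)
    also have "\<dots> = (f \<omega> * P (Suc (Suc n)) t \<omega> - f \<omega> * P (Suc (Suc n)) s \<omega>)
        + (g \<omega> * P (Suc n) t \<omega> - g \<omega> * P (Suc n) s \<omega>) + (h \<omega> * P n t \<omega> - h \<omega> * P n s \<omega>)"
      unfolding Q_poly_martingale_poly g_def h_def by (rule expand)
    finally show "f \<omega> * ?q (Suc (Suc n)) \<omega> + \<theta> * (f \<omega> * ?q (Suc n) \<omega>) =
      (f \<omega> * P (Suc (Suc n)) t \<omega> - f \<omega> * P (Suc (Suc n)) s \<omega>)
        + (g \<omega> * P (Suc n) t \<omega> - g \<omega> * P (Suc n) s \<omega>) + (h \<omega> * P n t \<omega> - h \<omega> * P n s \<omega>)" .
  qed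
  also have "\<dots> = (\<integral>\<omega>. f \<omega> * P (Suc (Suc n)) t \<omega> - f \<omega> * P (Suc (Suc n)) s \<omega> \<partial>M)
        + (\<integral>\<omega>. g \<omega> * P (Suc n) t \<omega> - g \<omega> * P (Suc n) s \<omega> \<partial>M) + (\<integral>\<omega>. h \<omega> * P n t \<omega> - h \<omega> * P n s \<omega> \<partial>M)"
    using int[OF f(2) s0, of "Suc (Suc n)"] int[OF f(2) st(1), of "Suc (Suc n)"]
      int[OF gm(2) s0, of "Suc n"] int[OF gm(2) st(1), of "Suc n"] int[OF hm(2) s0, of n] int[OF hm(2) st(1), of n]
    by (simp only: Bochner_Integration.integral_add Bochner_Integration.integrable_add
        Bochner_Integration.integrable_diff)
  also have "\<dots> = 0" using mart f gm hm by simp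
  finally have "(\<integral>\<omega>. f \<omega> * ?q (Suc (Suc n)) \<omega> \<partial>M) + \<theta> * (\<integral>\<omega>. f \<omega> * ?q (Suc n) \<omega> \<partial>M) = 0"
    using intq by simp
  then show ?case using Suc.IH by simp
qed

text \<open>
  The law of \<open>X\<^sub>t\<close> has the moments of the kernel started at \<open>0\<close>, which grow geometrically.
\<close>

lemma AE_bounded_X:
  assumes "0 \<le> t"
  obtains C where "0 \<le> C" "AE \<omega> in M. \<bar>X t \<omega>\<bar> \<le> C"
proof (cases "t = 0")
  case True
  have "AE \<omega> in M. \<bar>X t \<omega>\<bar> \<le> 0"
    using AE_X_0 by eventually_elim (simp add: True)
  then show ?thesis by (rule that[OF order_refl])
next
  case False
  then have t: "0 < t" using assms by simp
  define \<mu> where "\<mu> = distr M borel (X t)"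
  have [measurable]: "X t \<in> borel_measurable M" using X_measurable assms by simp
  interpret Q: three_term_recurrence "\<lambda>n. Q_poly \<eta> \<theta> n 0 t 0" "Q_diag \<eta> \<theta> 0 t 0" "Q_offdiag \<eta> \<theta> 0 t 0"
    by (rule three_term_recurrence_Q_poly)
  have \<mu>: "prob_space \<mu>" unfolding \<mu>_def by (rule prob_space_distr) simp
  have int: "integrable \<mu> (\<lambda>y. y ^ n)" for n
    using finite_moments_integrable[OF finite_moments_power[OF finite_moments_X[OF assms]], of n]
    unfolding \<mu>_def by (subst integrable_distr_eq) simp_all
  have zero: "(\<integral>y. poly (Q_poly \<eta> \<theta> n 0 t 0) y \<partial>\<mu>) = 0" if "0 < n" for n
  proof -
    from gr0_implies_Suc[OF that] obtain m where n: "n = Suc m" ..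
    have "(\<integral>y. poly (Q_poly \<eta> \<theta> n 0 t 0) y \<partial>\<mu>) = (\<integral>\<omega>. 1 * P n t \<omega> \<partial>M)"
      unfolding \<mu>_def martingale_poly_def by (subst integral_distr) (simp_all add: borel_measurable_continuous_onI continuous_on_poly)
    also have "\<dots> = (\<integral>\<omega>. 1 * P n 0 \<omega> \<partial>M)"
      by (rule expectation_martingale_poly[OF order_refl t]) (simp_all add: finite_moments_const)
    also have "\<dots> = 0"
    proof (rule integral_eq_zero_AE)
      show "AE \<omega> in M. 1 * P n 0 \<omega> = 0"
        using AE_X_0 by eventually_elim (simp add: n martingale_poly_at_origin)
    qed
    finally show ?thesis .
  qed
  obtain C where C: "0 \<le> C" "\<And>n. \<bar>kernel_moment \<eta> \<theta> 0 t n 0\<bar> \<le> C ^ n"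
    using kernel_moment_bound by blast
  have "AE y in \<mu>. \<bar>y\<bar> \<le> C"
  proof (rule AE_bounded_of_kernel_moments[OF \<mu> int _ C])
    show "(\<integral>y. y ^ n \<partial>\<mu>) = kernel_moment \<eta> \<theta> 0 t n 0" for n
      unfolding kernel_moment_def by (rule Q.integral_power_eq[OF \<mu> int zero])
  qed
  then have "AE \<omega> in M. \<bar>X t \<omega>\<bar> \<le> C"
    unfolding \<mu>_def by (subst (asm) AE_distr_iff) simp_all
  then show ?thesis by (rule that[OF C(1)])
qed

lemma finite_moments_continuous:
  assumes "0 \<le> s" and g: "continuous_on UNIV (g :: real \<Rightarrow> real)"
  shows "finite_moments (\<lambda>\<omega>. g (X s \<omega>))"
proof -
  have [measurable]: "g \<in> borel_measurable borel" by (rule borel_measurable_continuous_onI[OF g])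
  have [measurable]: "X s \<in> borel_measurable M" using X_measurable assms by simp
  obtain C where C: "0 \<le> C" "AE \<omega> in M. \<bar>X s \<omega>\<bar> \<le> C" using AE_bounded_X[OF assms(1)] by blast
  have "compact (g ` {-C..C})"
    using g by (intro compact_continuous_image continuous_on_subset[OF g]) auto
  then obtain B where B: "\<And>y. y \<in> {-C..C} \<Longrightarrow> norm (g y) \<le> B"
    by (meson bounded_iff compact_imp_bounded imageI)
  show ?thesis
  proof (rule finite_moments_bounded)
    show "AE \<omega> in M. \<bar>g (X s \<omega>)\<bar> \<le> B"
      using C(2)
    proof eventually_elim
      case (elim \<omega>)
      then show ?case using B[of "X s \<omega>"] by (simp add: abs_le_iff)
    qed
  qed measurable
qed

text \<open>
  Expand $X_t^n$ in the polynomials \<open>Q\<^sub>k(\<cdot>;X\<^sub>s,t,s)\<close>; only the term with \<open>k = 0\<close> survives. The coefficients are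
  continuous functions of \<open>X\<^sub>s\<close>, which is bounded, so they can be absorbed into the test variable.
\<close>

lemma conditional_moment:
  assumes st: "0 \<le> s" "s < t" and f: "f \<in> borel_measurable (past s)" "finite_moments f"
  shows "(\<integral>\<omega>. f \<omega> * X t \<omega> ^ n \<partial>M) = (\<integral>\<omega>. f \<omega> * kernel_moment \<eta> \<theta> s t n (X s \<omega>) \<partial>M)"
proof -
  define c where "c k x = recurrence_coeff (Q_diag \<eta> \<theta> x t s) (Q_offdiag \<eta> \<theta> x t s) n k" for k x
  let ?q = "\<lambda>k \<omega>. poly (Q_poly \<eta> \<theta> k (X s \<omega>) t s) (X t \<omega>)"
  have c: "continuous_on UNIV (c k)" for k unfolding c_def by (rule continuous_on_Q_coeff)
  have [measurable]: "c k \<in> borel_measurable borel" for k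
    by (rule borel_measurable_continuous_onI[OF c])
  have [measurable]: "X s \<in> borel_measurable (past s)" using st by (intro past_measurable_X) auto
  have cf: "(\<lambda>\<omega>. f \<omega> * c k (X s \<omega>)) \<in> borel_measurable (past s)" "finite_moments (\<lambda>\<omega>. f \<omega> * c k (X s \<omega>))" for k
    using f st by (measurable, intro finite_moments_mult finite_moments_continuous c)
  have int: "integrable M (\<lambda>\<omega>. f \<omega> * c k (X s \<omega>) * ?q k \<omega>)" for k
    using st by (intro finite_moments_integrable finite_moments_mult[OF cf(2)] finite_moments_Q_poly) auto
  have "(\<integral>\<omega>. f \<omega> * X t \<omega> ^ n \<partial>M) = (\<integral>\<omega>. (\<Sum>k\<le>n. f \<omega> * c k (X s \<omega>) * ?q k \<omega>) \<partial>M)"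
  proof (intro Bochner_Integration.integral_cong refl)
    fix \<omega>
    have "X t \<omega> ^ n = (\<Sum>k\<le>n. c k (X s \<omega>) * ?q k \<omega>)"
      unfolding c_def by (rule power_eq_sum_Q_poly)
    then show "f \<omega> * X t \<omega> ^ n = (\<Sum>k\<le>n. f \<omega> * c k (X s \<omega>) * ?q k \<omega>)"
      by (simp add: sum_distrib_left mult.assoc)
  qed
  also have "\<dots> = (\<Sum>k\<le>n. \<integral>\<omega>. f \<omega> * c k (X s \<omega>) * ?q k \<omega> \<partial>M)"
    by (rule Bochner_Integration.integral_sum) (rule int)
  also have "\<dots> = (\<Sum>k\<in>{0}. \<integral>\<omega>. f \<omega> * c k (X s \<omega>) * ?q k \<omega> \<partial>M)"
  proof (rule sum.mono_neutral_right)
    show "\<forall>k\<in>{..n} - {0}. (\<integral>\<omega>. f \<omega> * c k (X s \<omega>) * ?q k \<omega> \<partial>M) = 0"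
    proof
      fix k assume "k \<in> {..n} - {0}"
      then obtain j where "k = Suc j" by (metis DiffD2 insertI1 not0_implies_Suc)
      then show "(\<integral>\<omega>. f \<omega> * c k (X s \<omega>) * ?q k \<omega> \<partial>M) = 0"
        using expectation_Q_poly_eq_0[OF st cf] by simp
    qed
  qed auto
  also have "\<dots> = (\<integral>\<omega>. f \<omega> * kernel_moment \<eta> \<theta> s t n (X s \<omega>) \<partial>M)"
    by (simp add: c_def kernel_moment_def)
  finally show ?thesis .
qed

section \<open>The transition kernel on the support\<close>

text \<open>
  The topological support of the law of \<open>X\<^sub>s\<close>.
\<close>

definition support :: "real \<Rightarrow> real set" where
  "support s = {x. \<forall>e>0. 0 < prob {\<omega> \<in> space M. \<bar>X s \<omega> - x\<bar> < e}}"

lemma closed_support: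
  assumes "0 \<le> s"
  shows "closed (support s)"
proof -
  have [measurable]: "X s \<in> borel_measurable M" using X_measurable assms by simp
  have "open (- support s)"
    unfolding open_dist
  proof (intro ballI)
    fix x assume "x \<in> - support s"
    then obtain e where e: "0 < e" "\<not> 0 < prob {\<omega> \<in> space M. \<bar>X s \<omega> - x\<bar> < e}"
      by (auto simp: support_def)
    have "y \<in> - support s" if "dist y x < e / 2" for y
    proof -
      have "prob {\<omega> \<in> space M. \<bar>X s \<omega> - y\<bar> < e / 2} \<le> prob {\<omega> \<in> space M. \<bar>X s \<omega> - x\<bar> < e}"
      proof (rule finite_measure_mono)
        show "{\<omega> \<in> space M. \<bar>X s \<omega> - y\<bar> < e / 2} \<subseteq> {\<omega> \<in> space M. \<bar>X s \<omega> - x\<bar> < e}"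
        proof clarify
          fix \<omega> assume "\<bar>X s \<omega> - y\<bar> < e / 2"
          then show "\<bar>X s \<omega> - x\<bar> < e" using that unfolding dist_real_def by linarith
        qed
      qed measurable
      then have "\<not> 0 < prob {\<omega> \<in> space M. \<bar>X s \<omega> - y\<bar> < e / 2}" using e by simp
      then show ?thesis using e(1) by (auto simp: support_def intro!: exI[of _ "e / 2"])
    qed
    then show "\<exists>e>0. \<forall>y. dist y x < e \<longrightarrow> y \<in> - support s"
      using e(1) by (intro exI[of _ "e / 2"]) auto
  qed
  then show ?thesis by (simp add: closed_def)
qed

text \<open>
  A point outside the support lies in one of countably many rational intervals of probability \<open>0\<close>.
\<close>

lemma AE_support:
  assumes "0 \<le> s"
  shows "AE \<omega> in M. X s \<omega> \<in> support s"
proof -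
  have [measurable]: "X s \<in> borel_measurable M" using X_measurable assms by simp
  define N where "N = {(a, b). a \<in> \<rat> \<and> b \<in> \<rat> \<and> prob {\<omega> \<in> space M. a < X s \<omega> \<and> X s \<omega> < b} = 0}"
  have "N \<subseteq> \<rat> \<times> \<rat>" by (auto simp: N_def)
  moreover have "countable (\<rat> \<times> \<rat> :: (real \<times> real) set)" by (intro countable_SIGMA countable_rat)
  ultimately have "countable N" by (rule countable_subset)
  moreover have "AE \<omega> in M. \<not> (fst ab < X s \<omega> \<and> X s \<omega> < snd ab)" if "ab \<in> N" for ab
    using that by (subst AE_iff_measurable[OF _ refl]) (auto simp: N_def emeasure_eq_measure)
  ultimately have "AE \<omega> in M. \<forall>ab\<in>N. \<not> (fst ab < X s \<omega> \<and> X s \<omega> < snd ab)"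
    by (simp add: AE_ball_countable)
  then show ?thesis
  proof eventually_elim
    case (elim \<omega>)
    show ?case
    proof (rule ccontr)
      assume "X s \<omega> \<notin> support s"
      then obtain e where e: "0 < e" "\<not> 0 < prob {\<omega>' \<in> space M. \<bar>X s \<omega>' - X s \<omega>\<bar> < e}"
        by (auto simp: support_def)
      obtain a where a: "a \<in> \<rat>" "X s \<omega> - e < a" "a < X s \<omega>"
        using Rats_dense_in_real[of "X s \<omega> - e" "X s \<omega>"] e by auto
      obtain b where b: "b \<in> \<rat>" "X s \<omega> < b" "b < X s \<omega> + e"
        using Rats_dense_in_real[of "X s \<omega>" "X s \<omega> + e"] e by auto
      have "prob {\<omega>' \<in> space M. a < X s \<omega>' \<and> X s \<omega>' < b} \<le> prob {\<omega>' \<in> space M. \<bar>X s \<omega>' - X s \<omega>\<bar> < e}"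
        using a b by (intro finite_measure_mono) (auto simp: abs_less_iff)
      then have "prob {\<omega>' \<in> space M. a < X s \<omega>' \<and> X s \<omega>' < b} = 0"
        using e(2) by (simp add: not_less measure_le_0_iff)
      then have "(a, b) \<in> N" using a b by (simp add: N_def)
      then show False using elim a b by force
    qed
  qed
qed

lemma integral_uniform_measure:
  assumes "A \<in> sets M" "0 < prob A" "h \<in> borel_measurable M"
  shows "(\<integral>\<omega>. h \<omega> \<partial>uniform_measure M A) = (\<integral>\<omega>. indicator A \<omega> * h \<omega> \<partial>M) / prob A"
proof -
  have "uniform_measure M A = density M (\<lambda>\<omega>. ennreal (indicator A \<omega> / prob A))"
    unfolding uniform_measure_def using assms(2)
    by (intro arg_cong[where f = "density M"])
      (auto simp: fun_eq_iff emeasure_eq_measure indicator_def divide_ennreal simp flip: ennreal_1)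
  then have "(\<integral>\<omega>. h \<omega> \<partial>uniform_measure M A) = (\<integral>\<omega>. indicator A \<omega> / prob A * h \<omega> \<partial>M)"
    using assms by (simp add: integral_density)
  then show ?thesis by simp
qed

text \<open>
  Condition on the events \<open>\<bar>X\<^sub>s - x\<bar> < 1/(k+1)\<close>, which have positive probability. The laws of \<open>X\<^sub>t\<close> under these conditions
  live on one bounded interval, so a subsequence converges weakly, and by continuity of the
  conditional moments in \<open>X\<^sub>s\<close> the moments of the limit are those required at \<open>x\<close>.
\<close>

lemma trans_kernel_on_support:
  assumes st: "0 \<le> s" "s < t" and x: "x \<in> support s"
    and C: "0 \<le> C" "AE \<omega> in M. \<bar>X t \<omega>\<bar> \<le> C"
  shows "prob_space (trans_kernel \<eta> \<theta> s t x)" "sets (trans_kernel \<eta> \<theta> s t x) = sets borel"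
    and "AE y in trans_kernel \<eta> \<theta> s t x. \<bar>y\<bar> \<le> C"
    and "(\<integral>y. y ^ n \<partial>trans_kernel \<eta> \<theta> s t x) = kernel_moment \<eta> \<theta> s t n x"
proof -
  have [measurable]: "X s \<in> borel_measurable M" "X t \<in> borel_measurable M" "X s \<in> borel_measurable (past s)"
    using X_measurable past_measurable_X st by auto
  define A where "A k = {\<omega> \<in> space M. \<bar>X s \<omega> - x\<bar> < 1 / real (Suc k)}" for k
  have A_past: "A k \<in> sets (past s)" for k
  proof -
    have "{\<omega> \<in> space (past s). \<bar>X s \<omega> - x\<bar> < 1 / real (Suc k)} \<in> sets (past s)" by measurable
    then show ?thesis by (simp add: A_def)
  qed
  have A [measurable]: "A k \<in> sets M" for k unfolding A_def by measurable
  have pA: "0 < prob (A k)" for k using x unfolding support_def A_def by auto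
  define U where "U k = uniform_measure M (A k)" for k
  define \<mu> where "\<mu> k = distr (U k) borel (X t)" for k
  have sets_U [measurable_cong]: "sets (U k) = sets M" for k by (simp add: U_def)
  have U: "prob_space (U k)" for k
    unfolding U_def using pA[of k] by (intro prob_space_uniform_measure) (auto simp: emeasure_eq_measure)
  have \<mu>: "prob_space (\<mu> k)" for k
    unfolding \<mu>_def by (rule prob_space.prob_space_distr[OF U]) measurable
  have \<mu>C: "AE y in \<mu> k. \<bar>y\<bar> \<le> C" for k
    unfolding \<mu>_def
  proof (subst AE_distr_iff)
    show "AE \<omega> in U k. \<bar>X t \<omega>\<bar> \<le> C"
      unfolding U_def by (rule AE_uniform_measureI[OF A]) (use C(2) in \<open>auto elim!: eventually_mono\<close>)
  qed measurable
  have rd: "real_distribution (\<mu> k)" for k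
    using \<mu>[of k] by (auto simp: real_distribution_def real_distribution_axioms_def \<mu>_def)
  have "tight \<mu>"
    unfolding tight_def
  proof (intro conjI allI impI rd)
    fix \<epsilon> :: real assume \<epsilon>: "0 < \<epsilon>"
    have "measure (\<mu> n) {- C - 1<..C} = 1" for n
    proof -
      interpret \<mu>n: real_distribution "\<mu> n" by (rule rd)
      show ?thesis
        using \<mu>C[of n] by (subst \<mu>n.prob_eq_1) (auto elim!: eventually_mono)
    qed
    then show "\<exists>a b. a < b \<and> (\<forall>n. 1 - \<epsilon> < measure (\<mu> n) {a<..b})"
      using \<epsilon> C(1) by (intro exI[of _ "- C - 1"] exI[of _ C]) auto
  qed
  then obtain r \<nu> where r: "strict_mono (r :: nat \<Rightarrow> nat)" and \<nu>: "real_distribution \<nu>"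
    and conv: "weak_conv_m (\<mu> \<circ> id \<circ> r) \<nu>"
    using tight_imp_convergent_subsubsequence[OF _ strict_mono_id] by blast
  interpret \<nu>: real_distribution \<nu> by (rule \<nu>)
  have lim: "(\<lambda>k. \<integral>y. h y \<partial>\<mu> (r k)) \<longlonglongrightarrow> (\<integral>y. h y \<partial>\<nu>)"
    if "continuous_on UNIV h" "\<And>y. \<bar>h y\<bar> \<le> B" for h :: "real \<Rightarrow> real" and B
    using weak_conv_imp_integral_bdd_continuous_conv[of "\<mu> \<circ> id \<circ> r" \<nu> h B] rd \<nu> conv that
    by (simp add: continuous_on_eq_continuous_at)
  have \<nu>C: "AE y in \<nu>. \<bar>y\<bar> \<le> C"
  proof -
    define h where "h y = min 1 (max 0 (\<bar>y\<bar> - C))" for y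
    have h: "continuous_on UNIV h" "\<bar>h y\<bar> \<le> 1" "0 \<le> h y" for y
      unfolding h_def by (intro continuous_intros) auto
    have "(\<integral>y. h y \<partial>\<mu> (r k)) = 0" for k
      using \<mu>C[of "r k"] by (intro integral_eq_zero_AE) (auto elim!: eventually_mono simp: h_def)
    then have "(\<integral>y. h y \<partial>\<nu>) = 0"
      using lim[OF h(1,2)] by (simp add: LIMSEQ_const_iff)
    moreover have "integrable \<nu> h"
      using h borel_measurable_continuous_onI[OF h(1)] by (intro \<nu>.integrable_const_bound[where B = 1]) auto
    ultimately have "AE y in \<nu>. h y = 0"
      using h(3) by (subst (asm) integral_nonneg_eq_0_iff_AE) auto
    then show ?thesis by eventually_elim (auto simp: h_def min_def max_def split: if_splits)
  qed
  have \<nu>int: "integrable \<nu> (\<lambda>y. y ^ n)" for n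
  proof (rule \<nu>.integrable_const_bound[where B = "C ^ n"])
    show "AE y in \<nu>. norm (y ^ n) \<le> C ^ n"
      using \<nu>C by eventually_elim (auto simp: power_abs intro: power_mono)
  qed simp
  have moments: "(\<integral>y. y ^ n \<partial>\<nu>) = kernel_moment \<eta> \<theta> s t n x" for n
  proof -
    let ?m = "kernel_moment \<eta> \<theta> s t n"
    have m: "continuous_on UNIV ?m" by (rule continuous_on_kernel_moment)
    have [measurable]: "?m \<in> borel_measurable borel" by (rule borel_measurable_continuous_onI[OF m])
    \<comment> \<open>weak convergence only tests bounded functions, so the powers are cut off outside \<open>[-C, C]\<close>\<close>
    define c where "c y = (max (- C) (min C y)) ^ n" for y
    have c: "continuous_on UNIV c" unfolding c_def by (intro continuous_intros)
    have [measurable]: "c \<in> borel_measurable borel" by (rule borel_measurable_continuous_onI[OF c])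
    have cB: "\<bar>c y\<bar> \<le> C ^ n" for y
      unfolding c_def power_abs using C(1) by (intro power_mono) auto
    have c_eq: "c y = y ^ n" if "\<bar>y\<bar> \<le> C" for y
    proof -
      have "max (- C) (min C y) = y" using that by (auto simp: abs_le_iff max_def min_def)
      then show ?thesis by (simp add: c_def)
    qed
    have approx: "(\<integral>y. c y \<partial>\<mu> k) = (\<integral>\<omega>. indicator (A k) \<omega> * ?m (X s \<omega>) \<partial>M) / prob (A k)" for k
    proof -
      have "(\<integral>y. c y \<partial>\<mu> k) = (\<integral>\<omega>. c (X t \<omega>) \<partial>U k)"
        unfolding \<mu>_def by (subst integral_distr) auto
      also have "\<dots> = (\<integral>\<omega>. indicator (A k) \<omega> * c (X t \<omega>) \<partial>M) / prob (A k)"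
        unfolding U_def by (rule integral_uniform_measure[OF A pA]) measurable
      also have "(\<integral>\<omega>. indicator (A k) \<omega> * c (X t \<omega>) \<partial>M) = (\<integral>\<omega>. indicator (A k) \<omega> * X t \<omega> ^ n \<partial>M)"
        using C(2) by (intro integral_cong_AE) (auto elim!: eventually_mono simp: c_eq)
      also have "\<dots> = (\<integral>\<omega>. indicator (A k) \<omega> * ?m (X s \<omega>) \<partial>M)"
        using A_past by (intro conditional_moment st finite_moments_bounded[where B = 1]) (auto simp: indicator_def)
      finally show ?thesis .
    qed
    have "(\<lambda>k. \<integral>y. c y \<partial>\<mu> k) \<longlonglongrightarrow> ?m x"
    proof (rule LIMSEQ_I)
      fix e :: real assume e: "0 < e"
      obtain d where d: "0 < d" "\<And>y. \<bar>y - x\<bar> < d \<Longrightarrow> \<bar>?m y - ?m x\<bar> < e / 2"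
        using m e unfolding continuous_on_iff dist_real_def by (metis UNIV_I half_gt_zero)
      obtain N where N: "1 / real (Suc N) < d" using nat_approx_posE[OF d(1)] by blast
      show "\<exists>no. \<forall>k\<ge>no. norm ((\<integral>y. c y \<partial>\<mu> k) - ?m x) < e"
      proof (intro exI[of _ N] allI impI)
        fix k assume k: "N \<le> k"
        have scale: "\<bar>a - b * p\<bar> / p = \<bar>a / p - b\<bar>" if "0 < p" for a b p :: real
        proof -
          have "a / p - b = (a - b * p) / p" using that by (simp add: diff_divide_distrib)
          then show ?thesis using that by simp
        qed
        have close: "\<bar>?m (X s \<omega>) - ?m x\<bar> \<le> e / 2" if "\<omega> \<in> A k" for \<omega>
        proof -
          have "1 / real (Suc k) \<le> 1 / real (Suc N)" using k by (simp add: field_simps)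
          then have "\<bar>X s \<omega> - x\<bar> < d" using that N by (simp add: A_def)
          then show ?thesis using d(2) by (simp add: less_imp_le)
        qed
        have im: "integrable M (\<lambda>\<omega>. indicator (A k) \<omega> * ?m (X s \<omega>))"
          using finite_moments_integrable[OF finite_moments_continuous[OF st(1) m]] A
          by (intro integrable_real_mult_indicator[of "A k" M, unfolded mult.commute[of _ "indicator _ _"]])
        have i1: "integrable M (\<lambda>\<omega>. indicator (A k) \<omega> * z)" for z :: real
          using A by (auto intro!: integrable_mult_left simp: emeasure_eq_measure)
        have "\<bar>(\<integral>\<omega>. indicator (A k) \<omega> * ?m (X s \<omega>) \<partial>M) - ?m x * prob (A k)\<bar>
            = \<bar>\<integral>\<omega>. indicator (A k) \<omega> * ?m (X s \<omega>) - indicator (A k) \<omega> * ?m x \<partial>M\<bar>"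
          using im i1[of "?m x"] by (simp add: mult.commute)
        also have "\<dots> \<le> (\<integral>\<omega>. \<bar>indicator (A k) \<omega> * ?m (X s \<omega>) - indicator (A k) \<omega> * ?m x\<bar> \<partial>M)"
          by (rule integral_abs_bound)
        also have "\<dots> \<le> (\<integral>\<omega>. indicator (A k) \<omega> * (e / 2) \<partial>M)"
        proof (rule integral_mono[OF _ i1])
          show "integrable M (\<lambda>\<omega>. \<bar>indicator (A k) \<omega> * ?m (X s \<omega>) - indicator (A k) \<omega> * ?m x\<bar>)"
            by (intro integrable_abs Bochner_Integration.integrable_diff im i1)
        qed (use close in \<open>auto simp: indicator_def\<close>)
        also have "\<dots> = e / 2 * prob (A k)" by simp
        finally have "\<bar>(\<integral>\<omega>. indicator (A k) \<omega> * ?m (X s \<omega>) \<partial>M) - ?m x * prob (A k)\<bar> / prob (A k) \<le> e / 2"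
          using pA[of k] by (simp add: field_simps)
        also have "\<bar>(\<integral>\<omega>. indicator (A k) \<omega> * ?m (X s \<omega>) \<partial>M) - ?m x * prob (A k)\<bar> / prob (A k)
            = \<bar>(\<integral>\<omega>. indicator (A k) \<omega> * ?m (X s \<omega>) \<partial>M) / prob (A k) - ?m x\<bar>"
          by (rule scale[OF pA])
        finally show "norm ((\<integral>y. c y \<partial>\<mu> k) - ?m x) < e" using e by (simp add: approx)
      qed
    qed
    then have "(\<lambda>k. \<integral>y. c y \<partial>\<mu> (r k)) \<longlonglongrightarrow> ?m x"
      using LIMSEQ_subseq_LIMSEQ[OF _ r] by (auto simp: comp_def)
    then have "(\<integral>y. c y \<partial>\<nu>) = ?m x"
      using lim[OF c cB] LIMSEQ_unique by blast
    moreover have "(\<integral>y. c y \<partial>\<nu>) = (\<integral>y. y ^ n \<partial>\<nu>)"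
      using \<nu>C by (intro integral_cong_AE) (auto elim!: eventually_mono simp: c_eq)
    ultimately show ?thesis by simp
  qed
  have eq: "trans_kernel \<eta> \<theta> s t x = \<nu>"
    by (rule trans_kernel_eqI[OF \<nu>.prob_space_axioms _ \<nu>int moments]) simp
  show "prob_space (trans_kernel \<eta> \<theta> s t x)" "sets (trans_kernel \<eta> \<theta> s t x) = sets borel"
    and "AE y in trans_kernel \<eta> \<theta> s t x. \<bar>y\<bar> \<le> C"
    and "(\<integral>y. y ^ n \<partial>trans_kernel \<eta> \<theta> s t x) = kernel_moment \<eta> \<theta> s t n x"
    unfolding eq using \<nu>C moments \<nu>.prob_space_axioms by auto
qed

section \<open>A measurable version of the kernel\<close>

text \<open>
  Off the support the definite description is not under control, so a fixed point mass takes its place.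
  The set of these \<open>x\<close> is null for the law of \<open>X\<^sub>s\<close>.
\<close>

definition regular_kernel :: "real \<Rightarrow> real \<Rightarrow> real \<Rightarrow> real measure" where
  "regular_kernel s t x = (if x \<in> support s then trans_kernel \<eta> \<theta> s t x else return borel 0)"

lemma prob_space_regular_kernel: "0 \<le> s \<Longrightarrow> s < t \<Longrightarrow> prob_space (regular_kernel s t x)"
  and sets_regular_kernel: "0 \<le> s \<Longrightarrow> s < t \<Longrightarrow> sets (regular_kernel s t x) = sets borel"
proof -
  assume st: "0 \<le> s" "s < t"
  then have "0 \<le> t" by simp
  then obtain C where C: "0 \<le> C" "AE \<omega> in M. \<bar>X t \<omega>\<bar> \<le> C" by (rule AE_bounded_X)
  show "prob_space (regular_kernel s t x)" "sets (regular_kernel s t x) = sets borel"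
    using trans_kernel_on_support(1,2)[OF st _ C] by (auto simp: regular_kernel_def prob_space_return)
qed

lemma AE_regular_kernel_bounded:
  assumes "0 \<le> s" "s < t" "0 \<le> C" "AE \<omega> in M. \<bar>X t \<omega>\<bar> \<le> C"
  shows "AE y in regular_kernel s t x. \<bar>y\<bar> \<le> C"
proof (cases "x \<in> support s")
  case True
  then have "regular_kernel s t x = trans_kernel \<eta> \<theta> s t x" by (simp add: regular_kernel_def)
  then show ?thesis using trans_kernel_on_support(3)[OF assms(1,2) True assms(3,4)] by (simp only:)
next
  case False
  then have "regular_kernel s t x = return borel 0" by (simp add: regular_kernel_def)
  moreover have "AE y in return borel 0. \<bar>y :: real\<bar> \<le> C"
    using assms(3) by (subst AE_return) (simp_all, measurable)
  ultimately show ?thesis by (simp only:)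
qed

lemma regular_kernel_power_integral:
  assumes "0 \<le> s" "s < t"
  shows "(\<integral>y. y ^ n \<partial>regular_kernel s t x) = (if x \<in> support s then kernel_moment \<eta> \<theta> s t n x else 0 ^ n)"
proof -
  have "0 \<le> t" using assms by simp
  then obtain C where C: "0 \<le> C" "AE \<omega> in M. \<bar>X t \<omega>\<bar> \<le> C" by (rule AE_bounded_X)
  show ?thesis
    using trans_kernel_on_support(4)[OF assms _ C] by (auto simp: regular_kernel_def integral_return)
qed

text \<open>
  Integrals of powers are measurable because the moments are continuous in \<open>x\<close>; all the kernel measures live on one bounded
  interval, so uniform approximation by polynomials extends this to continuous functions.
\<close>

lemma measurable_regular_kernel_integral:
  assumes st: "0 \<le> s" "s < t" and f: "continuous_on UNIV (f :: real \<Rightarrow> real)"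
  shows "(\<lambda>x. \<integral>y. f y \<partial>regular_kernel s t x) \<in> borel_measurable borel"
proof -
  have "0 \<le> t" using st by simp
  then obtain C where C: "0 \<le> C" "AE \<omega> in M. \<bar>X t \<omega>\<bar> \<le> C" by (rule AE_bounded_X)
  have regular_kernel: "prob_space (regular_kernel s t x)" "sets (regular_kernel s t x) = sets borel" "AE y in regular_kernel s t x. \<bar>y\<bar> \<le> C" for x
    using prob_space_regular_kernel sets_regular_kernel AE_regular_kernel_bounded st C by auto
  have "\<exists>p. \<forall>y. \<bar>y\<bar> \<le> C \<longrightarrow> \<bar>f y - poly p y\<bar> \<le> 1 / real (Suc j)" for j
    using Weierstrass_poly[OF f, of "1 / real (Suc j)" C] by (metis of_nat_0_less_iff zero_less_Suc zero_less_divide_1_iff)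
  then obtain p where p: "\<And>j y. \<bar>y\<bar> \<le> C \<Longrightarrow> \<bar>f y - poly (p j) y\<bar> \<le> 1 / real (Suc j)" by metis
  show ?thesis
  proof (rule borel_measurable_LIMSEQ_real)
    fix x :: real
    show "(\<lambda>j. \<integral>y. poly (p j) y \<partial>regular_kernel s t x) \<longlonglongrightarrow> (\<integral>y. f y \<partial>regular_kernel s t x)"
    proof (rule LIM_zero_cancel, rule Lim_null_comparison)
      show "\<forall>\<^sub>F j in sequentially. norm ((\<integral>y. poly (p j) y \<partial>regular_kernel s t x) - (\<integral>y. f y \<partial>regular_kernel s t x)) \<le> 1 / real (Suc j)"
      proof (rule always_eventually, rule allI)
        fix j
        have pc: "continuous_on UNIV (poly (p j))" by (intro continuous_intros)
        show "norm ((\<integral>y. poly (p j) y \<partial>regular_kernel s t x) - (\<integral>y. f y \<partial>regular_kernel s t x)) \<le> 1 / real (Suc j)"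
          using abs_integral_diff_le[OF regular_kernel f pc p] by (simp add: abs_minus_commute)
      qed
      show "(\<lambda>j. 1 / real (Suc j)) \<longlonglongrightarrow> 0" by (rule LIMSEQ_Suc) (rule lim_1_over_n)
    qed
  next
    fix j
    have pow: "continuous_on UNIV (\<lambda>y :: real. y ^ i)" for i by (intro continuous_intros)
    have eq: "(\<integral>y. poly (p j) y \<partial>regular_kernel s t x) =
        (\<Sum>i\<le>degree (p j). coeff (p j) i * (if x \<in> support s then kernel_moment \<eta> \<theta> s t i x else 0 ^ i))" for x
      unfolding poly_altdef
      using integrable_continuous_of_AE_bounded[OF regular_kernel pow] regular_kernel_power_integral[OF st]
      by (simp add: Bochner_Integration.integral_sum)
    have [measurable]: "kernel_moment \<eta> \<theta> s t i \<in> borel_measurable borel" for i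
      by (rule borel_measurable_continuous_onI[OF continuous_on_kernel_moment])
    have [measurable]: "support s \<in> sets borel" using closed_support[OF st(1)] by simp
    show "(\<lambda>x. \<integral>y. poly (p j) y \<partial>regular_kernel s t x) \<in> borel_measurable borel"
      unfolding eq by measurable
  qed
qed

text \<open>
  The distribution functions are limits of integrals of continuous steps.
\<close>

lemma measurable_regular_kernel:
  assumes st: "0 \<le> s" "s < t"
  shows "regular_kernel s t \<in> borel \<rightarrow>\<^sub>M subprob_algebra borel"
proof (rule measurable_subprob_algebra_generated[where \<Omega> = UNIV and G = "range (\<lambda>a. {..a})"])
  show "sets (borel :: real measure) = sigma_sets UNIV (range (\<lambda>a. {..a}))"
    by (subst borel_eq_atMost) (simp add: sets_measure_of)
  show "Int_stable (range (\<lambda>a :: real. {..a}))"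
  proof (rule Int_stableI_image)
    fix a b :: real
    show "\<exists>c\<in>UNIV. {..a} \<inter> {..b} = {..c}" by (intro bexI[of _ "min a b"]) auto
  qed
  show "subprob_space (regular_kernel s t x)" for x
    using prob_space_regular_kernel[OF st] by (rule prob_space_imp_subprob_space)
  show "sets (regular_kernel s t x) = sets borel" for x by (rule sets_regular_kernel[OF st])
  have rd: "real_distribution (regular_kernel s t x)" for x
    using prob_space_regular_kernel[OF st] sets_regular_kernel[OF st]
    by (auto simp: real_distribution_def real_distribution_axioms_def)
  show "(\<lambda>x. emeasure (regular_kernel s t x) A) \<in> borel_measurable borel" if "A \<in> range (\<lambda>a. {..a})" for A
  proof -
    from that obtain a where A: "A = {..a}" by blast
    have "(\<lambda>x. cdf (regular_kernel s t x) a) \<in> borel_measurable borel"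
    proof (rule borel_measurable_LIMSEQ_real)
      fix x :: real
      interpret K: real_distribution "regular_kernel s t x" by (rule rd)
      show "(\<lambda>j. \<integral>y. cts_step a (a + 1 / real (Suc j)) y \<partial>regular_kernel s t x) \<longlonglongrightarrow> cdf (regular_kernel s t x) a"
      proof (rule tendsto_sandwich)
        show "\<forall>\<^sub>F j in sequentially. cdf (regular_kernel s t x) a \<le> (\<integral>y. cts_step a (a + 1 / real (Suc j)) y \<partial>regular_kernel s t x)"
          by (intro always_eventually allI K.cdf_cts_step(1)) simp
        show "\<forall>\<^sub>F j in sequentially. (\<integral>y. cts_step a (a + 1 / real (Suc j)) y \<partial>regular_kernel s t x) \<le> cdf (regular_kernel s t x) (a + 1 / real (Suc j))"
          by (intro always_eventually allI K.cdf_cts_step(2)) simp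
        have lim0: "(\<lambda>j. a + 1 / real (Suc j)) \<longlonglongrightarrow> a + 0"
          by (intro tendsto_add tendsto_const LIMSEQ_Suc lim_1_over_n)
        have "filterlim (\<lambda>j. a + 1 / real (Suc j)) (at_right a) sequentially"
          unfolding filterlim_at using lim0 by auto
        then show "(\<lambda>j. cdf (regular_kernel s t x) (a + 1 / real (Suc j))) \<longlonglongrightarrow> cdf (regular_kernel s t x) a"
          using K.cdf_is_right_cont[of a] unfolding continuous_within by (rule filterlim_compose[rotated])
      qed simp
    next
      fix j
      have "continuous_on UNIV (cts_step a (a + 1 / real (Suc j)))"
        by (intro uniformly_continuous_imp_continuous cts_step_uniformly_continuous) simp
      then show "(\<lambda>x. \<integral>y. cts_step a (a + 1 / real (Suc j)) y \<partial>regular_kernel s t x) \<in> borel_measurable borel"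
        by (rule measurable_regular_kernel_integral[OF st])
    qed
    then have "(\<lambda>x. ennreal (measure (regular_kernel s t x) A)) \<in> borel_measurable borel"
      by (simp add: A cdf_def)
    moreover have "emeasure (regular_kernel s t x) A = ennreal (measure (regular_kernel s t x) A)" for x
      by (rule finite_measure.emeasure_eq_measure) (rule prob_space.finite_measure[OF prob_space_regular_kernel[OF st]])
    ultimately show ?thesis by simp
  qed
  have "emeasure (regular_kernel s t x) UNIV = 1" for x
    using prob_space.emeasure_space_1[OF prob_space_regular_kernel[OF st, of x]] sets_eq_imp_space_eq[OF sets_regular_kernel[OF st, of x]]
    by simp
  then show "(\<lambda>x. emeasure (regular_kernel s t x) UNIV) \<in> borel_measurable borel" by simp
qed auto

section \<open>The Markov property\<close>

text \<open>
  Under the conditional probability given \<open>A\<close>, the law of \<open>X\<^sub>t\<close> and the mixture of the kernels at \<open>X\<^sub>s\<close> have bounded support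
  and, by \<open>conditional_moment\<close>, the same moments.
\<close>

lemma markov_nn_integral:
  assumes st: "0 \<le> s" "s < t" and A: "A \<in> sets (past s)" and h [measurable]: "h \<in> borel_measurable borel"
  shows "(\<integral>\<^sup>+ \<omega>. h (X t \<omega>) * indicator A \<omega> \<partial>M) = (\<integral>\<^sup>+ \<omega>. (\<integral>\<^sup>+ y. h y \<partial>regular_kernel s t (X s \<omega>)) * indicator A \<omega> \<partial>M)"
proof (cases "prob A = 0")
  case True
  have AM: "A \<in> sets M" using A subalgebra_past unfolding subalgebra_def by blast
  have "A \<in> null_sets M" using True AM by (intro null_setsI) (simp_all add: emeasure_eq_measure)
  then have ae: "AE \<omega> in M. \<omega> \<notin> A" by (rule AE_not_in)
  have "(\<integral>\<^sup>+ \<omega>. g \<omega> * indicator A \<omega> \<partial>M) = (\<integral>\<^sup>+ \<omega>. 0 \<partial>M)" for g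
    by (rule nn_integral_cong_AE, use ae in eventually_elim) simp
  then show ?thesis by (simp only:)
next
  case False
  have AM [measurable]: "A \<in> sets M" using A subalgebra_past unfolding subalgebra_def by blast
  have [measurable]: "X s \<in> borel_measurable M" "X t \<in> borel_measurable M"
    using X_measurable st by auto
  have "0 \<le> t" using st by simp
  then obtain C where C: "0 \<le> C" "AE \<omega> in M. \<bar>X t \<omega>\<bar> \<le> C" by (rule AE_bounded_X)
  note [measurable] = measurable_regular_kernel[OF st]
  have pA: "0 < prob A" using False measure_nonneg[of M A] by linarith
  define U where "U = uniform_measure M A"
  have [measurable_cong]: "sets U = sets M" by (simp add: U_def)
  have U: "prob_space U"
    unfolding U_def using pA by (intro prob_space_uniform_measure) (auto simp: emeasure_eq_measure)
  interpret U: prob_space U by (rule U)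
  have Kx: "(\<lambda>\<omega>. regular_kernel s t (X s \<omega>)) \<in> U \<rightarrow>\<^sub>M subprob_algebra borel" by measurable
  define \<mu> where "\<mu> = distr U borel (X t)"
  define \<nu> where "\<nu> = U \<bind> (\<lambda>\<omega>. regular_kernel s t (X s \<omega>))"
  have "\<mu> = \<nu>"
  proof (rule measure_eqI_moments)
    show "prob_space \<mu>" unfolding \<mu>_def by (rule U.prob_space_distr) measurable
    show "sets \<mu> = sets borel" by (simp add: \<mu>_def)
    show "prob_space \<nu>" unfolding \<nu>_def
      by (rule U.prob_space_bind[OF _ Kx]) (simp add: prob_space_regular_kernel[OF st])
    show \<nu>sets: "sets \<nu> = sets borel" unfolding \<nu>_def
      by (rule sets_bind) (use sets_regular_kernel[OF st] U.not_empty in auto)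
    have UC: "AE \<omega> in U. \<bar>X t \<omega>\<bar> \<le> C"
      unfolding U_def by (rule AE_uniform_measureI[OF AM]) (use C(2) in \<open>auto elim!: eventually_mono\<close>)
    show \<mu>C: "AE y in \<mu>. \<bar>y\<bar> \<le> C"
      unfolding \<mu>_def by (subst AE_distr_iff) (use UC in auto)
    show \<nu>C: "AE y in \<nu>. \<bar>y\<bar> \<le> C"
      unfolding \<nu>_def by (subst AE_bind[OF Kx]) (use AE_regular_kernel_bounded[OF st C] in auto)
    fix n
    \<comment> \<open>a bounded function that agrees with the power almost everywhere\<close>
    define c where "c y = (max (- C) (min C y)) ^ n" for y
    have cB: "norm (c y) \<le> C ^ n" for y
      unfolding c_def real_norm_def power_abs using C(1) by (intro power_mono) auto
    have c_eq: "c y = y ^ n" if "\<bar>y\<bar> \<le> C" for y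
    proof -
      have "max (- C) (min C y) = y" using that by (auto simp: abs_le_iff max_def min_def)
      then show ?thesis by (simp add: c_def)
    qed
    have [measurable]: "c \<in> borel_measurable borel" unfolding c_def by measurable
    have [measurable]: "kernel_moment \<eta> \<theta> s t n \<in> borel_measurable borel"
      by (rule borel_measurable_continuous_onI[OF continuous_on_kernel_moment])
    have supp: "AE \<omega> in U. X s \<omega> \<in> support s"
      unfolding U_def by (rule AE_uniform_measureI[OF AM]) (use AE_support[OF st(1)] in \<open>auto elim!: eventually_mono\<close>)
    have "(\<integral>y. y ^ n \<partial>\<mu>) = (\<integral>\<omega>. X t \<omega> ^ n \<partial>U)"
      unfolding \<mu>_def by (subst integral_distr) auto
    also have "\<dots> = (\<integral>\<omega>. indicator A \<omega> * X t \<omega> ^ n \<partial>M) / prob A"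
      unfolding U_def by (rule integral_uniform_measure[OF AM pA]) measurable
    also have "(\<integral>\<omega>. indicator A \<omega> * X t \<omega> ^ n \<partial>M) = (\<integral>\<omega>. indicator A \<omega> * kernel_moment \<eta> \<theta> s t n (X s \<omega>) \<partial>M)"
      using A by (intro conditional_moment st finite_moments_bounded[where B = 1]) (auto simp: indicator_def)
    also have "\<dots> / prob A = (\<integral>\<omega>. kernel_moment \<eta> \<theta> s t n (X s \<omega>) \<partial>U)"
      unfolding U_def by (rule integral_uniform_measure[OF AM pA, symmetric]) measurable
    also have "\<dots> = (\<integral>\<omega>. (\<integral>y. c y \<partial>regular_kernel s t (X s \<omega>)) \<partial>U)"
    proof (rule integral_cong_AE)
      show "AE \<omega> in U. kernel_moment \<eta> \<theta> s t n (X s \<omega>) = (\<integral>y. c y \<partial>regular_kernel s t (X s \<omega>))"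
        using supp
      proof eventually_elim
        case (elim \<omega>)
        have "(\<integral>y. c y \<partial>regular_kernel s t (X s \<omega>)) = (\<integral>y. y ^ n \<partial>regular_kernel s t (X s \<omega>))"
          using AE_regular_kernel_bounded[OF st C, of "X s \<omega>"] sets_regular_kernel[OF st]
          by (intro integral_cong_AE) (auto elim!: eventually_mono simp: c_eq cong: measurable_cong_sets)
        then show ?case using elim regular_kernel_power_integral[OF st] by simp
      qed
    qed measurable
    also have "\<dots> = (\<integral>y. c y \<partial>\<nu>)"
      unfolding \<nu>_def
    proof (rule integral_bind[symmetric])
      show "(\<lambda>\<omega>. regular_kernel s t (X s \<omega>)) \<in> U \<rightarrow>\<^sub>M subprob_algebra borel" by (rule Kx)
      show "\<bar>c y\<bar> \<le> C ^ n" for y using cB by simp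
      show "AE \<omega> in U. emeasure (regular_kernel s t (X s \<omega>)) (space (regular_kernel s t (X s \<omega>))) \<le> ennreal 1"
        by (simp add: prob_space.emeasure_space_1[OF prob_space_regular_kernel[OF st]])
    qed (measurable, unfold_locales)
    also have "\<dots> = (\<integral>y. y ^ n \<partial>\<nu>)"
      using \<nu>C \<nu>sets by (intro integral_cong_AE) (auto elim!: eventually_mono simp: c_eq cong: measurable_cong_sets)
    finally show "(\<integral>y. y ^ n \<partial>\<mu>) = (\<integral>y. y ^ n \<partial>\<nu>)" .
  qed
  have "(\<integral>\<^sup>+ \<omega>. h (X t \<omega>) \<partial>U) = (\<integral>\<^sup>+ y. h y \<partial>\<mu>)"
    unfolding \<mu>_def by (rule nn_integral_distr[symmetric]) measurable
  also have "\<dots> = (\<integral>\<^sup>+ \<omega>. \<integral>\<^sup>+ y. h y \<partial>regular_kernel s t (X s \<omega>) \<partial>U)"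
    unfolding \<open>\<mu> = \<nu>\<close> \<nu>_def by (rule nn_integral_bind[OF h Kx])
  finally have "(\<integral>\<^sup>+ \<omega>. h (X t \<omega>) \<partial>U) = (\<integral>\<^sup>+ \<omega>. \<integral>\<^sup>+ y. h y \<partial>regular_kernel s t (X s \<omega>) \<partial>U)" .
  then have "(\<integral>\<^sup>+ \<omega>. h (X t \<omega>) * indicator A \<omega> \<partial>M) / emeasure M A =
      (\<integral>\<^sup>+ \<omega>. (\<integral>\<^sup>+ y. h y \<partial>regular_kernel s t (X s \<omega>)) * indicator A \<omega> \<partial>M) / emeasure M A"
    unfolding U_def by (subst (asm) (1 2) nn_integral_uniform_measure) auto
  then have "(\<integral>\<^sup>+ \<omega>. h (X t \<omega>) * indicator A \<omega> \<partial>M) / emeasure M A * emeasure M A =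
      (\<integral>\<^sup>+ \<omega>. (\<integral>\<^sup>+ y. h y \<partial>regular_kernel s t (X s \<omega>)) * indicator A \<omega> \<partial>M) / emeasure M A * emeasure M A"
    by (rule arg_cong)
  then show ?thesis
    using pA by (simp add: ennreal_divide_times ennreal_divide_self emeasure_eq_measure)
qed

lemma state_space_borel [measurable]: "state_space \<eta> \<in> sets borel"
  unfolding state_space_def by measurable

theorem markov_process: "markov_process_on M (state_space \<eta>) (trans_kernel \<eta> \<theta>) 0 X"
  unfolding markov_process_on_def
proof (intro conjI allI impI)
  show "AE \<omega> in M. X 0 \<omega> = 0" by (rule AE_X_0)
  show "AE \<omega> in M. X t \<omega> \<in> state_space \<eta>" if "0 \<le> t" for t using that by (rule AE_state_space)
  fix s t :: real and B :: "real set"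
  assume asm: "0 \<le> s \<and> s < t \<and> B \<in> sets borel"
  then have st: "0 \<le> s" "s < t" and B [measurable]: "B \<in> sets borel" by auto
  interpret finite_measure_subalgebra M "past s" by unfold_locales (rule subalgebra_past)
  note [measurable] = measurable_regular_kernel[OF st]
  have [measurable]: "X s \<in> borel_measurable M" "X t \<in> borel_measurable M" "X s \<in> borel_measurable (past s)"
    using X_measurable past_measurable_X st by auto
  have K1: "measure (regular_kernel s t x) B \<le> 1" "emeasure (regular_kernel s t x) B = ennreal (measure (regular_kernel s t x) B)" for x
  proof -
    interpret K: prob_space "regular_kernel s t x" by (rule prob_space_regular_kernel[OF st])
    show "measure (regular_kernel s t x) B \<le> 1" by (rule K.prob_le_1)
    show "emeasure (regular_kernel s t x) B = ennreal (measure (regular_kernel s t x) B)" by (rule K.emeasure_eq_measure)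
  qed
  have "AE \<omega> in M. real_cond_exp M (past s) (\<lambda>\<omega>. indicator B (X t \<omega>)) \<omega> = measure (regular_kernel s t (X s \<omega>)) B"
  proof (rule real_cond_exp_charact)
    fix A assume A: "A \<in> sets (past s)"
    then have [measurable]: "A \<in> sets M" using subalgebra_past unfolding subalgebra_def by blast
    have "(\<integral>\<omega>\<in>A. indicator B (X t \<omega>) \<partial>M) = enn2real (\<integral>\<^sup>+\<omega>. indicator B (X t \<omega>) * indicator A \<omega> \<partial>M)"
      unfolding set_lebesgue_integral_def
      by (subst integral_eq_nn_integral) (auto intro!: arg_cong[where f = enn2real] nn_integral_cong simp: indicator_def)
    also have "(\<integral>\<^sup>+\<omega>. indicator B (X t \<omega>) * indicator A \<omega> \<partial>M)
        = (\<integral>\<^sup>+\<omega>. (\<integral>\<^sup>+y. indicator B y \<partial>regular_kernel s t (X s \<omega>)) * indicator A \<omega> \<partial>M)"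
      by (rule markov_nn_integral[OF st A]) measurable
    also have "\<dots> = (\<integral>\<^sup>+\<omega>. ennreal (indicator A \<omega> *\<^sub>R measure (regular_kernel s t (X s \<omega>)) B) \<partial>M)"
    proof (intro nn_integral_cong)
      fix \<omega>
      have "(\<integral>\<^sup>+y. indicator B y \<partial>regular_kernel s t (X s \<omega>)) = emeasure (regular_kernel s t (X s \<omega>)) B"
        by (rule nn_integral_indicator) (simp add: sets_regular_kernel[OF st])
      then show "(\<integral>\<^sup>+y. indicator B y \<partial>regular_kernel s t (X s \<omega>)) * indicator A \<omega> =
          ennreal (indicator A \<omega> *\<^sub>R measure (regular_kernel s t (X s \<omega>)) B)"
        by (simp add: K1(2) split: split_indicator)
    qed
    also have "enn2real \<dots> = (\<integral>\<omega>\<in>A. measure (regular_kernel s t (X s \<omega>)) B \<partial>M)"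
      unfolding set_lebesgue_integral_def
      by (subst integral_eq_nn_integral) auto
    finally show "(\<integral>\<omega>\<in>A. indicator B (X t \<omega>) \<partial>M) = (\<integral>\<omega>\<in>A. measure (regular_kernel s t (X s \<omega>)) B \<partial>M)" .
  next
    show "integrable M (\<lambda>\<omega>. indicator B (X t \<omega>) :: real)"
      by (rule integrable_const_bound[where B = 1]) (auto simp: indicator_def)
    show "integrable M (\<lambda>\<omega>. measure (regular_kernel s t (X s \<omega>)) B)"
      using K1(1) by (intro integrable_const_bound[where B = 1]) auto
    show "(\<lambda>\<omega>. measure (regular_kernel s t (X s \<omega>)) B) \<in> borel_measurable (past s)" by measurable
  qed
  then show "AE \<omega> in M. real_cond_exp M (past s) (\<lambda>\<omega>. indicator B (X t \<omega>)) \<omega> =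
      measure (trans_kernel \<eta> \<theta> s t (X s \<omega>)) B"
    using AE_support[OF st(1)] by eventually_elim (simp add: regular_kernel_def)
qed

lemma measurable_path_prob:
  assumes "0 \<le> s" "sorted_wrt (<) (s # map fst l)" "\<forall>(t, B)\<in>set l. B \<in> sets borel"
  shows "(\<lambda>x. path_prob (state_space \<eta>) regular_kernel s x l) \<in> borel_measurable borel"
  using assms
proof (induction l arbitrary: s)
  case (Cons tB l)
  obtain t B where tB: "tB = (t, B)" by fastforce
  have st: "0 \<le> s" "s < t" and [measurable]: "B \<in> sets borel" using Cons.prems tB by auto
  have [measurable]: "(\<lambda>x. path_prob (state_space \<eta>) regular_kernel t x l) \<in> borel_measurable borel"
    using Cons.prems tB by (intro Cons.IH) auto
  have "(\<lambda>x. \<integral>\<^sup>+ y. indicator (B \<inter> state_space \<eta>) y * path_prob (state_space \<eta>) regular_kernel t y l \<partial>regular_kernel s t x)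
      \<in> borel_measurable borel"
    by (rule measurable_compose[OF measurable_regular_kernel[OF st] nn_integral_measurable_subprob_algebra]) measurable
  then show ?case by (simp add: tB)
qed simp

text \<open>
  Induction on the list: the first event is added to \<open>A\<close> before the induction hypothesis is applied at the later time, and
  then the Markov property replaces a function of \<open>X\<^sub>t\<close> by its kernel integral.
\<close>

lemma emeasure_path:
  assumes "0 \<le> s" "sorted_wrt (<) (s # map fst l)" "\<forall>(t, B)\<in>set l. B \<in> sets borel" "A \<in> sets (past s)"
  shows "emeasure M {\<omega> \<in> A. \<forall>(t, B)\<in>set l. X t \<omega> \<in> B} =
    (\<integral>\<^sup>+ \<omega>. path_prob (state_space \<eta>) regular_kernel s (X s \<omega>) l * indicator A \<omega> \<partial>M)"
  using assms
proof (induction l arbitrary: s A)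
  case Nil
  have "A \<in> sets M" using Nil(4) subalgebra_past unfolding subalgebra_def by blast
  then show ?case by simp
next
  case (Cons tB l)
  obtain t B where tB: "tB = (t, B)" by fastforce
  have st: "0 \<le> s" "s < t" and B [measurable]: "B \<in> sets borel" using Cons.prems tB by auto
  have t: "0 \<le> t" using st by simp
  let ?E = "state_space \<eta>"
  define A' where "A' = A \<inter> {\<omega> \<in> space M. X t \<omega> \<in> B}"
  have "A \<in> sets (past t)" using Cons.prems(4) sets_sigma_gen_mono[of "{0..s}" "{0..t}" M X] st by auto
  moreover have "{\<omega> \<in> space (past t). X t \<omega> \<in> B} \<in> sets (past t)"
    using past_measurable_X[of t t] t by measurable
  ultimately have A': "A' \<in> sets (past t)" unfolding A'_def by (simp add: sets.Int)
  have AM: "A \<subseteq> space M"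
    using sets.sets_into_space[OF Cons.prems(4)] by simp
  have mp [measurable]: "(\<lambda>x. path_prob ?E regular_kernel t x l) \<in> borel_measurable borel"
    using Cons.prems tB t by (intro measurable_path_prob) auto
  have "{\<omega> \<in> A. \<forall>(t, B)\<in>set (tB # l). X t \<omega> \<in> B} = {\<omega> \<in> A'. \<forall>(t, B)\<in>set l. X t \<omega> \<in> B}"
    using AM by (auto simp: A'_def tB)
  then have "emeasure M {\<omega> \<in> A. \<forall>(t, B)\<in>set (tB # l). X t \<omega> \<in> B} =
      (\<integral>\<^sup>+ \<omega>. path_prob ?E regular_kernel t (X t \<omega>) l * indicator A' \<omega> \<partial>M)"
    using Cons.IH[OF t _ _ A'] Cons.prems tB by simp
  also have "\<dots> = (\<integral>\<^sup>+ \<omega>. (indicator (B \<inter> ?E) (X t \<omega>) * path_prob ?E regular_kernel t (X t \<omega>) l) * indicator A \<omega> \<partial>M)"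
  proof (rule nn_integral_cong_AE)
    show "AE \<omega> in M. path_prob ?E regular_kernel t (X t \<omega>) l * indicator A' \<omega> =
        (indicator (B \<inter> ?E) (X t \<omega>) * path_prob ?E regular_kernel t (X t \<omega>) l) * indicator A \<omega>"
      using AE_state_space[OF t] AE_space by eventually_elim (auto simp: A'_def indicator_def)
  qed
  also have "\<dots> = (\<integral>\<^sup>+ \<omega>. (\<integral>\<^sup>+ y. indicator (B \<inter> ?E) y * path_prob ?E regular_kernel t y l \<partial>regular_kernel s t (X s \<omega>)) * indicator A \<omega> \<partial>M)"
    by (rule markov_nn_integral[OF st Cons.prems(4)]) measurable
  finally show ?case by (simp add: tB)
qed

text \<open>
  Exceptional sets have to be propagated backwards: a null set for the law of \<open>X\<^sub>t\<close> is charged by the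
  kernel only from a null set of starting points at time \<open>s\<close>.
\<close>

lemma path_prob_kernel_eq:
  assumes "0 \<le> s" "sorted_wrt (<) (s # map fst l)" "\<forall>(t, B)\<in>set l. B \<in> sets borel"
  shows "\<exists>N\<in>sets borel. (AE \<omega> in M. X s \<omega> \<notin> N) \<and>
    (\<forall>x. x \<notin> N \<longrightarrow> path_prob (state_space \<eta>) regular_kernel s x l = path_prob (state_space \<eta>) (trans_kernel \<eta> \<theta>) s x l)"
  using assms
proof (induction l arbitrary: s)
  case Nil
  show ?case by (rule bexI[of _ "{}"]) auto
next
  case (Cons tB l)
  obtain t B where tB: "tB = (t, B)" by fastforce
  have st: "0 \<le> s" "s < t" and B [measurable]: "B \<in> sets borel" using Cons.prems tB by auto
  let ?E = "state_space \<eta>"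
  have "\<exists>N\<in>sets borel. (AE \<omega> in M. X t \<omega> \<notin> N) \<and>
      (\<forall>x. x \<notin> N \<longrightarrow> path_prob ?E regular_kernel t x l = path_prob ?E (trans_kernel \<eta> \<theta>) t x l)"
    using Cons.prems tB st by (intro Cons.IH) auto
  then obtain N where N [measurable]: "N \<in> sets borel" and AE_N: "AE \<omega> in M. X t \<omega> \<notin> N"
    and eq: "\<And>x. x \<notin> N \<Longrightarrow> path_prob ?E regular_kernel t x l = path_prob ?E (trans_kernel \<eta> \<theta>) t x l"
    by blast
  note [measurable] = measurable_regular_kernel[OF st]
  have [measurable]: "X s \<in> borel_measurable M" using X_measurable st by simp
  define N' where "N' = {x. emeasure (regular_kernel s t x) N \<noteq> 0} \<union> - support s"
  have sp: "space M \<in> sets (past s)" using sets.top[of "past s"] by simp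
  have "(\<integral>\<^sup>+ \<omega>. emeasure (regular_kernel s t (X s \<omega>)) N \<partial>M)
      = (\<integral>\<^sup>+ \<omega>. (\<integral>\<^sup>+ y. indicator N y \<partial>regular_kernel s t (X s \<omega>)) * indicator (space M) \<omega> \<partial>M)"
  proof (intro nn_integral_cong)
    fix \<omega> assume "\<omega> \<in> space M"
    moreover have "(\<integral>\<^sup>+ y. indicator N y \<partial>regular_kernel s t (X s \<omega>)) = emeasure (regular_kernel s t (X s \<omega>)) N"
      by (rule nn_integral_indicator) (simp add: sets_regular_kernel[OF st])
    ultimately show "emeasure (regular_kernel s t (X s \<omega>)) N =
        (\<integral>\<^sup>+ y. indicator N y \<partial>regular_kernel s t (X s \<omega>)) * indicator (space M) \<omega>"
      by simp
  qed
  also have "\<dots> = (\<integral>\<^sup>+ \<omega>. indicator N (X t \<omega>) * indicator (space M) \<omega> \<partial>M)"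
    by (rule markov_nn_integral[OF st sp, symmetric]) measurable
  also have "\<dots> = (\<integral>\<^sup>+ \<omega>. 0 \<partial>M)"
    using AE_N by (intro nn_integral_cong_AE) (auto elim!: eventually_mono simp: indicator_def)
  finally have "(\<integral>\<^sup>+ \<omega>. emeasure (regular_kernel s t (X s \<omega>)) N \<partial>M) = 0" by simp
  then have AE0: "AE \<omega> in M. emeasure (regular_kernel s t (X s \<omega>)) N = 0"
    by (subst (asm) nn_integral_0_iff_AE) auto
  show ?case
  proof (intro bexI[of _ N'] conjI allI impI)
    show "N' \<in> sets borel"
    proof -
      have "{x \<in> space borel. emeasure (regular_kernel s t x) N \<noteq> 0} \<in> sets borel" by measurable
      then show ?thesis using closed_support[OF st(1)] by (simp add: N'_def)
    qed
    show "AE \<omega> in M. X s \<omega> \<notin> N'"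
      using AE0 AE_support[OF st(1)] by eventually_elim (simp add: N'_def)
    fix x assume "x \<notin> N'"
    then have x: "emeasure (regular_kernel s t x) N = 0" "regular_kernel s t x = trans_kernel \<eta> \<theta> s t x"
      by (auto simp: N'_def regular_kernel_def)
    then have "AE y in trans_kernel \<eta> \<theta> s t x. y \<notin> N"
      using sets_regular_kernel[OF st, of x] by (intro AE_not_in) (auto simp: null_sets_def)
    then show "path_prob ?E regular_kernel s x (tB # l) = path_prob ?E (trans_kernel \<eta> \<theta>) s x (tB # l)"
      unfolding tB path_prob.simps x(2) by (intro nn_integral_cong_AE) (auto elim!: eventually_mono simp: eq)
  qed
qed

theorem markov_fdds: "has_markov_fdds M (state_space \<eta>) (trans_kernel \<eta> \<theta>) 0 X"
  unfolding has_markov_fdds_def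
proof (intro ballI allI impI)
  fix B0 :: "real set" and l :: "(real \<times> real set) list"
  assume B0: "B0 \<in> sets borel"
    and l: "sorted_wrt (<) (0 # map fst l) \<and> (\<forall>(t, B)\<in>set l. B \<in> sets borel)"
  let ?E = "state_space \<eta>"
  define A where "A = {\<omega> \<in> space M. X 0 \<omega> \<in> B0}"
  have "{\<omega> \<in> space (past 0). X 0 \<omega> \<in> B0} \<in> sets (past 0)"
    using past_measurable_X[of 0 0] B0 by measurable
  then have A: "A \<in> sets (past 0)" by (simp add: A_def)
  obtain N where N: "AE \<omega> in M. X 0 \<omega> \<notin> N"
    "\<And>x. x \<notin> N \<Longrightarrow> path_prob ?E regular_kernel 0 x l = path_prob ?E (trans_kernel \<eta> \<theta>) 0 x l"
    using path_prob_kernel_eq[of 0 l] l by blast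
  have "emeasure M {\<omega> \<in> space M. X 0 \<omega> \<in> B0 \<and> (\<forall>(t, B)\<in>set l. X t \<omega> \<in> B)}
      = emeasure M {\<omega> \<in> A. \<forall>(t, B)\<in>set l. X t \<omega> \<in> B}"
    by (rule arg_cong[where f = "emeasure M"]) (auto simp: A_def)
  also have "\<dots> = (\<integral>\<^sup>+ \<omega>. path_prob ?E regular_kernel 0 (X 0 \<omega>) l * indicator A \<omega> \<partial>M)"
    using l A by (intro emeasure_path) auto
  also have "\<dots> = (\<integral>\<^sup>+ \<omega>. indicator B0 0 * path_prob ?E (trans_kernel \<eta> \<theta>) 0 0 l \<partial>M)"
  proof (rule nn_integral_cong_AE)
    show "AE \<omega> in M. path_prob ?E regular_kernel 0 (X 0 \<omega>) l * indicator A \<omega> =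
        indicator B0 0 * path_prob ?E (trans_kernel \<eta> \<theta>) 0 0 l"
      using AE_X_0 N(1) AE_space
    proof eventually_elim
      case (elim \<omega>)
      then have "path_prob ?E regular_kernel 0 (X 0 \<omega>) l = path_prob ?E (trans_kernel \<eta> \<theta>) 0 0 l"
        using N(2)[of "X 0 \<omega>"] by simp
      then show ?case using elim by (simp add: A_def indicator_def)
    qed
  qed
  also have "\<dots> = indicator B0 0 * path_prob ?E (trans_kernel \<eta> \<theta>) 0 0 l"
    by (simp add: emeasure_space_1)
  finally show "emeasure M {\<omega> \<in> space M. X 0 \<omega> \<in> B0 \<and> (\<forall>(t, B)\<in>set l. X t \<omega> \<in> B)}
      = indicator B0 0 * path_prob ?E (trans_kernel \<eta> \<theta>) 0 0 l" .
qed

end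

theorem theorem3p1:
  fixes M :: "'a measure" and X :: "real \<Rightarrow> 'a \<Rightarrow> real" and \<eta> \<theta> :: real
  assumes "1 + \<eta> * \<theta> \<ge> 0"
    and "prob_space M"
    and "\<And>t. t \<ge> 0 \<Longrightarrow> X t \<in> borel_measurable M"
    and "\<And>t. t \<ge> 0 \<Longrightarrow> integrable M (\<lambda>\<omega>. (X t \<omega>)\<^sup>2)"
    and "separable_process M X"
    and "\<And>t. t \<ge> 0 \<Longrightarrow> (\<integral>\<omega>. X t \<omega> \<partial>M) = 0"
    and "\<And>s t. s \<ge> 0 \<Longrightarrow> t \<ge> 0 \<Longrightarrow> (\<integral>\<omega>. X t \<omega> * X s \<omega> \<partial>M) = min t s"
    and "\<And>s t u. 0 \<le> s \<Longrightarrow> s < t \<Longrightarrow> t < u \<Longrightarrow>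
           AE \<omega> in M. real_cond_exp M (sigma_gen M X ({0..s} \<union> {u..})) (X t) \<omega>
             = (u - t) / (u - s) * X s \<omega> + (t - s) / (u - s) * X u \<omega>"
    and "\<And>s t u. 0 \<le> s \<Longrightarrow> s < t \<Longrightarrow> t < u \<Longrightarrow>
           AE \<omega> in M. cond_var M (sigma_gen M X ({0..s} \<union> {u..})) (X t) \<omega>
             = (u - t) * (t - s) / u *
                 (1 + \<eta> * ((u * X s \<omega> - s * X u \<omega>) / (u - s))
                    + \<theta> * ((X u \<omega> - X s \<omega>) / (u - s))
                    + (X u \<omega> - X s \<omega>) * (s * X u \<omega> - u * X s \<omega>) / (u - s)\<^sup>2)"
  shows "markov_process_on M (state_space \<eta>) (trans_kernel \<eta> \<theta>) 0 X \<and>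
         has_markov_fdds M (state_space \<eta>) (trans_kernel \<eta> \<theta>) 0 X"
proof -
  interpret prob_space M by fact
  interpret quadratic_harness M X \<eta> \<theta>
    by unfold_locales (fact assms)+
  show ?thesis using markov_process markov_fdds ..
qed

end
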